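(* Let $p\ge 1$, $k\ge 1$ and $r\in\{0,\dots,p-1\}$ be integers, and let $q=p-r$. Suppose the model $(c,\{f_i\}_{i=0}^k)$ belongs to the class $\mathcal M_r$ (defined in the context), with associated $\alpha$, $\mu$, $\theta$, $\mathcal B$. Suppose that, given initial values $z_0,z_{-1},\dots,z_{-k+1}\in\mathbb R^p$ and a sequence $\{u_t\}_{t\ge1}$ in $\mathbb R^p$, the sequence $\{z_t\}$ satisfies $f_0(z_t)=c+\sum_{i=1}^k f_i(z_{t-i})+u_t$ for all $t\ge1$. Then the map $\chi:\mathbb R^p\to\mathbb R^p$ is a homeomorphism and, for all $t\ge1$, $$z_t=\chi^{-1}\left(\begin{bmatrix}\alpha_\perp^\top\bar h(\vec z_0)+\alpha_\perp^\top\sum_{s=1}^t u_s\\ -\mu\end{bmatrix}+S_\chi^\top\boldsymbol\xi_t\right),$$ where $\vec z_0=(z_0^\top,\dots,z_{-k+1}^\top)^\top$, $\bar h(\vec z_0)\defeq f_0(z_0)-\sum_{i=1}^{k-1}g_i(z_{-i})$, $$S_\chi^\top\defeq\begin{bmatrix}-\alpha_\perp^\top & 0\\ 0 & I_r\end{bmatrix}\begin{bmatrix}0_{p\times r} & I_p & \cdots & I_p\\ I_r & 0_{r\times p} & \cdots & 0_{r\times p}\end{bmatrix}\in\mathbb R^{p\times[p(k-1)+r]},$$ and $$\boldsymbol\xi_t\defeq\begin{bmatrix}\mu\\0_{p(k-1)}\end{bmatrix}+\boldsymbol\theta(z_t)+\mathbf D_0\mathbf z_t=\begin{bmatrix}\mu+\theta(z_t)\\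 \Delta\boldsymbol\zeta_t\end{bmatrix},$$ with $\mathbf z_t=(z_t^\top,\boldsymbol\zeta_{t-1}^\top)^\top$, $\boldsymbol\zeta_t=(\zeta_{1,t}^\top,\dots,\zeta_{k-1,t}^\top)^\top$, $\zeta_{j,t}=\sum_{i=j}^{k-1}g_i(z_{t-i+j})$. Moreover $\{\boldsymbol\xi_t\}$ follows the exponentially stable time-varying VAR $$\boldsymbol\xi_t=(I_{p(k-1)+r}+\boldsymbol\beta_t^\top\boldsymbol\alpha)\boldsymbol\xi_{t-1}+\boldsymbol\beta_t^\top\mathbf u_t,\qquad \mathbf u_t=(u_t^\top,0_{1\times p(k-1)})^\top,$$ with $\boldsymbol\beta_t\in\mathcal B$ for all $t$.
   Context: Model: for $c\in\mathbb R^p$ and maps $f_0,\dots,f_k:\mathbb R^p\to\mathbb R^p$ with $f_i(0)=0$, a sequence $\{z_t\}$ follows the nonlinear VAR($k$) with shocks $u_t$ if $f_0(z_t)=c+\sum_{i=1}^k f_i(z_{t-i})+u_t$. (When $k=1$, all blocks indexed by $1,\dots,k-1$ below are empty.) Define $g_j(z)=-\sum_{i=j+1}^k f_i(z)$ for $j=0,\dots,k-1$; $\pi(z)=-f_0(z)+\sum_{i=1}^k f_i(z)$; $\mathbf g(z)=(g_1(z)^\top,\dots,g_{k-1}(z)^\top)^\top\in\mathbb R^{p(k-1)}$. Let $D\in\mathbb R^{p(k-1)\times p(k-1)}$ be the block matrix with $-I_p$ in each diagonal block, $I_p$ in each block immediately above the diagonal, and zeros elsewhere; $E=(I_p,0_{p\times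 p(k-2)})^\top\in\mathbb R^{p(k-1)\times p}$. For $\alpha\in\mathbb R^{p\times r}$ of rank $r$, $\alpha_\perp$ is a $p\times(p-r)$ matrix of rank $p-r$ with $\alpha_\perp^\top\alpha=0$, and $\boldsymbol\alpha=\begin{bmatrix}\alpha & E^\top\\ 0 & I_{p(k-1)}\end{bmatrix}$. For $\theta:\mathbb R^p\to\mathbb R^r$, $\boldsymbol\theta(z)=(\theta(z)^\top,\mathbf g(z)^\top)^\top$ and $\mathbf D_0=\begin{bmatrix}0_{r\times p}&0\\0_{p(k-1)\times p}&D\end{bmatrix}$. For a bounded set $\mathcal A$ of square matrices, its joint spectral radius is $\rho_{JSR}(\mathcal A)=\limsup_{t\to\infty}\sup\{\rho(M_1\cdots M_t)^{1/t}:M_s\in\mathcal A\}$, $\rho$ the spectral radius. Class $\mathcal M_r(\alpha,\bar b,\bar\rho)$ (for $\alpha\in\mathbb R^{p\times r}$ of rank $r$, $\bar b\in\mathbb R$, $\bar\rho\in[0,1)$): the model $(c,\{f_i\}_{i=0}^k)$ belongs to it if (i) $f_0$ is a homeomorphism of $\mathbb R^p$; (ii) there exist $\mu\in\mathbb R^r$ and $\theta:\mathbb R^p\to\mathbb R^r$ with $c=\alpha\mu$ and $\pi(z)=\alpha\theta(z)$ for all $z$; (iii) there is a closed set $\mathcal B\subset\mathbb R^{kp\times[p(k-1)+r]}$ with $\max_{\boldsymbol\beta\in\mathcal B}\|\boldsymbol\beta\|\le\bar b$ and $\rho_{JSR}(\{I_{p(k-1)+r}+\boldsymbol\beta^\top\boldsymbol\alpha:\boldsymbol\beta\in\mathcal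 B\})\le\bar\rho$, such that for all $\mathbf z=(z^\top,\boldsymbol\zeta^\top)^\top,\mathbf z'=(z'^\top,\boldsymbol\zeta'^\top)^\top\in\mathbb R^p\times\mathbb R^{p(k-1)}$ there is $\boldsymbol\beta\in\mathcal B$ with $[\boldsymbol\theta(f_0^{-1}(z))+\mathbf D_0\mathbf z]-[\boldsymbol\theta(f_0^{-1}(z'))+\mathbf D_0\mathbf z']=\boldsymbol\beta^\top(\mathbf z-\mathbf z')$. $\mathcal M_r$ is the union of these classes over all $\alpha$ of rank $r$, $\bar b<\infty$, $\bar\rho<1$. Given such a model, define $h(z)=f_0(z)-\sum_{i=1}^{k-1}g_i(z)$, $\psi(z)=\alpha_\perp^\top h(z)$, and $\chi(z)=(\psi(z)^\top,\theta(z)^\top)^\top$. Exponential stability: a sequence $w_t=c_t+A_tw_{t-1}+B_tv_t$ ($t\in\mathbb N$) with $A_t\in\mathscr A$, $B_t\in\mathscr B$, $c_t\in\mathscr C$ is exponentially stable if $\mathscr B,\mathscr C$ are bounded and there exist $C<\infty$, $\rho\in[0,1)$ with $\|\prod_{s=1}^tA_s\|\le C\rho^t$ for all $t$. *)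

theory Defs
  imports "Jordan_Normal_Form.Spectral_Radius" "Jordan_Normal_Form.DL_Rank"
    "HOL-Library.Extended_Real"
begin

definition vnorm :: "real vec \<Rightarrow> real" where
  "vnorm v = sqrt (\<Sum>i<dim_vec v. (v $ i)^2)"

definition mnorm :: "real mat \<Rightarrow> real" where
  "mnorm M = sqrt (\<Sum>i<dim_row M. \<Sum>j<dim_col M. (M $$ (i,j))^2)"

definition vcont_on :: "nat \<Rightarrow> (real vec \<Rightarrow> real vec) \<Rightarrow> bool" where
  "vcont_on n F = (\<forall>x\<in>carrier_vec n. \<forall>e>0. \<exists>d>0. \<forall>y\<in>carrier_vec n.
      vnorm (y - x) < d \<longrightarrow> vnorm (F y - F x) < e)"

definition vinv :: "nat \<Rightarrow> (real vec \<Rightarrow> real vec) \<Rightarrow> real vec \<Rightarrow> real vec" where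
  "vinv n F = the_inv_into (carrier_vec n) F"

definition homeo_vec :: "nat \<Rightarrow> (real vec \<Rightarrow> real vec) \<Rightarrow> bool" where
  "homeo_vec n F = (bij_betw F (carrier_vec n) (carrier_vec n) \<and> vcont_on n F \<and> vcont_on n (vinv n F))"

definition closed_mats :: "nat \<Rightarrow> nat \<Rightarrow> real mat set \<Rightarrow> bool" where
  "closed_mats m n B = (B \<subseteq> carrier_mat m n \<and>
     (\<forall>X L. (\<forall>i. X i \<in> B) \<and> L \<in> carrier_mat m n \<and> (\<lambda>i. mnorm (X i - L)) \<longlonglongrightarrow> 0 \<longrightarrow> L \<in> B))"

definition rspec_rad :: "real mat \<Rightarrow> real" where
  "rspec_rad M = (if dim_row M = 0 then 0 else spectral_radius (map_mat complex_of_real M))"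

definition mprod_list :: "nat \<Rightarrow> real mat list \<Rightarrow> real mat" where
  "mprod_list n Ms = foldr (*) Ms (1\<^sub>m n)"

definition jsr :: "nat \<Rightarrow> real mat set \<Rightarrow> ereal" where
  "jsr n A = limsup (\<lambda>t::nat. SUP Ms \<in> {Ms. length Ms = t \<and> set Ms \<subseteq> A}.
       ereal (rspec_rad (mprod_list n Ms) powr (1 / real t)))"

fun mprod_seq :: "nat \<Rightarrow> (nat \<Rightarrow> real mat) \<Rightarrow> nat \<Rightarrow> real mat" where
  "mprod_seq n A 0 = 1\<^sub>m n"
| "mprod_seq n A (Suc t) = A (Suc t) * mprod_seq n A t"

text \<open>The recursion w_t = c_t + A_t w_(t-1) + B_t v_t, t \<ge> 1, is exponentially stable.\<close>
definition exp_stable :: "nat \<Rightarrow> (nat \<Rightarrow> real mat) \<Rightarrow> (nat \<Rightarrow> real mat) \<Rightarrow> (nat \<Rightarrow> real vec) \<Rightarrow> bool" where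
  "exp_stable n A Bs cs = ((\<exists>K. \<forall>t\<ge>1. mnorm (Bs t) \<le> K) \<and> (\<exists>K. \<forall>t\<ge>1. vnorm (cs t) \<le> K) \<and>
     (\<exists>(C::real) \<rho>. 0 \<le> \<rho> \<and> \<rho> < 1 \<and> (\<forall>t\<ge>1. mnorm (mprod_seq n A t) \<le> C * \<rho> ^ t)))"

definition vsum :: "nat \<Rightarrow> ('i \<Rightarrow> real vec) \<Rightarrow> 'i set \<Rightarrow> real vec" where
  "vsum n F I = finsum_vec TYPE(real) n F I"

definition gfun :: "nat \<Rightarrow> nat \<Rightarrow> (nat \<Rightarrow> real vec \<Rightarrow> real vec) \<Rightarrow> nat \<Rightarrow> real vec \<Rightarrow> real vec" where
  "gfun p k f j z = - vsum p (\<lambda>i. f i z) {j+1..k}"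

definition pifun :: "nat \<Rightarrow> nat \<Rightarrow> (nat \<Rightarrow> real vec \<Rightarrow> real vec) \<Rightarrow> real vec \<Rightarrow> real vec" where
  "pifun p k f z = - f 0 z + vsum p (\<lambda>i. f i z) {1..k}"

definition gstack :: "nat \<Rightarrow> nat \<Rightarrow> (nat \<Rightarrow> real vec \<Rightarrow> real vec) \<Rightarrow> real vec \<Rightarrow> real vec" where
  "gstack p k f z = vec (p*(k-1)) (\<lambda>l. gfun p k f (l div p + 1) z $ (l mod p))"

text \<open>D: -I_p on diagonal blocks, I_p on the blocks immediately above the diagonal.\<close>
definition Dmat :: "nat \<Rightarrow> nat \<Rightarrow> real mat" where
  "Dmat p k = mat (p*(k-1)) (p*(k-1)) (\<lambda>(a,b). if b = a then -1 else if b = a + p then 1 else 0)"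

definition Emat :: "nat \<Rightarrow> nat \<Rightarrow> real mat" where
  "Emat p k = mat (p*(k-1)) p (\<lambda>(a,b). if a = b then 1 else 0)"

definition boldalpha :: "nat \<Rightarrow> nat \<Rightarrow> nat \<Rightarrow> real mat \<Rightarrow> real mat" where
  "boldalpha p k r \<alpha> = four_block_mat \<alpha> (transpose_mat (Emat p k)) (0\<^sub>m (p*(k-1)) r) (1\<^sub>m (p*(k-1)))"

definition boldtheta :: "nat \<Rightarrow> nat \<Rightarrow> (nat \<Rightarrow> real vec \<Rightarrow> real vec) \<Rightarrow> (real vec \<Rightarrow> real vec) \<Rightarrow> real vec \<Rightarrow> real vec" where
  "boldtheta p k f \<theta> z = \<theta> z @\<^sub>v gstack p k f z"

definition D0mat :: "nat \<Rightarrow> nat \<Rightarrow> nat \<Rightarrow> real mat" where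
  "D0mat p k r = four_block_mat (0\<^sub>m r p) (0\<^sub>m r (p*(k-1))) (0\<^sub>m (p*(k-1)) p) (Dmat p k)"

text \<open>Membership of (c, f_0..f_k) in M_r(alpha, bbar, rhobar) with witnesses mu, theta, B.\<close>
definition in_class_M ::
  "nat \<Rightarrow> nat \<Rightarrow> nat \<Rightarrow> real mat \<Rightarrow> real \<Rightarrow> real \<Rightarrow> real vec \<Rightarrow> (nat \<Rightarrow> real vec \<Rightarrow> real vec)
   \<Rightarrow> real vec \<Rightarrow> (real vec \<Rightarrow> real vec) \<Rightarrow> real mat set \<Rightarrow> bool" where
  "in_class_M p k r \<alpha> bb \<rho>b c f \<mu> \<theta> B =
    (\<alpha> \<in> carrier_mat p r \<and> vec_space.rank p \<alpha> = r \<and> 0 \<le> \<rho>b \<and> \<rho>b < 1 \<and>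
     \<comment> \<open>(i)\<close>
     homeo_vec p (f 0) \<and>
     \<comment> \<open>(ii)\<close>
     \<mu> \<in> carrier_vec r \<and> (\<forall>z\<in>carrier_vec p. \<theta> z \<in> carrier_vec r) \<and>
     c = \<alpha> *\<^sub>v \<mu> \<and> (\<forall>z\<in>carrier_vec p. pifun p k f z = \<alpha> *\<^sub>v \<theta> z) \<and>
     \<comment> \<open>(iii)\<close>
     closed_mats (k*p) (p*(k-1)+r) B \<and> (\<forall>\<beta>\<in>B. mnorm \<beta> \<le> bb) \<and>
     jsr (p*(k-1)+r) ((\<lambda>\<beta>. 1\<^sub>m (p*(k-1)+r) + transpose_mat \<beta> * boldalpha p k r \<alpha>) ` B) \<le> ereal \<rho>b \<and>
     (\<forall>zz\<in>carrier_vec (k*p). \<forall>zz'\<in>carrier_vec (k*p). \<exists>\<beta>\<in>B.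
        (boldtheta p k f \<theta> (vinv p (f 0) (vec_first zz p)) + D0mat p k r *\<^sub>v zz)
      - (boldtheta p k f \<theta> (vinv p (f 0) (vec_first zz' p)) + D0mat p k r *\<^sub>v zz')
      = transpose_mat \<beta> *\<^sub>v (zz - zz')))"

definition var_model :: "nat \<Rightarrow> nat \<Rightarrow> real vec \<Rightarrow> (nat \<Rightarrow> real vec \<Rightarrow> real vec) \<Rightarrow> bool" where
  "var_model p k c f = (c \<in> carrier_vec p \<and>
     (\<forall>i\<le>k. (\<forall>z\<in>carrier_vec p. f i z \<in> carrier_vec p) \<and> f i (0\<^sub>v p) = 0\<^sub>v p))"

definition hfun :: "nat \<Rightarrow> nat \<Rightarrow> (nat \<Rightarrow> real vec \<Rightarrow> real vec) \<Rightarrow> real vec \<Rightarrow> real vec" where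
  "hfun p k f z = f 0 z - vsum p (\<lambda>i. gfun p k f i z) {1..k-1}"

definition chifun :: "nat \<Rightarrow> nat \<Rightarrow> (nat \<Rightarrow> real vec \<Rightarrow> real vec) \<Rightarrow> real mat \<Rightarrow> (real vec \<Rightarrow> real vec)
   \<Rightarrow> real vec \<Rightarrow> real vec" where
  "chifun p k f \<alpha>p \<theta> z = (transpose_mat \<alpha>p *\<^sub>v hfun p k f z) @\<^sub>v \<theta> z"

definition hbar :: "nat \<Rightarrow> nat \<Rightarrow> (nat \<Rightarrow> real vec \<Rightarrow> real vec) \<Rightarrow> (int \<Rightarrow> real vec) \<Rightarrow> real vec" where
  "hbar p k f z = f 0 (z 0) - vsum p (\<lambda>i. gfun p k f i (z (- int i))) {1..k-1}"

definition Schi :: "nat \<Rightarrow> nat \<Rightarrow> nat \<Rightarrow> real mat \<Rightarrow> real mat" where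
  "Schi p k r \<alpha>p =
     four_block_mat (- transpose_mat \<alpha>p) (0\<^sub>m (p-r) r) (0\<^sub>m r p) (1\<^sub>m r) *
     four_block_mat (0\<^sub>m p r) (mat p (p*(k-1)) (\<lambda>(a,b). if b mod p = a then 1 else 0))
                    (1\<^sub>m r) (0\<^sub>m r (p*(k-1)))"

definition zeta :: "nat \<Rightarrow> nat \<Rightarrow> (nat \<Rightarrow> real vec \<Rightarrow> real vec) \<Rightarrow> (int \<Rightarrow> real vec) \<Rightarrow> int \<Rightarrow> real vec" where
  "zeta p k f z t = vec (p*(k-1)) (\<lambda>l. vsum p (\<lambda>i. gfun p k f i (z (t - int i + int (l div p + 1))))
                                          {l div p + 1..k-1} $ (l mod p))"

definition xi :: "nat \<Rightarrow> nat \<Rightarrow> nat \<Rightarrow> (nat \<Rightarrow> real vec \<Rightarrow> real vec) \<Rightarrow> real vec \<Rightarrow> (real vec \<Rightarrow> real vec)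
   \<Rightarrow> (int \<Rightarrow> real vec) \<Rightarrow> int \<Rightarrow> real vec" where
  "xi p k r f \<mu> \<theta> z t = (\<mu> @\<^sub>v 0\<^sub>v (p*(k-1))) + boldtheta p k f \<theta> (z t)
       + D0mat p k r *\<^sub>v (z t @\<^sub>v zeta p k f z (t - 1))"

end

theory Submission
  imports Defs "HOL-Analysis.L2_Norm" "Jordan_Normal_Form.Schur_Decomposition"
begin

text \<open>The bound on the joint spectral radius controls eigenvalues of long products, whereas stability
  is about their norms; the bridge is the Berger--Wang theorem. Suppose all products of length \<open>L\<close>
  have norm at most \<open>\<gamma>\<^sup>L\<close> (up to a constant) with \<open>\<gamma> \<ge> 1\<close>. In a norm \<open>\<nu>\<close> adapted to \<open>\<gamma>\<close>,
  an orbit that does not shrink stays, after rescaling, in a fixed shell; if it is long, then two of its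
  points are close, so some rescaled product \<open>P\<close> is a \<open>\<nu>\<close>-contraction that nearly fixes a vector. Since its
  eigenvalues are at most \<open>1/2\<close>, this contradicts \<open>\<nu> x \<le> 3\<^sup>n \<nu> (P x - x)\<close>, which follows by
  splitting off the eigenvalues one at a time. Hence \<open>\<gamma>\<close> can be improved by a fixed factor, until
  it is below one.

  On the state space of pairs \<open>(f\<^sub>0(z), \<zeta>)\<close>, the map \<open>F\<close> of condition (iii) is such that
  \<open>x + F(zz + A x)\<close> has increments governed by the stable matrices \<open>1 + \<beta>\<^sup>T A\<close>, where \<open>A\<close> is the block
  matrix built from \<open>\<alpha>\<close>. So \<open>F\<close> takes every value exactly once on each affine subspace parallel to the
  range of \<open>A\<close>. These subspaces are the level sets of \<open>\<alpha>\<^sub>\<bottom>\<^sup>T (z - E\<^sup>T \<zeta>)\<close>, and on the states with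
  \<open>g + D \<zeta> = 0\<close> the two maps together are \<open>\<chi>\<close>; this makes \<open>\<chi>\<close> a homeomorphism. Along a path the state
  moves by \<open>A \<xi>\<close> plus the shock, which yields the autoregression for \<open>\<xi> = \<mu> + F\<close> and the
  accumulation of shocks in the first block of \<open>\<chi>\<close>.\<close>


text \<open>No extremal norm is constructed for Berger--Wang; the growth rate is improved step by
  step instead, so suprema over words need not be attained. The danger is that the rates stall at a
  limit above one, hence every constant has to be independent of the norm adapted to the current
  rate. This is why the eigenvalue argument is run in an arbitrary norm in which \<open>P\<close> is
  a contraction (its constant \<open>3 ^ n\<close> sees only the dimension), and why closeness of
  orbit points is measured in coordinates of an almost Auerbach basis, whose bounds hold for all
  norms alike.

  Neither \<chi> nor \<open>f 0\<close> is assumed to be Lipschitz. Condition (iii) does make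
  \<open>\<chi>\<close> Lipschitz in both directions when \<open>f 0 w\<close> instead of
  \<open>w\<close> is taken as the variable: upwards because the matrices in \<open>B\<close> are
  bounded, downwards because stable matrices keep a uniform distance from fixing a vector.
  Continuity of \<chi> and of its inverse is then inherited from \<open>f 0\<close> and its
  inverse.\<close>

definition vec_l1 :: "'a::real_normed_field vec \<Rightarrow> real" where
  "vec_l1 v = (\<Sum>i<dim_vec v. norm (v $ i))"

text \<open>A sum over entries bounds the operator norm for \<open>vec_l1\<close>, agrees with
  \<open>mnorm\<close> up to dimension factors, and is unchanged by passing from real to complex
  entries.\<close>

definition mat_l1 :: "'a::real_normed_field mat \<Rightarrow> real" where
  "mat_l1 A = (\<Sum>i<dim_row A. \<Sum>j<dim_col A. norm (A $$ (i,j)))"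

lemma vec_l1_nonneg [simp]: "0 \<le> vec_l1 v"
  by (simp add: vec_l1_def sum_nonneg)

lemma mat_l1_nonneg [simp]: "0 \<le> mat_l1 A"
  by (simp add: mat_l1_def sum_nonneg)

lemma vec_l1_zero [simp]: "vec_l1 (0\<^sub>v n) = 0"
  by (simp add: vec_l1_def)

lemma vec_l1_smult [simp]: "vec_l1 (c \<cdot>\<^sub>v v) = norm c * vec_l1 v"
  by (simp add: vec_l1_def norm_mult sum_distrib_left)

lemma vec_l1_add:
  assumes "x \<in> carrier_vec n" "y \<in> carrier_vec n"
  shows "vec_l1 (x + y) \<le> vec_l1 x + vec_l1 y"
proof -
  have "(\<Sum>i<n. norm (x $ i + y $ i)) \<le> (\<Sum>i<n. norm (x $ i) + norm (y $ i))"
    by (intro sum_mono norm_triangle_ineq)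
  then show ?thesis using assms by (simp add: vec_l1_def sum.distrib)
qed

lemma vec_l1_diff:
  assumes "x \<in> carrier_vec n" "y \<in> carrier_vec n"
  shows "vec_l1 (x - y) \<le> vec_l1 x + vec_l1 y"
proof -
  have "(\<Sum>i<n. norm (x $ i - y $ i)) \<le> (\<Sum>i<n. norm (x $ i) + norm (y $ i))"
    by (intro sum_mono norm_triangle_ineq4)
  then show ?thesis using assms by (simp add: vec_l1_def sum.distrib)
qed

lemma norm_index_le_vec_l1:
  assumes "i < dim_vec v"
  shows "norm (v $ i) \<le> vec_l1 v"
  unfolding vec_l1_def by (rule member_le_sum[of i _ "\<lambda>i. norm (v $ i)"]) (use assms in auto)

lemma vec_l1_mult_mat_vec_le:
  assumes "A \<in> carrier_mat m n" "x \<in> carrier_vec n"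
  shows "vec_l1 (A *\<^sub>v x) \<le> mat_l1 A * vec_l1 x"
proof -
  have "norm ((A *\<^sub>v x) $ i) \<le> (\<Sum>j<n. norm (A $$ (i,j))) * vec_l1 x" if "i < m" for i
  proof -
    have "(A *\<^sub>v x) $ i = (\<Sum>j<n. A $$ (i,j) * x $ j)"
      using assms that by (auto simp: scalar_prod_def lessThan_atLeast0 intro!: sum.cong)
    also have "norm \<dots> \<le> (\<Sum>j<n. norm (A $$ (i,j)) * vec_l1 x)"
      using assms norm_index_le_vec_l1[of _ x]
      by (intro sum_norm_le) (auto simp: norm_mult intro!: mult_left_mono)
    finally show ?thesis by (simp add: sum_distrib_right)
  qed
  then have "(\<Sum>i<m. norm ((A *\<^sub>v x) $ i)) \<le> (\<Sum>i<m. (\<Sum>j<n. norm (A $$ (i,j))) * vec_l1 x)"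
    by (intro sum_mono) auto
  then show ?thesis using assms by (simp add: vec_l1_def[of "A *\<^sub>v x"] mat_l1_def sum_distrib_right)
qed

section \<open>Norms and nearly fixed vectors\<close>

text \<open>The eigenvalues are split off one after the other; the last factor in the list acts first,
  so that the support of the vector shrinks by one coordinate in each step.\<close>
lemma upper_triangular_eigenfactors_annihilate:
  fixes U :: "'a :: comm_ring_1 mat"
  assumes U: "U \<in> carrier_mat n n" "upper_triangular U"
    and "k \<le> n" "v \<in> carrier_vec n" "\<And>i. k \<le> i \<Longrightarrow> i < n \<Longrightarrow> v $ i = 0"
  shows "foldr (\<lambda>l v. U *\<^sub>v v - l \<cdot>\<^sub>v v) (take k (diag_mat U)) v = 0\<^sub>v n"
  using assms(3-)
proof (induction k arbitrary: v)
  case 0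
  then show ?case by (auto intro!: eq_vecI)
next
  case (Suc k)
  define w where "w = U *\<^sub>v v - diag_mat U ! k \<cdot>\<^sub>v v"
  have len: "k < length (diag_mat U)" using Suc.prems U by (simp add: diag_mat_def)
  have w: "w \<in> carrier_vec n" using U Suc.prems by (auto simp: w_def)
  have "w $ i = 0" if i: "k \<le> i" "i < n" for i
  proof -
    have "(\<Sum>j=0..<n. U $$ (i,j) * v $ j) = (\<Sum>j=0..<n. if j = k then U $$ (i,k) * v $ k else 0)"
    proof (rule sum.cong)
      fix j assume j: "j \<in> {0..<n}"
      show "U $$ (i,j) * v $ j = (if j = k then U $$ (i,k) * v $ k else 0)"
      proof (cases "j < i")
        case True
        then have "U $$ (i,j) = 0" using U i by (auto simp: upper_triangular_def)
        moreover have "j = k \<Longrightarrow> U $$ (i,k) = 0" using calculation by simp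
        ultimately show ?thesis by auto
      next
        case False
        then show ?thesis using Suc.prems(3)[of j] j i by (cases "j = k") auto
      qed
    qed simp
    also have "\<dots> = U $$ (i,k) * v $ k" using Suc.prems by simp
    also have "\<dots> = U $$ (k,k) * v $ i"
    proof (cases "i = k")
      case False
      then have "U $$ (i,k) = 0" "v $ i = 0"
        using U i Suc.prems by (auto simp: upper_triangular_def)
      then show ?thesis by simp
    qed simp
    finally have "(U *\<^sub>v v) $ i = U $$ (k,k) * v $ i"
      using U Suc.prems(2) i by (simp add: scalar_prod_def)
    then show ?thesis using U Suc.prems i by (simp add: w_def diag_mat_def)
  qed
  then have "foldr (\<lambda>l v. U *\<^sub>v v - l \<cdot>\<^sub>v v) (take k (diag_mat U)) w = 0\<^sub>v n"
    using Suc.IH[of w] w Suc.prems(1) by auto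
  then show ?case using len by (simp add: take_Suc_conv_app_nth w_def)
qed

lemma foldr_factors_carrier:
  fixes P :: "'a :: comm_ring_1 mat"
  assumes "P \<in> carrier_mat n n" "v \<in> carrier_vec n"
  shows "foldr (\<lambda>l v. P *\<^sub>v v - l \<cdot>\<^sub>v v) ls v \<in> carrier_vec n"
  using assms(2) by (induction ls) (use assms in auto)

text \<open>Cayley--Hamilton in factored form: Schur triangularisation reduces it to the triangular
  case, since similarity intertwines each single factor. A list of factors is kept instead of a
  polynomial in \<open>P\<close> because the norm estimate built on it treats one eigenvalue at a
  time.\<close>

lemma eigenfactors_annihilate:
  fixes P :: "complex mat"
  assumes P: "P \<in> carrier_mat n n"
  obtains ls where "length ls = n" "\<And>l. l \<in> set ls \<Longrightarrow> eigenvalue P l"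
    "\<And>v. v \<in> carrier_vec n \<Longrightarrow> foldr (\<lambda>l v. P *\<^sub>v v - l \<cdot>\<^sub>v v) ls v = 0\<^sub>v n"
proof -
  obtain es where es: "char_poly P = (\<Prod>a\<leftarrow>es. [:- a, 1:])" "length es = n"
    using char_poly_factorized[OF P] by blast
  obtain U Q Q' where "schur_decomposition P es = (U,Q,Q')" by (cases "schur_decomposition P es")
  from schur_decomposition[OF P es(1) this]
  have sim: "similar_mat_wit P U Q Q'" and U: "upper_triangular U" and d: "diag_mat U = es" by auto
  from similar_mat_witD2[OF P sim]
  have c: "Q * Q' = 1\<^sub>m n" "P = Q * U * Q'" "U \<in> carrier_mat n n" "Q \<in> carrier_mat n n"
    "Q' \<in> carrier_mat n n" and QQ: "Q' * Q = 1\<^sub>m n" by auto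
  have intertwine: "foldr (\<lambda>l v. P *\<^sub>v v - l \<cdot>\<^sub>v v) ls (Q *\<^sub>v v)
      = Q *\<^sub>v foldr (\<lambda>l v. U *\<^sub>v v - l \<cdot>\<^sub>v v) ls v" if v: "v \<in> carrier_vec n" for ls v
  proof (induction ls)
    case Nil
    then show ?case by simp
  next
    case (Cons l ls)
    let ?w = "foldr (\<lambda>l v. U *\<^sub>v v - l \<cdot>\<^sub>v v) ls v"
    have w: "?w \<in> carrier_vec n" by (rule foldr_factors_carrier[OF c(3) v])
    have "P *\<^sub>v (Q *\<^sub>v ?w) = (Q * U * (Q' * Q)) *\<^sub>v ?w"
      using c w by (simp add: assoc_mult_mat_vec[of _ n n _ n] assoc_mult_mat[of _ n n _ n _ n])
    also have "\<dots> = Q *\<^sub>v (U *\<^sub>v ?w)" using c w QQ by (simp add: assoc_mult_mat_vec[of _ n n _ n])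
    finally show ?case using Cons c w
      by (simp add: mult_minus_distrib_mat_vec[of _ n n] mult_mat_vec[of _ n n])
  qed
  show thesis
  proof (rule that[of es])
    show "length es = n" by fact
    show "eigenvalue P l" if "l \<in> set es" for l
    proof -
      have "poly (char_poly P) l = 0" using that unfolding es(1) poly_prod_list
        by (auto simp: prod_list_zero_iff image_iff intro!: bexI[of _ l])
      then show ?thesis using eigenvalue_root_char_poly[OF P] by simp
    qed
    fix v :: "complex vec" assume v: "v \<in> carrier_vec n"
    have "v = Q *\<^sub>v (Q' *\<^sub>v v)" using c v by (simp add: assoc_mult_mat_vec[of _ n n _ n, symmetric])
    then have "foldr (\<lambda>l v. P *\<^sub>v v - l \<cdot>\<^sub>v v) es v
      = Q *\<^sub>v foldr (\<lambda>l v. U *\<^sub>v v - l \<cdot>\<^sub>v v) es (Q' *\<^sub>v v)"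
      using intertwine[of "Q' *\<^sub>v v" es] c v by auto
    also have "foldr (\<lambda>l v. U *\<^sub>v v - l \<cdot>\<^sub>v v) es (Q' *\<^sub>v v) = 0\<^sub>v n"
      using upper_triangular_eigenfactors_annihilate[OF c(3) U order_refl, of "Q' *\<^sub>v v"] c v d es(2)
      by auto
    finally show "foldr (\<lambda>l v. P *\<^sub>v v - l \<cdot>\<^sub>v v) es v = 0\<^sub>v n" using c by (auto intro!: eq_vecI)
  qed
qed

text \<open>The last assumption replaces definiteness. Having constant one there, it bounds the
  entries of all unit-ball vectors by one, whatever the norm.\<close>

locale vec_norm =
  fixes n :: nat and \<nu> :: "complex vec \<Rightarrow> real"
  assumes triangle: "x \<in> carrier_vec n \<Longrightarrow> y \<in> carrier_vec n \<Longrightarrow> \<nu> (x + y) \<le> \<nu> x + \<nu> y"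
    and scale: "x \<in> carrier_vec n \<Longrightarrow> \<nu> (c \<cdot>\<^sub>v x) = cmod c * \<nu> x"
    and l1_le: "x \<in> carrier_vec n \<Longrightarrow> vec_l1 x \<le> \<nu> x"
begin

lemma nonneg: "x \<in> carrier_vec n \<Longrightarrow> 0 \<le> \<nu> x"
  using l1_le[of x] vec_l1_nonneg[of x] by linarith

lemma zero [simp]: "\<nu> (0\<^sub>v n) = 0"
proof -
  have "0 \<cdot>\<^sub>v 0\<^sub>v n = (0\<^sub>v n :: complex vec)" by auto
  then show ?thesis using scale[of "0\<^sub>v n" 0] by simp
qed

lemma triangle_minus: "x \<in> carrier_vec n \<Longrightarrow> y \<in> carrier_vec n \<Longrightarrow> \<nu> (x - y) \<le> \<nu> x + \<nu> y"
proof -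
  assume *: "x \<in> carrier_vec n" "y \<in> carrier_vec n"
  then have "x - y = x + (-1) \<cdot>\<^sub>v y" by auto
  then show ?thesis using triangle[of x "(-1) \<cdot>\<^sub>v y"] scale[of y "-1"] * by simp
qed

text \<open>With \<open>d = P x - x\<close> and \<open>y = P x - l x\<close> one has
  \<open>(1 - l) x = y - d\<close>, where 1 - l has modulus at least 1/2, and the defect of
  \<open>y\<close> is \<open>P d - l d\<close>, of norm at most 3/2 times that of \<open>d\<close>.
  A constant \<open>C\<close> for the remaining factors thus becomes \<open>3 * C + 2\<close>;
  starting from 0 this gives \<open>3 ^ length ls - 1\<close>.\<close>

lemma norm_le_defect:
  assumes P: "P \<in> carrier_mat n n" and contr: "\<And>x. x \<in> carrier_vec n \<Longrightarrow> \<nu> (P *\<^sub>v x) \<le> \<nu> x"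
    and eig: "\<And>l. eigenvalue P l \<Longrightarrow> cmod l \<le> 1/2" and x: "x \<in> carrier_vec n"
  shows "\<nu> x \<le> 3 ^ n * \<nu> (P *\<^sub>v x - x)"
proof -
  have step: "\<nu> x \<le> (3 ^ length ls - 1) * \<nu> (P *\<^sub>v x - x)"
    if "\<forall>l\<in>set ls. cmod l \<le> 1/2" "x \<in> carrier_vec n"
      "foldr (\<lambda>l v. P *\<^sub>v v - l \<cdot>\<^sub>v v) ls x = 0\<^sub>v n" for ls x
    using that
  \<comment> \<open>The last factor acts first, so it is peeled off from the right: \<open>y\<close>
    is then annihilated by the shorter list.\<close>
  proof (induction ls arbitrary: x rule: rev_induct)
    case Nil
    then show ?case by simp
  next
    case (snoc l ls)
    define y where "y = P *\<^sub>v x - l \<cdot>\<^sub>v x"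
    define d where "d = P *\<^sub>v x - x"
    define C :: real where "C = 3 ^ length ls - 1"
    have C: "C \<ge> 0" by (simp add: C_def)
    have carr: "x \<in> carrier_vec n" "P *\<^sub>v x \<in> carrier_vec n" "y \<in> carrier_vec n" "d \<in> carrier_vec n"
      "P *\<^sub>v d \<in> carrier_vec n" "P *\<^sub>v y \<in> carrier_vec n"
      using P snoc.prems by (auto simp: y_def d_def)
    have l: "cmod l \<le> 1/2" using snoc.prems by simp
    have "P *\<^sub>v y - y = P *\<^sub>v d - l \<cdot>\<^sub>v d"
      using P carr unfolding y_def d_def
      by (intro eq_vecI) (auto simp: mult_minus_distrib_mat_vec[of _ n n] mult_mat_vec[of _ n n] algebra_simps)
    also have "\<nu> \<dots> \<le> \<nu> (P *\<^sub>v d) + cmod l * \<nu> d"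
      using triangle_minus[of "P *\<^sub>v d" "l \<cdot>\<^sub>v d"] carr scale[of d l] by simp
    also have "\<dots> \<le> (3/2) * \<nu> d"
      using contr[of d] carr mult_right_mono[OF l nonneg[of d]] by simp
    finally have py: "\<nu> (P *\<^sub>v y - y) \<le> (3/2) * \<nu> d" .
    have "\<nu> y \<le> C * \<nu> (P *\<^sub>v y - y)"
      using snoc.IH[of y] snoc.prems carr by (simp add: y_def C_def)
    also have "\<dots> \<le> C * ((3/2) * \<nu> d)" using py C by (rule mult_left_mono)
    finally have y: "\<nu> y \<le> C * ((3/2) * \<nu> d)" .
    have "(1 - l) \<cdot>\<^sub>v x = y - d"
      using carr unfolding y_def d_def by (intro eq_vecI) (auto simp: algebra_simps)
    then have "cmod (1 - l) * \<nu> x \<le> \<nu> y + \<nu> d"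
      using triangle_minus[of y d] carr scale[of x "1 - l"] by simp
    moreover have "1/2 \<le> cmod (1 - l)"
      using norm_triangle_ineq2[of 1 l] l by simp
    then have "1/2 * \<nu> x \<le> cmod (1 - l) * \<nu> x" using nonneg[of x] carr by (intro mult_right_mono) auto
    ultimately have "1/2 * \<nu> x \<le> \<nu> y + \<nu> d" using order_trans by blast
    then have "\<nu> x \<le> 2 * (\<nu> y + \<nu> d)" by simp
    also have "\<dots> \<le> (3 * C + 2) * \<nu> d" using y by (simp add: algebra_simps)
    finally show ?case by (simp add: d_def C_def algebra_simps)
  qed
  obtain ls where "length ls = n" "\<And>l. l \<in> set ls \<Longrightarrow> eigenvalue P l"
    "\<And>v. v \<in> carrier_vec n \<Longrightarrow> foldr (\<lambda>l v. P *\<^sub>v v - l \<cdot>\<^sub>v v) ls v = 0\<^sub>v n"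
    using eigenfactors_annihilate[OF P] by metis
  then have "\<nu> x \<le> (3 ^ n - 1) * \<nu> (P *\<^sub>v x - x)" using step[of ls x] eig x by auto
  also have "\<dots> \<le> 3 ^ n * \<nu> (P *\<^sub>v x - x)"
    using P x by (intro mult_right_mono nonneg) auto
  finally show ?thesis .
qed

lemma mult_mat_vec_le_coords:
  assumes A: "A \<in> carrier_mat n n" and cols: "\<And>j. j < n \<Longrightarrow> \<nu> (col A j) \<le> 1" and c: "c \<in> carrier_vec n"
  shows "\<nu> (A *\<^sub>v c) \<le> vec_l1 c"
proof -
  define s where "s m = vec n (\<lambda>i. \<Sum>j<m. A $$ (i,j) * c $ j)" for m
  have "\<nu> (s m) \<le> (\<Sum>j<m. cmod (c $ j))" if "m \<le> n" for m
    using that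
  proof (induction m)
    case 0
    have "s 0 = 0\<^sub>v n" by (auto simp: s_def)
    then show ?case by simp
  next
    case (Suc m)
    have "s (Suc m) = s m + c $ m \<cdot>\<^sub>v col A m"
      using A Suc.prems by (intro eq_vecI) (auto simp: s_def)
    then have "\<nu> (s (Suc m)) \<le> \<nu> (s m) + cmod (c $ m) * \<nu> (col A m)"
      using triangle[of "s m" "c $ m \<cdot>\<^sub>v col A m"] scale[of "col A m" "c $ m"]
        col_carrier_vec[of m n A n] A Suc.prems
      by (simp add: s_def del: sum.lessThan_Suc)
    also have "\<dots> \<le> (\<Sum>j<m. cmod (c $ j)) + cmod (c $ m) * 1"
      using Suc cols[of m] by (intro add_mono mult_left_mono) auto
    finally show ?case by simp
  qed
  from this[of n] have "\<nu> (s n) \<le> vec_l1 c" using c by (simp add: vec_l1_def)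
  moreover have "s n = A *\<^sub>v c"
    using A c by (intro eq_vecI) (auto simp: s_def scalar_prod_def lessThan_atLeast0)
  ultimately show ?thesis by simp
qed

text \<open>An approximate Auerbach basis: the unit-ball columns nearly maximise the determinant, and
  Cramer's rule bounds the coordinates of every unit-ball vector.\<close>
lemma auerbach_basis:
  obtains A where "A \<in> carrier_mat n n" "\<And>j. j < n \<Longrightarrow> \<nu> (col A j) \<le> 1"
    "\<And>x. x \<in> carrier_vec n \<Longrightarrow> \<nu> x \<le> 1 \<Longrightarrow>
      \<exists>c\<in>carrier_vec n. x = A *\<^sub>v c \<and> (\<forall>i<n. cmod (c $ i) \<le> 2)"
proof -
  define F where "F = {A. A \<in> carrier_mat n n \<and> (\<forall>j<n. \<nu> (col A j) \<le> 1)}"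
  define S where "S = (\<lambda>A. cmod (det A)) ` F"
  have entry: "cmod (A $$ (i,j)) \<le> 1" if "A \<in> F" "i < n" "j < n" for A i j
  proof -
    have "cmod (col A j $ i) \<le> vec_l1 (col A j)"
      using that by (intro norm_index_le_vec_l1) (auto simp: F_def)
    also have "\<dots> \<le> \<nu> (col A j)" using that by (intro l1_le) (auto simp: F_def)
    also have "\<dots> \<le> 1" using that by (auto simp: F_def)
    finally show ?thesis using that by (auto simp: F_def)
  qed
  \<comment> \<open>By the Leibniz formula determinants of matrices with entries of modulus at most
    one are bounded, so \<open>Sup S\<close> is meaningful.\<close>
  have "cmod (det A) \<le> (\<Sum>\<pi>\<in>{\<pi>. \<pi> permutes {0..<n}}. 1)" if A: "A \<in> F" for A
  proof -
    have "det A = (\<Sum>\<pi>\<in>{\<pi>. \<pi> permutes {0..<n}}. signof \<pi> * (\<Prod>i=0..<n. A $$ (i, \<pi> i)))"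
      using A by (auto simp: F_def det_def)
    also have "cmod \<dots> \<le> (\<Sum>\<pi>\<in>{\<pi>. \<pi> permutes {0..<n}}. 1)"
    proof (rule sum_norm_le)
      fix \<pi> assume "\<pi> \<in> {\<pi>. \<pi> permutes {0..<n}}"
      then have "\<pi> i < n" if "i < n" for i using that permutes_in_image[of \<pi> "{0..<n}" i] by auto
      then have "(\<Prod>i=0..<n. cmod (A $$ (i, \<pi> i))) \<le> 1"
        using entry[OF A] by (intro prod_le_1) auto
      then show "cmod (signof \<pi> * (\<Prod>i=0..<n. A $$ (i, \<pi> i))) \<le> 1"
        by (simp add: norm_mult prod_norm sign_def)
    qed
    finally show ?thesis .
  qed
  then have bdd: "bdd_above S" unfolding S_def by (intro bdd_aboveI2)
  \<comment> \<open>A small multiple of the identity has its columns in the unit ball, which makes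
    \<open>Sup S\<close> positive; the summand 1 keeps \<open>s\<close> positive in dimension 0
    too.\<close>
  define s where "s = 1 + (\<Sum>j<n. \<nu> (unit_vec n j))"
  have s: "s > 0" by (simp add: s_def add_pos_nonneg sum_nonneg nonneg)
  define D where "D = complex_of_real (1 / s) \<cdot>\<^sub>m 1\<^sub>m n"
  have "\<nu> (col D j) \<le> 1" if j: "j < n" for j
  proof -
    have "col D j = complex_of_real (1 / s) \<cdot>\<^sub>v unit_vec n j"
      using j by (intro eq_vecI) (auto simp: D_def)
    then have "\<nu> (col D j) = \<nu> (unit_vec n j) / s" using s by (simp add: scale norm_divide)
    moreover have "\<nu> (unit_vec n j) \<le> s"
      using member_le_sum[of j "{..<n}" "\<lambda>j. \<nu> (unit_vec n j)"] j nonneg by (auto simp: s_def)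
    ultimately show ?thesis using s by (simp add: divide_le_eq)
  qed
  then have D: "D \<in> F" by (auto simp: F_def D_def)
  have "det D \<noteq> 0" using s by (simp add: D_def det_smult)
  moreover have "cmod (det D) \<le> Sup S" using cSup_upper[OF _ bdd, of "cmod (det D)"] D by (simp add: S_def)
  ultimately have pos: "0 < Sup S" using less_le_trans zero_less_norm_iff by blast
  \<comment> \<open>No maximiser has to exist. Half the supremum is enough, at the price of the
    bound 2 instead of 1 for the coordinates.\<close>
  then obtain A where A: "A \<in> F" "Sup S / 2 < cmod (det A)"
    using less_cSup_iff[OF _ bdd, of "Sup S / 2"] D by (auto simp: S_def)
  have Ac: "A \<in> carrier_mat n n" and "det A \<noteq> 0" using A pos by (auto simp: F_def)
  from det_non_zero_imp_unit[OF this, of n]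
  obtain A' where A': "A' \<in> carrier_mat n n" "A * A' = 1\<^sub>m n"
    by (auto simp: Units_def ring_mat_def)
  show thesis
  proof (rule that[OF Ac])
    show "\<nu> (col A j) \<le> 1" if "j < n" for j using A that by (auto simp: F_def)
    fix x assume x: "x \<in> carrier_vec n" "\<nu> x \<le> 1"
    define c where "c = A' *\<^sub>v x"
    have c: "c \<in> carrier_vec n" "x = A *\<^sub>v c"
      using x A' Ac by (auto simp: c_def assoc_mult_mat_vec[of _ n n _ n, symmetric])
    have "cmod (c $ i) \<le> 2" if i: "i < n" for i
    proof -
      have "replace_col A x i \<in> F"
      proof -
        have "col (replace_col A x i) j = (if j = i then x else col A j)" if "j < n" for j
          using that x Ac by (intro eq_vecI) (auto simp: replace_col_def)
        then show ?thesis using A x Ac by (auto simp: F_def replace_col_def)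
      qed
      then have "cmod (det (replace_col A x i)) \<le> Sup S" using bdd by (auto simp: S_def intro: cSup_upper)
      then have "cmod (c $ i) * cmod (det A) \<le> Sup S"
        using cramer_lemma_mat[OF Ac c(1) i] c(2) by (simp add: norm_mult)
      also have "\<dots> \<le> 2 * cmod (det A)" using A by simp
      finally show ?thesis using \<open>det A \<noteq> 0\<close> by simp
    qed
    then show "\<exists>c\<in>carrier_vec n. x = A *\<^sub>v c \<and> (\<forall>i<n. cmod (c $ i) \<le> 2)" using c by blast
  qed
qed

end

section \<open>The Berger--Wang theorem\<close>

text \<open>The same fold as \<open>mprod_list\<close>, polymorphic so that products of complexified
  matrices are covered.\<close>

definition mat_prod :: "nat \<Rightarrow> 'a::semiring_1 mat list \<Rightarrow> 'a mat" where
  "mat_prod n Ms = foldr (*) Ms (1\<^sub>m n)"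

lemma mat_prod_Nil [simp]: "mat_prod n [] = 1\<^sub>m n"
  and mat_prod_Cons [simp]: "mat_prod n (M # Ms) = M * mat_prod n Ms"
  by (simp_all add: mat_prod_def)

lemma mat_prod_carrier [intro]: "set Ms \<subseteq> carrier_mat n n \<Longrightarrow> mat_prod n Ms \<in> carrier_mat n n"
  by (induction Ms) auto

lemma mat_prod_append:
  assumes "set Ms \<subseteq> carrier_mat n n" "set Ns \<subseteq> carrier_mat n n"
  shows "mat_prod n (Ms @ Ns) = mat_prod n Ms * mat_prod n Ns"
  using assms(1)
proof (induction Ms)
  case Nil
  then show ?case using mat_prod_carrier[OF assms(2)] by simp
next
  case (Cons M Ms)
  then show ?case
    using mat_prod_carrier[OF assms(2)] mat_prod_carrier[of Ms n]
      assoc_mult_mat[of M n n "mat_prod n Ms" n "mat_prod n Ns" n] by simp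
qed

text \<open>Pigeonhole on a grid of mesh \<open>\<delta>\<close>: real and imaginary parts of all
  coordinates are rounded down, and only finitely many cells meet the bounded region.\<close>

lemma close_pair_in_long_sequence:
  fixes \<delta> :: real
  assumes \<delta>: "\<delta> > 0"
  obtains N where "N \<ge> 1" "\<And>c :: nat \<Rightarrow> complex vec. (\<And>j i. j \<le> N \<Longrightarrow> i < n \<Longrightarrow> cmod (c j $ i) \<le> 2) \<Longrightarrow>
    \<exists>a b. a < b \<and> b \<le> N \<and> (\<forall>i<n. cmod (c b $ i - c a $ i) \<le> 2 * \<delta>)"
proof -
  define m where "m = \<lceil>2 / \<delta>\<rceil> + 1"
  define T where "T = ({..<n} \<rightarrow>\<^sub>E {-m..m} \<times> {-m..m} :: (nat \<Rightarrow> int \<times> int) set)"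
  have T: "finite T" by (simp add: T_def finite_PiE)
  show thesis
  proof (rule that[of "max 1 (card T)"])
    \<comment> \<open>The indices from 0 to \<open>?N\<close> are more numerous than the cells in
      \<open>T\<close>.\<close>
    let ?N = "max 1 (card T)"
    fix c :: "nat \<Rightarrow> complex vec"
    assume c: "\<And>j i. j \<le> ?N \<Longrightarrow> i < n \<Longrightarrow> cmod (c j $ i) \<le> 2"
    define F where "F j = restrict (\<lambda>i. (\<lfloor>Re (c j $ i) / \<delta>\<rfloor>, \<lfloor>Im (c j $ i) / \<delta>\<rfloor>)) {..<n}" for j
    have bound: "\<lfloor>a / \<delta>\<rfloor> \<in> {-m..m}" if "\<bar>a\<bar> \<le> 2" for a
    proof -
      have "a / \<delta> \<le> 2 / \<delta>" "- (2 / \<delta>) \<le> a / \<delta>"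
        using that \<delta> by (auto simp: field_simps)
      then show ?thesis unfolding m_def by simp linarith
    qed
    have "F ` {..?N} \<subseteq> T"
    proof
      fix g assume "g \<in> F ` {..?N}"
      then obtain j where j: "j \<le> ?N" "g = F j" by auto
      have "F j i \<in> {-m..m} \<times> {-m..m}" if "i < n" for i
      proof -
        have "\<bar>Re (c j $ i)\<bar> \<le> 2" "\<bar>Im (c j $ i)\<bar> \<le> 2"
          using c[OF j(1) that] abs_Re_le_cmod[of "c j $ i"] abs_Im_le_cmod[of "c j $ i"] by auto
        then show ?thesis using bound that unfolding F_def by simp
      qed
      then show "g \<in> T" unfolding T_def j(2) by (auto simp: F_def)
    qed
    then have "card (F ` {..?N}) < card {..?N}"
      using card_mono[OF T] by (simp add: less_Suc_eq_le le_max_iff_disj)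
    then have "\<not> inj_on F {..?N}" by (rule pigeonhole)
    then obtain a b where ab: "a < b" "b \<le> ?N" "F a = F b"
      unfolding inj_on_def by (metis atMost_iff linorder_neqE_nat)
    have close: "\<bar>s - t\<bar> \<le> \<delta>" if "\<lfloor>s / \<delta>\<rfloor> = \<lfloor>t / \<delta>\<rfloor>" for s t
    proof -
      have "\<bar>s / \<delta> - t / \<delta>\<bar> \<le> 1" using that by linarith
      then have "\<bar>(s - t) / \<delta>\<bar> \<le> 1" by (simp add: diff_divide_distrib)
      then show ?thesis using \<delta> by (simp add: abs_divide)
    qed
    have "cmod (c b $ i - c a $ i) \<le> 2 * \<delta>" if "i < n" for i
    proof -
      have "F a i = F b i" using ab by simp
      then have "\<bar>Re (c b $ i - c a $ i)\<bar> \<le> \<delta>" "\<bar>Im (c b $ i - c a $ i)\<bar> \<le> \<delta>"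
        using that close by (auto simp: F_def)
      then show ?thesis using cmod_le[of "c b $ i - c a $ i"] by linarith
    qed
    then show "\<exists>a b. a < b \<and> b \<le> ?N \<and> (\<forall>i<n. cmod (c b $ i - c a $ i) \<le> 2 * \<delta>)"
      using ab by blast
  qed simp
qed

text \<open>The length \<open>N\<close> does not depend on the norm; this uniformity is what makes it possible to apply
  the bound to the norms adapted to better and better growth rates.\<close>
lemma no_long_orbit_in_shell:
  obtains N :: nat where "N \<ge> 1" "\<And>\<nu> y Q. vec_norm n \<nu> \<Longrightarrow>
    (\<And>j. j \<le> N \<Longrightarrow> y j \<in> carrier_vec n \<and> \<nu> (y j) \<le> 1 \<and> 1/4 \<le> \<nu> (y j)) \<Longrightarrow>
    (\<And>a b. a < b \<Longrightarrow> b \<le> N \<Longrightarrow> Q a b \<in> carrier_mat n n \<and> Q a b *\<^sub>v y a = y b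
       \<and> (\<forall>x\<in>carrier_vec n. \<nu> (Q a b *\<^sub>v x) \<le> \<nu> x) \<and> (\<forall>l. eigenvalue (Q a b) l \<longrightarrow> cmod l \<le> 1/2)) \<Longrightarrow> False"
proof -
  \<comment> \<open>Two vectors in one cell differ in norm by at most n * 2 * \<delta>; multiplied
    by the factor \<open>3 ^ n\<close> from \<open>norm_le_defect\<close> this must stay below 1/4,
    the lower edge of the shell.\<close>
  define \<delta> :: real where "\<delta> = 1 / (16 * (n + 1) * 3 ^ n)"
  have \<delta>: "\<delta> > 0" by (simp add: \<delta>_def)
  have "3 ^ n * (n * (2 * \<delta>)) = n / (8 * (real n + 1))"
    by (simp add: \<delta>_def divide_simps)
  also have "\<dots> < 1/4" by (simp add: divide_less_eq)
  finally have small: "3 ^ n * (n * (2 * \<delta>)) < 1/4" .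
  obtain N where N: "N \<ge> 1" "\<And>c :: nat \<Rightarrow> complex vec. (\<And>j i. j \<le> N \<Longrightarrow> i < n \<Longrightarrow> cmod (c j $ i) \<le> 2) \<Longrightarrow>
    \<exists>a b. a < b \<and> b \<le> N \<and> (\<forall>i<n. cmod (c b $ i - c a $ i) \<le> 2 * \<delta>)"
    using close_pair_in_long_sequence[OF \<delta>] by metis
  show thesis
  proof (rule that[OF N(1)])
    fix \<nu> y Q
    assume "vec_norm n \<nu>" and y: "\<And>j. j \<le> N \<Longrightarrow> y j \<in> carrier_vec n \<and> \<nu> (y j) \<le> 1 \<and> 1/4 \<le> \<nu> (y j)"
      and Q: "\<And>a b. a < b \<Longrightarrow> b \<le> N \<Longrightarrow> Q a b \<in> carrier_mat n n \<and> Q a b *\<^sub>v y a = y b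
       \<and> (\<forall>x\<in>carrier_vec n. \<nu> (Q a b *\<^sub>v x) \<le> \<nu> x) \<and> (\<forall>l. eigenvalue (Q a b) l \<longrightarrow> cmod l \<le> 1/2)"
    interpret vec_norm n \<nu> by fact
    obtain A where A: "A \<in> carrier_mat n n" "\<And>j. j < n \<Longrightarrow> \<nu> (col A j) \<le> 1"
      "\<And>x. x \<in> carrier_vec n \<Longrightarrow> \<nu> x \<le> 1 \<Longrightarrow>
      \<exists>c\<in>carrier_vec n. x = A *\<^sub>v c \<and> (\<forall>i<n. cmod (c $ i) \<le> 2)"
      using auerbach_basis by metis
    have "\<forall>j\<in>{..N}. \<exists>c. c \<in> carrier_vec n \<and> y j = A *\<^sub>v c \<and> (\<forall>i<n. cmod (c $ i) \<le> 2)"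
      using A(3) y by blast
    from bchoice[OF this] obtain c where c: "\<And>j. j \<le> N \<Longrightarrow> c j \<in> carrier_vec n"
      "\<And>j. j \<le> N \<Longrightarrow> y j = A *\<^sub>v c j" "\<And>j i. j \<le> N \<Longrightarrow> i < n \<Longrightarrow> cmod (c j $ i) \<le> 2" by auto
    obtain a b where ab: "a < b" "b \<le> N" "\<forall>i<n. cmod (c b $ i - c a $ i) \<le> 2 * \<delta>"
      using N(2)[of c] c(3) by blast
    have ca: "c a \<in> carrier_vec n" "c b \<in> carrier_vec n" using c(1)[of a] c(1)[of b] ab by auto
    have "y b - y a = A *\<^sub>v (c b - c a)"
      using c(2)[of a] c(2)[of b] ab ca A(1) by (simp add: mult_minus_distrib_mat_vec[of A n n])
    then have "\<nu> (y b - y a) \<le> vec_l1 (c b - c a)"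
      using mult_mat_vec_le_coords[OF A(1,2), of "c b - c a"] ca by simp
    also have "\<dots> \<le> (\<Sum>i<n. 2 * \<delta>)"
      using ca ab(3) by (auto simp: vec_l1_def simp del: sum_constant intro!: sum_mono)
    finally have d: "\<nu> (y b - y a) \<le> n * (2 * \<delta>)" by simp
    \<comment> \<open>\<open>Q a b\<close> moves \<open>y a\<close> only to the nearby point
      \<open>y b\<close>, although its eigenvalues stay away from 1.\<close>
    have "1/4 \<le> \<nu> (y a)" using y[of a] ab by simp
    also have "\<dots> \<le> 3 ^ n * \<nu> (Q a b *\<^sub>v y a - y a)"
      using Q[OF ab(1,2)] y[of a] ab by (intro norm_le_defect) auto
    also have "\<dots> = 3 ^ n * \<nu> (y b - y a)" using Q[OF ab(1,2)] by simp
    also have "\<dots> \<le> 3 ^ n * (n * (2 * \<delta>))" by (rule mult_left_mono[OF d]) simp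
    finally show False using small by simp
  qed
qed

lemma (in vec_norm) mat_prod_le:
  assumes "\<And>M x. M \<in> S \<Longrightarrow> x \<in> carrier_vec n \<Longrightarrow> \<nu> (M *\<^sub>v x) \<le> \<gamma> * \<nu> x"
    and "S \<subseteq> carrier_mat n n" "\<gamma> \<ge> 0" "set Ms \<subseteq> S" "x \<in> carrier_vec n"
  shows "\<nu> (mat_prod n Ms *\<^sub>v x) \<le> \<gamma> ^ length Ms * \<nu> x"
  using assms(4)
proof (induction Ms)
  case Nil
  then show ?case using assms by simp
next
  case (Cons M Ms)
  let ?y = "mat_prod n Ms *\<^sub>v x"
  have P: "mat_prod n Ms \<in> carrier_mat n n" using Cons.prems assms by (intro mat_prod_carrier) auto
  then have y: "?y \<in> carrier_vec n" using assms(5) by simp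
  have "\<nu> (mat_prod n (M # Ms) *\<^sub>v x) = \<nu> (M *\<^sub>v ?y)"
    using P assms Cons.prems by (subst mat_prod_Cons, subst assoc_mult_mat_vec[of M n n _ n]) auto
  also have "\<dots> \<le> \<gamma> * \<nu> ?y" using Cons.prems y assms by simp
  also have "\<dots> \<le> \<gamma> * (\<gamma> ^ length Ms * \<nu> x)" using Cons assms by (intro mult_left_mono) auto
  finally show ?case by simp
qed

lemma eigenvalue_smult:
  fixes P :: "complex mat"
  assumes "P \<in> carrier_mat n n" "eigenvalue (c \<cdot>\<^sub>m P) l" "c \<noteq> 0"
  shows "eigenvalue P (l / c)"
proof -
  obtain v where v: "v \<in> carrier_vec n" "v \<noteq> 0\<^sub>v n" "(c \<cdot>\<^sub>m P) *\<^sub>v v = l \<cdot>\<^sub>v v"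
    using assms by (auto simp: eigenvalue_def eigenvector_def)
  have "c * (row P i \<bullet> v) = l * v $ i" if "i < n" for i
    using arg_cong[OF v(3), of "\<lambda>w. w $ i"] assms v(1) that by simp
  then have "P *\<^sub>v v = (l / c) \<cdot>\<^sub>v v"
    using assms v(1) by (intro eq_vecI) (auto simp: field_simps)
  then show ?thesis using assms v by (auto simp: eigenvalue_def eigenvector_def)
qed

text \<open>The word is cut into \<open>N\<close> blocks of length \<open>m\<close>. If the whole
  product failed to gain the factor 1/4, then the orbit of \<open>x\<close> at the block ends,
  divided by the growth allowed so far, would lie in the shell between 1/4 and 1: it cannot exceed
  1, and from below 1/4 the remaining blocks could not bring it back up. \<open>L\<close> is fixed
  before the norm, the rate and the set of matrices.\<close>

lemma long_products_contract:
  fixes \<sigma> :: real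
  assumes \<sigma>: "0 \<le> \<sigma>" "\<sigma> < 1"
  obtains L where "L \<ge> 1" "\<And>\<nu> \<gamma> S Ms x. vec_norm n \<nu> \<Longrightarrow> \<gamma> \<ge> 1 \<Longrightarrow> S \<subseteq> carrier_mat n n \<Longrightarrow>
    (\<And>M x. M \<in> S \<Longrightarrow> x \<in> carrier_vec n \<Longrightarrow> \<nu> (M *\<^sub>v x) \<le> \<gamma> * \<nu> x) \<Longrightarrow>
    (\<And>Ms l. set Ms \<subseteq> S \<Longrightarrow> length Ms \<ge> T \<Longrightarrow> eigenvalue (mat_prod n Ms) l \<Longrightarrow> cmod l \<le> \<sigma> ^ length Ms) \<Longrightarrow>
    set Ms \<subseteq> S \<Longrightarrow> length Ms = L \<Longrightarrow> x \<in> carrier_vec n \<Longrightarrow>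
    \<nu> (mat_prod n Ms *\<^sub>v x) \<le> \<gamma> ^ L / 4 * \<nu> x"
proof -
  obtain N :: nat where N: "N \<ge> 1" "\<And>\<nu> y Q. vec_norm n \<nu> \<Longrightarrow>
    (\<And>j. j \<le> N \<Longrightarrow> y j \<in> carrier_vec n \<and> \<nu> (y j) \<le> 1 \<and> 1/4 \<le> \<nu> (y j)) \<Longrightarrow>
    (\<And>a b. a < b \<Longrightarrow> b \<le> N \<Longrightarrow> Q a b \<in> carrier_mat n n \<and> Q a b *\<^sub>v y a = y b
       \<and> (\<forall>x\<in>carrier_vec n. \<nu> (Q a b *\<^sub>v x) \<le> \<nu> x) \<and> (\<forall>l. eigenvalue (Q a b) l \<longrightarrow> cmod l \<le> 1/2)) \<Longrightarrow> False"
    using no_long_orbit_in_shell[of n] by metis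
  obtain m0 where m0: "\<sigma> ^ m0 < 1/2" using real_arch_pow_inv[of "1/2" \<sigma>] \<sigma> by auto
  \<comment> \<open>A block must be long enough for the eigenvalue bound to apply (\<open>T\<close>)
    and to push eigenvalues below 1/2 (\<open>m0\<close>).\<close>
  define m where "m = max 1 (max T m0)"
  have m: "m \<ge> 1" "m \<ge> T" "m \<ge> m0" by (auto simp: m_def)
  show thesis
  proof (rule that[of "m * N"])
    show "m * N \<ge> 1" using m N by simp
    fix \<nu> and \<gamma> :: real and S :: "complex mat set" and Ms and x :: "complex vec"
    assume "vec_norm n \<nu>" and \<gamma>: "\<gamma> \<ge> 1" and S: "S \<subseteq> carrier_mat n n"
      and M: "\<And>M x. M \<in> S \<Longrightarrow> x \<in> carrier_vec n \<Longrightarrow> \<nu> (M *\<^sub>v x) \<le> \<gamma> * \<nu> x"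
      and eig: "\<And>Ms l. set Ms \<subseteq> S \<Longrightarrow> length Ms \<ge> T \<Longrightarrow> eigenvalue (mat_prod n Ms) l \<Longrightarrow> cmod l \<le> \<sigma> ^ length Ms"
      and Ms: "set Ms \<subseteq> S" "length Ms = m * N" and x: "x \<in> carrier_vec n"
    interpret vec_norm n \<nu> by fact
    have g: "\<gamma> ^ j > 0" for j using \<gamma> by simp
    have \<gamma>_abs: "\<bar>\<gamma>\<bar> = \<gamma>" using \<gamma> by simp
    \<comment> \<open>Blocks are counted from the right end of the word, because the last matrix
      acts first: \<open>sl a b\<close> leads from the orbit point after \<open>a\<close> blocks to
      the one after \<open>b\<close> blocks.\<close>
    define sl where "sl a b = take (m * (b - a)) (drop (m * (N - b)) Ms)" for a b
    have slS: "set (sl a b) \<subseteq> S" for a b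
      using Ms set_take_subset set_drop_subset unfolding sl_def by (metis subset_trans)
    have slc: "set (sl a b) \<subseteq> carrier_mat n n" for a b using slS S by blast
    have slen: "length (sl a b) = m * (b - a)" if "a \<le> b" "b \<le> N" for a b
    proof -
      have "m * (b - a) \<le> m * N - m * (N - b)"
        using that by (simp add: diff_mult_distrib2[symmetric])
      then show ?thesis using Ms by (simp add: sl_def)
    qed
    have slapp: "sl 0 b = sl a b @ sl 0 a" if "a \<le> b" "b \<le> N" for a b
    proof -
      have "sl 0 b = take (m * (b - a) + m * a) (drop (m * (N - b)) Ms)"
        using that by (simp add: sl_def add_mult_distrib2[symmetric])
      also have "\<dots> = sl a b @ take (m * a) (drop (m * (b - a) + m * (N - b)) Ms)"
        by (simp add: take_add sl_def)
      also have "m * (b - a) + m * (N - b) = m * (N - a)"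
        using that by (simp add: add_mult_distrib2[symmetric])
      finally show ?thesis by (simp add: sl_def)
    qed
    define X where "X j = mat_prod n (sl 0 j) *\<^sub>v x" for j
    have Pc: "mat_prod n (sl a b) \<in> carrier_mat n n" for a b by (rule mat_prod_carrier[OF slc])
    have Xc: "X j \<in> carrier_vec n" for j using mult_mat_vec_carrier[OF Pc x] by (simp add: X_def)
    have step: "mat_prod n (sl a b) *\<^sub>v X a = X b" if "a \<le> b" "b \<le> N" for a b
      using slapp[OF that] mat_prod_append[OF slc slc] assoc_mult_mat_vec[OF Pc Pc x] by (simp add: X_def)
    have bound: "\<nu> (mat_prod n (sl a b) *\<^sub>v w) \<le> \<gamma> ^ (m * (b - a)) * \<nu> w"
      if "a \<le> b" "b \<le> N" "w \<in> carrier_vec n" for a b w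
      using mat_prod_le[of S \<gamma> "sl a b" w, OF M S _ slS] \<gamma> slen[OF that(1,2)] that by simp
    show "\<nu> (mat_prod n Ms *\<^sub>v x) \<le> \<gamma> ^ (m * N) / 4 * \<nu> x"
    proof (rule ccontr)
      assume "\<not> ?thesis"
      moreover have "sl 0 N = Ms" using Ms by (simp add: sl_def)
      ultimately have big: "\<gamma> ^ (m * N) / 4 * \<nu> x < \<nu> (X N)" by (simp add: X_def)
      have "sl 0 0 = []" by (simp add: sl_def)
      then have X0: "X 0 = x" using x by (simp add: X_def)
      have "\<nu> (X N) \<le> \<gamma> ^ (m * N) * \<nu> x" using bound[of 0 N x] x step[of 0 N] X0 by simp
      then have "\<nu> x \<noteq> 0" using big by auto
      then have nx: "\<nu> x > 0" using nonneg[OF x] by simp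
      define s where "s j = 1 / (\<gamma> ^ (m * j) * \<nu> x)" for j
      have s: "s j > 0" for j using g nx by (simp add: s_def)
      define y where "y j = complex_of_real (s j) \<cdot>\<^sub>v X j" for j
      define Q where "Q a b = complex_of_real (1 / \<gamma> ^ (m * (b - a))) \<cdot>\<^sub>m mat_prod n (sl a b)" for a b
      have \<nu>y: "\<nu> (y j) = s j * \<nu> (X j)" for j using scale[OF Xc] s[of j] by (simp add: y_def)
      have split: "\<gamma> ^ (m * b) = \<gamma> ^ (m * (b - a)) * \<gamma> ^ (m * a)" if "a \<le> b" for a b
        using that by (simp add: power_add[symmetric] add_mult_distrib2[symmetric])
      have "\<nu> (y j) \<le> 1 \<and> 1/4 \<le> \<nu> (y j)" if j: "j \<le> N" for j
      proof
        show "\<nu> (y j) \<le> 1"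
          using bound[of 0 j x] step[of 0 j] X0 x j g[of "m * j"] nx by (simp add: \<nu>y s_def divide_le_eq)
        \<comment> \<open>The last N - j blocks multiply the norm by at most
          \<open>\<gamma> ^ (m * (N - j))\<close>, so the size at the end forces a size at
          \<open>j\<close>.\<close>
        have "\<gamma> ^ (m * N) / 4 * \<nu> x < \<gamma> ^ (m * (N - j)) * \<nu> (X j)"
          using big bound[of j N "X j"] step[of j N] Xc j by simp
        then have "\<gamma> ^ (m * (N - j)) * (\<gamma> ^ (m * j) * \<nu> x / 4) < \<gamma> ^ (m * (N - j)) * \<nu> (X j)"
          using split[OF j] by (simp add: algebra_simps)
        then have "\<gamma> ^ (m * j) * \<nu> x / 4 < \<nu> (X j)" using g by simp
        then show "1/4 \<le> \<nu> (y j)" using g[of "m * j"] nx by (simp add: \<nu>y s_def field_simps)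
      qed
      moreover have "y j \<in> carrier_vec n" for j using Xc by (simp add: y_def)
      moreover have "Q a b \<in> carrier_mat n n \<and> Q a b *\<^sub>v y a = y b
         \<and> (\<forall>x\<in>carrier_vec n. \<nu> (Q a b *\<^sub>v x) \<le> \<nu> x) \<and> (\<forall>l. eigenvalue (Q a b) l \<longrightarrow> cmod l \<le> 1/2)"
        if ab: "a < b" "b \<le> N" for a b
      proof (intro conjI ballI allI impI)
        let ?c = "complex_of_real (1 / \<gamma> ^ (m * (b - a)))"
        have c0: "?c \<noteq> 0" using \<gamma> g[of "m * (b - a)"] by auto
        show "Q a b \<in> carrier_mat n n" using Pc by (simp add: Q_def)
        have Qv: "Q a b *\<^sub>v w = ?c \<cdot>\<^sub>v (mat_prod n (sl a b) *\<^sub>v w)" if "w \<in> carrier_vec n" for w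
          using Pc[of a b] that unfolding Q_def by (intro eq_vecI) auto
        have "Q a b *\<^sub>v y a = (?c * complex_of_real (s a)) \<cdot>\<^sub>v X b"
          using Qv[of "y a"] Xc[of a] mult_mat_vec[OF Pc Xc] step[of a b] ab
          by (simp add: y_def smult_smult_assoc)
        also have "?c * complex_of_real (s a) = complex_of_real (s b)"
          using split[of a b] ab by (simp add: s_def)
        finally show "Q a b *\<^sub>v y a = y b" by (simp add: y_def)
        show "\<nu> (Q a b *\<^sub>v w) \<le> \<nu> w" if w: "w \<in> carrier_vec n" for w
        proof -
          have "\<nu> (Q a b *\<^sub>v w) = 1 / \<gamma> ^ (m * (b - a)) * \<nu> (mat_prod n (sl a b) *\<^sub>v w)"
            using Qv[OF w] scale[of "mat_prod n (sl a b) *\<^sub>v w" ?c] mult_mat_vec_carrier[OF Pc w] g[of "m * (b - a)"]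
            by (simp add: norm_divide norm_power \<gamma>_abs)
          also have "\<dots> \<le> \<nu> w"
            using bound[of a b w] ab w g[of "m * (b - a)"] by (simp add: field_simps)
          finally show ?thesis .
        qed
        fix l assume "eigenvalue (Q a b) l"
        then have "eigenvalue (mat_prod n (sl a b)) (l / ?c)"
          unfolding Q_def by (rule eigenvalue_smult[OF Pc _ c0])
        moreover have "m * 1 \<le> m * (b - a)" using ab by (intro mult_le_mono2) simp
        then have long: "T \<le> m * (b - a)" "m0 \<le> m * (b - a)" using m by linarith+
        ultimately have "cmod (l / ?c) \<le> \<sigma> ^ (m * (b - a))"
          using eig[OF slS, of a b "l / ?c"] slen[of a b] ab long by auto
        also have "\<dots> \<le> \<sigma> ^ m0" using long \<sigma> by (intro power_decreasing) auto
        finally have le: "cmod (l / ?c) \<le> 1/2" using m0 by simp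
        \<comment> \<open>Since \<gamma> \<ge> 1, the rescaling only shrinks eigenvalues.\<close>
        have "cmod l \<le> cmod (l / ?c)"
          using g[of "m * (b - a)"] \<gamma> by (simp add: norm_mult norm_power mult_left_le mult_le_cancel_left1 one_le_power)
        then show "cmod l \<le> 1/2" using le by simp
      qed
      ultimately show False using N(2)[of \<nu> y Q] vec_norm_axioms by blast
    qed
  qed
qed

text \<open>The Rota--Strang norm: the supremum over all words of the rescaled size of the image.
  Letting \<open>M\<close> act first lengthens the word by one letter and costs exactly one factor
  \<gamma>; the empty word gives the lower bound by \<open>vec_l1\<close>. The constant
  \<open>C\<close> appears only in the upper bound and so does not spoil the rate.\<close>

lemma adapted_norm:
  assumes S: "S \<subseteq> carrier_mat n n" and \<gamma>: "\<gamma> > 0"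
    and C: "\<And>Ms x. set Ms \<subseteq> S \<Longrightarrow> x \<in> carrier_vec n \<Longrightarrow>
      vec_l1 (mat_prod n Ms *\<^sub>v x) \<le> C * \<gamma> ^ length Ms * vec_l1 x"
  obtains \<nu> where "vec_norm n \<nu>" "\<And>M x. M \<in> S \<Longrightarrow> x \<in> carrier_vec n \<Longrightarrow> \<nu> (M *\<^sub>v x) \<le> \<gamma> * \<nu> x"
    "\<And>x. x \<in> carrier_vec n \<Longrightarrow> \<nu> x \<le> C * vec_l1 x"
proof -
  define I where "I = {Ms. set Ms \<subseteq> S}"
  define val where "val x Ms = vec_l1 (mat_prod n Ms *\<^sub>v x) / \<gamma> ^ length Ms" for x and Ms :: "complex mat list"
  define \<nu> where "\<nu> x = (SUP Ms\<in>I. val x Ms)" for x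
  have Pc: "mat_prod n Ms \<in> carrier_mat n n" if "Ms \<in> I" for Ms
    using that S by (intro mat_prod_carrier) (auto simp: I_def)
  have I0: "[] \<in> I" by (simp add: I_def)
  then have I: "I \<noteq> {}" by blast
  have g: "\<gamma> ^ j > 0" for j using \<gamma> by simp
  have valC: "val x Ms \<le> C * vec_l1 x" if "Ms \<in> I" "x \<in> carrier_vec n" for x Ms
    using C[of Ms x] that g[of "length Ms"] by (simp add: I_def val_def divide_le_eq algebra_simps)
  then have bdd: "bdd_above (val x ` I)" if "x \<in> carrier_vec n" for x
    using that by (intro bdd_aboveI2[where M = "C * vec_l1 x"]) auto
  have upper: "val x Ms \<le> \<nu> x" if "Ms \<in> I" "x \<in> carrier_vec n" for x Ms
    unfolding \<nu>_def using that bdd by (intro cSUP_upper) auto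
  have least: "\<nu> x \<le> b" if "\<And>Ms. Ms \<in> I \<Longrightarrow> val x Ms \<le> b" for x b
    unfolding \<nu>_def using that I by (intro cSUP_least) auto
  have l1: "vec_l1 x \<le> \<nu> x" if "x \<in> carrier_vec n" for x
    using upper[OF I0 that] that by (simp add: val_def)
  have smult: "\<nu> (c \<cdot>\<^sub>v x) \<le> cmod c * \<nu> x" if "x \<in> carrier_vec n" for c x
  proof (rule least)
    fix Ms assume Ms: "Ms \<in> I"
    have "val (c \<cdot>\<^sub>v x) Ms = cmod c * val x Ms"
      using that mult_mat_vec[OF Pc[OF Ms] that] by (simp add: val_def)
    also have "\<dots> \<le> cmod c * \<nu> x" using upper[OF Ms that] by (intro mult_left_mono) auto
    finally show "val (c \<cdot>\<^sub>v x) Ms \<le> cmod c * \<nu> x" .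
  qed
  have "vec_norm n \<nu>"
  proof
    fix x y :: "complex vec" assume xy: "x \<in> carrier_vec n" "y \<in> carrier_vec n"
    show "\<nu> (x + y) \<le> \<nu> x + \<nu> y"
    proof (rule least)
      fix Ms assume Ms: "Ms \<in> I"
      have "vec_l1 (mat_prod n Ms *\<^sub>v (x + y)) \<le> vec_l1 (mat_prod n Ms *\<^sub>v x) + vec_l1 (mat_prod n Ms *\<^sub>v y)"
        using mult_add_distrib_mat_vec[OF Pc[OF Ms] xy] Pc[OF Ms] xy vec_l1_add[of "mat_prod n Ms *\<^sub>v x" n]
        by simp
      then have "val (x + y) Ms \<le> val x Ms + val y Ms"
        using g[of "length Ms"] by (simp add: val_def add_divide_distrib[symmetric] divide_right_mono)
      then show "val (x + y) Ms \<le> \<nu> x + \<nu> y" using upper[OF Ms xy(1)] upper[OF Ms xy(2)] by linarith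
    qed
  next
    fix x :: "complex vec" and c assume x: "x \<in> carrier_vec n"
    show "\<nu> (c \<cdot>\<^sub>v x) = cmod c * \<nu> x"
    proof (cases "c = 0")
      case True
      then show ?thesis using smult[OF x, of 0] l1[of "0 \<cdot>\<^sub>v x"] x by simp
    next
      case False
      have "\<nu> x = \<nu> ((1 / c) \<cdot>\<^sub>v (c \<cdot>\<^sub>v x))" using False by (simp add: smult_smult_assoc)
      also have "\<dots> \<le> cmod (1 / c) * \<nu> (c \<cdot>\<^sub>v x)" using x by (intro smult) simp
      finally have "cmod c * \<nu> x \<le> \<nu> (c \<cdot>\<^sub>v x)" using False by (simp add: norm_divide field_simps)
      then show ?thesis using smult[OF x, of c] by simp
    qed
  qed (use l1 in auto)
  moreover have "\<nu> (M *\<^sub>v x) \<le> \<gamma> * \<nu> x" if M: "M \<in> S" and x: "x \<in> carrier_vec n" for M x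
  proof (rule least)
    fix Ms assume Ms: "Ms \<in> I"
    have MsM: "Ms @ [M] \<in> I" using Ms M by (simp add: I_def)
    have Mc: "M \<in> carrier_mat n n" using M S by blast
    have "mat_prod n (Ms @ [M]) = mat_prod n Ms * M"
      using mat_prod_append[of Ms n "[M]"] Ms S Mc by (auto simp: I_def)
    then have "mat_prod n Ms *\<^sub>v (M *\<^sub>v x) = mat_prod n (Ms @ [M]) *\<^sub>v x"
      using assoc_mult_mat_vec[OF Pc[OF Ms] Mc x] by simp
    then have "val (M *\<^sub>v x) Ms = \<gamma> * val x (Ms @ [M])" using \<gamma> by (simp add: val_def)
    also have "\<dots> \<le> \<gamma> * \<nu> x" using upper[OF MsM x] \<gamma> by simp
    finally show "val (M *\<^sub>v x) Ms \<le> \<gamma> * \<nu> x" .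
  qed
  ultimately show thesis using that least valC by blast
qed

text \<open>The constant is hidden on purpose: each improvement of the rate enlarges it, and only
  the rate is tracked.\<close>

definition growth_rate :: "nat \<Rightarrow> complex mat set \<Rightarrow> real \<Rightarrow> bool" where
  "growth_rate n S \<gamma> \<longleftrightarrow> (\<exists>C\<ge>0. \<forall>Ms x. set Ms \<subseteq> S \<longrightarrow> x \<in> carrier_vec n \<longrightarrow>
      vec_l1 (mat_prod n Ms *\<^sub>v x) \<le> C * \<gamma> ^ length Ms * vec_l1 x)"

text \<open>The nontrivial half of the Berger--Wang theorem. A growth rate
  \<open>\<gamma> \<ge> 1\<close> can always be improved by a factor that does not depend on \<open>\<gamma>\<close>.\<close>
theorem berger_wang:
  fixes S :: "complex mat set"
  assumes S: "S \<subseteq> carrier_mat n n" and b: "\<And>M. M \<in> S \<Longrightarrow> mat_l1 M \<le> b"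
    and \<sigma>: "0 \<le> \<sigma>" "\<sigma> < 1"
    and eig: "\<And>Ms l. set Ms \<subseteq> S \<Longrightarrow> length Ms \<ge> T \<Longrightarrow> eigenvalue (mat_prod n Ms) l \<Longrightarrow> cmod l \<le> \<sigma> ^ length Ms"
  obtains \<gamma> where "0 < \<gamma>" "\<gamma> < 1" "growth_rate n S \<gamma>"
proof -
  obtain L where L: "L \<ge> 1" "\<And>\<nu> \<gamma> S Ms x. vec_norm n \<nu> \<Longrightarrow> \<gamma> \<ge> 1 \<Longrightarrow> S \<subseteq> carrier_mat n n \<Longrightarrow>
    (\<And>M x. M \<in> S \<Longrightarrow> x \<in> carrier_vec n \<Longrightarrow> \<nu> (M *\<^sub>v x) \<le> \<gamma> * \<nu> x) \<Longrightarrow>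
    (\<And>Ms l. set Ms \<subseteq> S \<Longrightarrow> length Ms \<ge> T \<Longrightarrow> eigenvalue (mat_prod n Ms) l \<Longrightarrow> cmod l \<le> \<sigma> ^ length Ms) \<Longrightarrow>
    set Ms \<subseteq> S \<Longrightarrow> length Ms = L \<Longrightarrow> x \<in> carrier_vec n \<Longrightarrow>
    \<nu> (mat_prod n Ms *\<^sub>v x) \<le> \<gamma> ^ L / 4 * \<nu> x"
    using long_products_contract[OF \<sigma>] by metis
  \<comment> \<open>Gaining 1/4 on each block of length \<open>L\<close> amounts to
    \<open>\<kappa>\<close> per matrix.\<close>
  define \<kappa> where "\<kappa> = root L (1/4)"
  have \<kappa>: "0 < \<kappa>" "\<kappa> < 1" "\<kappa> ^ L = 1/4"
    using L real_root_lt_1_iff[of L "1/4"] by (auto simp: \<kappa>_def)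
  have improve: "growth_rate n S (\<gamma> * \<kappa>)" if rate: "growth_rate n S \<gamma>" and \<gamma>: "\<gamma> \<ge> 1" for \<gamma>
  proof -
    obtain C where C: "C \<ge> 0" "\<And>Ms x. set Ms \<subseteq> S \<Longrightarrow> x \<in> carrier_vec n \<Longrightarrow>
      vec_l1 (mat_prod n Ms *\<^sub>v x) \<le> C * \<gamma> ^ length Ms * vec_l1 x"
      using rate unfolding growth_rate_def by blast
    have \<gamma>0: "\<gamma> > 0" using \<gamma> by simp
    obtain \<nu> where \<nu>: "vec_norm n \<nu>" "\<And>M x. M \<in> S \<Longrightarrow> x \<in> carrier_vec n \<Longrightarrow> \<nu> (M *\<^sub>v x) \<le> \<gamma> * \<nu> x"
      "\<And>x. x \<in> carrier_vec n \<Longrightarrow> \<nu> x \<le> C * vec_l1 x"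
      using adapted_norm[OF S \<gamma>0 C(2)] by metis
    interpret vec_norm n \<nu> by fact
    \<comment> \<open>Blocks of length \<open>L\<close> are split off the word; the factor 4 pays
      for the remainder, which is shorter than \<open>L\<close>.\<close>
    have decay: "\<nu> (mat_prod n Ms *\<^sub>v x) \<le> 4 * (\<gamma> * \<kappa>) ^ length Ms * \<nu> x"
      if "set Ms \<subseteq> S" "x \<in> carrier_vec n" for Ms x
      using that
    proof (induction "length Ms" arbitrary: Ms rule: less_induct)
      case less
      show ?case
      proof (cases "length Ms < L")
        case True
        have "1/4 \<le> \<kappa> ^ length Ms" using True \<kappa> power_decreasing[of "length Ms" L \<kappa>] by linarith
        then have "\<gamma> ^ length Ms * 1 \<le> \<gamma> ^ length Ms * (4 * \<kappa> ^ length Ms)"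
          using \<gamma> by (intro mult_left_mono) auto
        then have "\<gamma> ^ length Ms * \<nu> x \<le> 4 * (\<gamma> * \<kappa>) ^ length Ms * \<nu> x"
          using less.prems nonneg[of x] by (intro mult_right_mono) (auto simp: power_mult_distrib)
        moreover have "\<nu> (mat_prod n Ms *\<^sub>v x) \<le> \<gamma> ^ length Ms * \<nu> x"
          using mat_prod_le[OF \<nu>(2) S] less.prems \<gamma> by simp
        ultimately show ?thesis by linarith
      next
        case False
        define As Bs where "As = take L Ms" and "Bs = drop L Ms"
        have sub: "set As \<subseteq> S" "set Bs \<subseteq> S" and Ms: "Ms = As @ Bs"
          using less.prems set_take_subset[of L Ms] set_drop_subset[of L Ms] by (auto simp: As_def Bs_def)
        have len: "length As = L" "length Ms = L + length Bs" "length Bs < length Ms"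
          using False L by (auto simp: As_def Bs_def)
        have c: "mat_prod n As \<in> carrier_mat n n" "mat_prod n Bs \<in> carrier_mat n n"
          using sub S by (auto intro!: mat_prod_carrier)
        let ?y = "mat_prod n Bs *\<^sub>v x"
        have y: "?y \<in> carrier_vec n" using c less.prems by simp
        have "mat_prod n Ms *\<^sub>v x = mat_prod n As *\<^sub>v ?y"
          using mat_prod_append[of As n Bs] sub S assoc_mult_mat_vec[OF c less.prems(2)] Ms by auto
        also have "\<nu> \<dots> \<le> \<gamma> ^ L / 4 * \<nu> ?y"
          by (rule L(2)[OF \<nu>(1) \<gamma> S \<nu>(2) eig sub(1) len(1) y])
        also have "\<dots> \<le> \<gamma> ^ L / 4 * (4 * (\<gamma> * \<kappa>) ^ length Bs * \<nu> x)"
          using less.hyps[OF len(3) sub(2) less.prems(2)] \<gamma> by (intro mult_left_mono) auto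
        also have "\<dots> = 4 * (\<gamma> * \<kappa>) ^ length Ms * \<nu> x"
          using \<kappa>(3) by (simp add: len(2) power_add power_mult_distrib)
        finally show ?thesis .
      qed
    qed
    have "vec_l1 (mat_prod n Ms *\<^sub>v x) \<le> (4 * C) * (\<gamma> * \<kappa>) ^ length Ms * vec_l1 x"
      if Ms: "set Ms \<subseteq> S" and x: "x \<in> carrier_vec n" for Ms x
    proof -
      have "mat_prod n Ms \<in> carrier_mat n n" using Ms S by (intro mat_prod_carrier) auto
      then have "vec_l1 (mat_prod n Ms *\<^sub>v x) \<le> \<nu> (mat_prod n Ms *\<^sub>v x)" using x by (intro l1_le) auto
      also have "\<dots> \<le> 4 * (\<gamma> * \<kappa>) ^ length Ms * \<nu> x"
        by (rule decay[OF Ms x])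
      also have "\<dots> \<le> 4 * (\<gamma> * \<kappa>) ^ length Ms * (C * vec_l1 x)"
        using \<nu>(3)[OF x] \<gamma> \<kappa> by (intro mult_left_mono) auto
      finally show ?thesis by (simp add: algebra_simps)
    qed
    then show ?thesis unfolding growth_rate_def using C(1) by (intro exI[of _ "4 * C"]) auto
  qed
  define \<gamma>0 where "\<gamma>0 = max 1 b"
  have rate0: "growth_rate n S \<gamma>0"
  proof -
    have "vec_l1 (mat_prod n Ms *\<^sub>v x) \<le> 1 * \<gamma>0 ^ length Ms * vec_l1 x"
      if "set Ms \<subseteq> S" and x: "x \<in> carrier_vec n" for Ms and x :: "complex vec"
      using that(1)
    proof (induction Ms)
      case Nil
      then show ?case using x by simp
    next
      case (Cons M Ms)
      have Mc: "M \<in> carrier_mat n n" "mat_prod n Ms \<in> carrier_mat n n"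
        using Cons.prems S by (auto intro!: mat_prod_carrier)
      have "vec_l1 (mat_prod n (M # Ms) *\<^sub>v x) = vec_l1 (M *\<^sub>v (mat_prod n Ms *\<^sub>v x))"
        using assoc_mult_mat_vec[OF Mc x] by simp
      also have "\<dots> \<le> mat_l1 M * vec_l1 (mat_prod n Ms *\<^sub>v x)"
        using Mc x by (intro vec_l1_mult_mat_vec_le[of _ n n]) auto
      also have "\<dots> \<le> \<gamma>0 * (1 * \<gamma>0 ^ length Ms * vec_l1 x)"
        using Cons b[of M] by (intro mult_mono) (auto simp: \<gamma>0_def)
      finally show ?case by simp
    qed
    then show ?thesis unfolding growth_rate_def by (intro exI[of _ 1]) auto
  qed
  have \<gamma>0: "\<gamma>0 \<ge> 1" by (simp add: \<gamma>0_def)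
  \<comment> \<open>The alternative is needed because \<open>improve\<close> applies only to rates
    at least one; once a rate drops below one, nothing remains to be done.\<close>
  have iter: "(\<exists>\<gamma>. 0 < \<gamma> \<and> \<gamma> < 1 \<and> growth_rate n S \<gamma>) \<or> growth_rate n S (\<gamma>0 * \<kappa> ^ j)" for j
  proof (induction j)
    case (Suc j)
    have "\<gamma>0 * \<kappa> ^ j > 0" using \<gamma>0 \<kappa> by simp
    then show ?case using Suc improve[of "\<gamma>0 * \<kappa> ^ j"]
      by (cases "\<gamma>0 * \<kappa> ^ j < 1") (auto simp: ac_simps)
  qed (use rate0 in simp)
  obtain j where "\<kappa> ^ j < 1 / \<gamma>0" using real_arch_pow_inv[of "1 / \<gamma>0" \<kappa>] \<gamma>0 \<kappa> by auto
  then have "\<gamma>0 * \<kappa> ^ j < 1" "\<gamma>0 * \<kappa> ^ j > 0" using \<gamma>0 \<kappa> by (auto simp: field_simps)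
  then show thesis using iter[of j] that by blast
qed

section \<open>From the joint spectral radius of real matrices to decay of norms\<close>

lemma mprod_list_eq_mat_prod: "mprod_list n Ms = mat_prod n Ms"
  by (simp add: mprod_list_def mat_prod_def)

lemma mat_prod_of_real:
  assumes "set Ms \<subseteq> carrier_mat n n"
  shows "mat_prod n (map (map_mat complex_of_real) Ms) = map_mat complex_of_real (mat_prod n Ms)"
  using assms
proof (induction Ms)
  case Nil
  then show ?case by (simp add: of_real_hom.mat_hom_one)
next
  case (Cons M Ms)
  have "map_mat complex_of_real (M * mat_prod n Ms)
      = map_mat complex_of_real M * map_mat complex_of_real (mat_prod n Ms)"
    by (rule of_real_hom.mat_hom_mult[of _ n n _ n]) (use Cons.prems mat_prod_carrier[of Ms n] in auto)
  then show ?case using Cons by simp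
qed

lemma vec_l1_of_real [simp]: "vec_l1 (map_vec complex_of_real x) = vec_l1 x"
  by (simp add: vec_l1_def)

lemma mat_l1_of_real [simp]: "mat_l1 (map_mat complex_of_real A) = mat_l1 A"
  by (simp add: mat_l1_def)

lemma eigenvalue_le_rspec_rad:
  assumes P: "P \<in> carrier_mat n n" and l: "eigenvalue (map_mat complex_of_real P) l"
  shows "cmod l \<le> rspec_rad P"
proof -
  have Pc: "map_mat complex_of_real P \<in> carrier_mat n n" using P by simp
  \<comment> \<open>In dimension 0 there is no eigenvector, so the default value of
    \<open>rspec_rad\<close> does not interfere.\<close>
  have n: "n > 0"
  proof (rule ccontr)
    assume "\<not> n > 0"
    then have "v = 0\<^sub>v n" if "v \<in> carrier_vec n" for v :: "complex vec" using that by (intro eq_vecI) auto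
    then show False using l Pc by (auto simp: eigenvalue_def eigenvector_def)
  qed
  have "cmod l \<in> norm ` spectrum (map_mat complex_of_real P)" using l by (auto simp: spectrum_def)
  then show ?thesis using spectral_radius_mem_max(2)[OF Pc n] n P by (simp add: rspec_rad_def)
qed

lemma jsr_less_imp_rspec_rad_le:
  assumes "jsr n S < ereal \<sigma>" "\<sigma> \<ge> 0"
  obtains T where "\<And>Ms. set Ms \<subseteq> S \<Longrightarrow> length Ms \<ge> T \<Longrightarrow> rspec_rad (mprod_list n Ms) \<le> \<sigma> ^ length Ms"
proof -
  define X where "X t = (SUP Ms \<in> {Ms. length Ms = t \<and> set Ms \<subseteq> S}.
       ereal (rspec_rad (mprod_list n Ms) powr (1 / real t)))" for t
  have "eventually (\<lambda>t. X t < ereal \<sigma>) sequentially"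
    using assms(1) unfolding jsr_def X_def by (rule Limsup_lessD)
  then obtain T0 where T0: "\<And>t. t \<ge> T0 \<Longrightarrow> X t < ereal \<sigma>" by (auto simp: eventually_sequentially)
  \<comment> \<open>\<open>max 1\<close> excludes the empty word, for which the exponent
    \<open>1 / real t\<close> would be the default value 0 of a division by zero.\<close>
  have "rspec_rad (mprod_list n Ms) \<le> \<sigma> ^ length Ms" if Ms: "set Ms \<subseteq> S" "length Ms \<ge> max 1 T0" for Ms
  proof -
    let ?t = "length Ms" and ?r = "rspec_rad (mprod_list n Ms)"
    have "ereal (?r powr (1 / real ?t)) \<le> X ?t"
      unfolding X_def by (rule SUP_upper) (use Ms in auto)
    also have "\<dots> < ereal \<sigma>" using T0 Ms by simp
    finally have less: "?r powr (1 / real ?t) < \<sigma>" by simp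
    show ?thesis
    proof (cases "?r \<le> 0")
      case True
      then show ?thesis using assms(2) zero_le_power[of \<sigma> ?t] by linarith
    next
      case False
      moreover have "Ms \<noteq> []" using Ms by auto
      ultimately have "?r = (?r powr (1 / real ?t)) ^ ?t"
        by (simp add: powr_realpow[symmetric] powr_powr)
      also have "\<dots> \<le> \<sigma> ^ ?t" using less by (intro power_mono) auto
      finally show ?thesis .
    qed
  qed
  then show thesis by (rule that)
qed

text \<open>A number \<open>s\<close> strictly between the joint spectral radius and 1 turns the
  limit superior into the bound \<open>s ^ t\<close> for the eigenvalues of all long products.
  Berger--Wang is then applied to the complexified family, which acts on real vectors with the same
  \<open>vec_l1\<close>.\<close>

lemma jsr_imp_exponential_decay:
  fixes S :: "real mat set"
  assumes S: "S \<subseteq> carrier_mat n n" and b: "\<And>M. M \<in> S \<Longrightarrow> mat_l1 M \<le> b"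
    and jsr: "jsr n S < 1"
  obtains C \<gamma> where "C \<ge> 0" "0 < \<gamma>" "\<gamma> < 1" "\<And>Ms x. set Ms \<subseteq> S \<Longrightarrow> x \<in> carrier_vec n \<Longrightarrow>
      vec_l1 (mat_prod n Ms *\<^sub>v x) \<le> C * \<gamma> ^ length Ms * vec_l1 x"
proof -
  let ?h = "map_mat complex_of_real"
  \<comment> \<open>\<open>max 0\<close> makes \<open>s\<close> nonnegative even for empty
    \<open>S\<close>, where the suprema are minus infinity.\<close>
  obtain s where "max 0 (jsr n S) < ereal s" "ereal s < 1"
    using ereal_dense2[of "max 0 (jsr n S)" 1] jsr by auto
  then have s: "0 \<le> s" "s < 1" "jsr n S < ereal s" by auto
  obtain T where T: "\<And>Ms. set Ms \<subseteq> S \<Longrightarrow> length Ms \<ge> T \<Longrightarrow> rspec_rad (mprod_list n Ms) \<le> s ^ length Ms"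
    using jsr_less_imp_rspec_rad_le[OF s(3,1)] by metis
  have sub: "?h ` S \<subseteq> carrier_mat n n" using S by auto
  have bnd: "mat_l1 M \<le> b" if "M \<in> ?h ` S" for M using b that by auto
  have eig: "cmod l \<le> s ^ length Ms"
    if Ms: "set Ms \<subseteq> ?h ` S" "length Ms \<ge> T" "eigenvalue (mat_prod n Ms) l" for Ms l
  proof -
    have "Ms \<in> lists (?h ` S)" using Ms by auto
    then obtain Ns where Ns: "Ms = map ?h Ns" "set Ns \<subseteq> S" by (auto simp: lists_image)
    have Nc: "set Ns \<subseteq> carrier_mat n n" using Ns S by blast
    have "cmod l \<le> rspec_rad (mprod_list n Ns)"
      using Ms(3) eigenvalue_le_rspec_rad[OF mat_prod_carrier[OF Nc], of l]
      by (simp add: Ns mat_prod_of_real[OF Nc] mprod_list_eq_mat_prod)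
    also have "\<dots> \<le> s ^ length Ns" using T Ns Ms by simp
    finally show ?thesis by (simp add: Ns)
  qed
  obtain \<gamma> where \<gamma>: "0 < \<gamma>" "\<gamma> < 1" "growth_rate n (?h ` S) \<gamma>"
    by (rule berger_wang[OF sub _ s(1,2), of b T]) (use bnd eig in blast)+
  then obtain C where C: "C \<ge> 0" "\<And>Ms x. set Ms \<subseteq> ?h ` S \<Longrightarrow> x \<in> carrier_vec n \<Longrightarrow>
      vec_l1 (mat_prod n Ms *\<^sub>v x) \<le> C * \<gamma> ^ length Ms * vec_l1 x"
    unfolding growth_rate_def by blast
  show thesis
  proof (rule that[OF C(1) \<gamma>(1,2)])
    fix Ms :: "real mat list" and x :: "real vec" assume Ms: "set Ms \<subseteq> S" and x: "x \<in> carrier_vec n"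
    have Mc: "set Ms \<subseteq> carrier_mat n n" using Ms S by blast
    have "mat_prod n (map ?h Ms) *\<^sub>v map_vec complex_of_real x = map_vec complex_of_real (mat_prod n Ms *\<^sub>v x)"
      unfolding mat_prod_of_real[OF Mc]
      by (rule of_real_hom.mult_mat_vec_hom[OF mat_prod_carrier[OF Mc] x, symmetric])
    then show "vec_l1 (mat_prod n Ms *\<^sub>v x) \<le> C * \<gamma> ^ length Ms * vec_l1 x"
      using C(2)[of "map ?h Ms" "map_vec complex_of_real x"] Ms x by auto
  qed
qed

section \<open>Exponentially stable families of matrices\<close>

lemma vnorm_eq_L2_set: "vnorm v = L2_set (\<lambda>i. v $ i) {..<dim_vec v}"
  by (simp add: vnorm_def L2_set_def)

lemma mnorm_eq_L2_set: "mnorm M = L2_set (\<lambda>(i,j). M $$ (i,j)) ({..<dim_row M} \<times> {..<dim_col M})"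
  by (simp add: mnorm_def L2_set_def sum.cartesian_product case_prod_unfold)

lemma mat_l1_eq_sum: "mat_l1 M = (\<Sum>(i,j)\<in>{..<dim_row M} \<times> {..<dim_col M}. norm (M $$ (i,j)))"
  by (simp add: mat_l1_def sum.cartesian_product)

lemma vnorm_le_vec_l1: "vnorm v \<le> vec_l1 v"
  unfolding vnorm_eq_L2_set vec_l1_def real_norm_def by (rule L2_set_le_sum_abs)

lemma vec_l1_le_vnorm: "vec_l1 v \<le> dim_vec v * vnorm v"
proof -
  have "\<bar>v $ i\<bar> \<le> vnorm v" if "i < dim_vec v" for i
    using member_le_L2_set[of "{..<dim_vec v}" i "\<lambda>i. \<bar>v $ i\<bar>"] that
    by (simp add: vnorm_eq_L2_set L2_set_def)
  then show ?thesis using sum_bounded_above[of "{..<dim_vec v}" "\<lambda>i. \<bar>v $ i\<bar>" "vnorm v"]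
    by (simp add: vec_l1_def)
qed

lemma mnorm_le_mat_l1: "mnorm M \<le> mat_l1 M"
  unfolding mnorm_eq_L2_set mat_l1_eq_sum real_norm_def
  by (rule order_trans[OF L2_set_le_sum_abs]) (simp add: case_prod_unfold)

lemma mat_l1_le_mnorm: "mat_l1 M \<le> dim_row M * dim_col M * mnorm (M :: real mat)"
proof -
  let ?I = "{..<dim_row M} \<times> {..<dim_col M}"
  have "\<bar>M $$ ij\<bar> \<le> mnorm M" if "ij \<in> ?I" for ij
    using member_le_L2_set[of ?I ij "\<lambda>ij. \<bar>M $$ ij\<bar>"] that
    by (simp add: mnorm_eq_L2_set L2_set_def)
  then show ?thesis using sum_bounded_above[of ?I "\<lambda>ij. \<bar>M $$ ij\<bar>" "mnorm M"]
    by (simp add: mat_l1_eq_sum)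
qed

lemma mat_l1_transpose [simp]: "mat_l1 (transpose_mat A) = mat_l1 A"
proof -
  have "mat_l1 (transpose_mat A) = (\<Sum>j<dim_col A. \<Sum>i<dim_row A. norm (A $$ (i,j)))"
    by (simp add: mat_l1_def)
  also have "\<dots> = mat_l1 A" unfolding mat_l1_def by (rule sum.swap)
  finally show ?thesis .
qed

lemma mnorm_transpose [simp]: "mnorm (transpose_mat A) = mnorm A"
proof -
  have "mnorm (transpose_mat A) = sqrt (\<Sum>j<dim_col A. \<Sum>i<dim_row A. (A $$ (i,j))\<^sup>2)"
    by (simp add: mnorm_def)
  also have "\<dots> = mnorm A" unfolding mnorm_def by (subst sum.swap) (rule refl)
  finally show ?thesis .
qed

lemma mat_l1_add_le:
  assumes "A \<in> carrier_mat m n" "B \<in> carrier_mat m n"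
  shows "mat_l1 (A + B) \<le> mat_l1 A + mat_l1 B"
proof -
  have "(\<Sum>i<m. \<Sum>j<n. norm (A $$ (i,j) + B $$ (i,j))) \<le> (\<Sum>i<m. \<Sum>j<n. norm (A $$ (i,j)) + norm (B $$ (i,j)))"
    by (intro sum_mono norm_triangle_ineq)
  then show ?thesis using assms by (simp add: mat_l1_def sum.distrib)
qed

lemma mat_l1_eq_sum_col:
  assumes "A \<in> carrier_mat m n"
  shows "mat_l1 A = (\<Sum>j<n. vec_l1 (col A j))"
proof -
  have "mat_l1 A = (\<Sum>j<n. \<Sum>i<m. norm (A $$ (i,j)))"
    using assms unfolding mat_l1_def by (subst sum.swap) auto
  then show ?thesis using assms by (simp add: vec_l1_def)
qed

lemma mat_l1_mult_le:
  assumes "A \<in> carrier_mat m n" "B \<in> carrier_mat n q"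
  shows "mat_l1 (A * B) \<le> mat_l1 A * mat_l1 B"
proof -
  have "mat_l1 (A * B) = (\<Sum>j<q. vec_l1 (A *\<^sub>v col B j))"
    using mat_l1_eq_sum_col[of "A * B" m q] assms col_mult2[OF assms] by simp
  also have "\<dots> \<le> (\<Sum>j<q. mat_l1 A * vec_l1 (col B j))"
    using assms by (intro sum_mono vec_l1_mult_mat_vec_le) auto
  finally show ?thesis using assms mat_l1_eq_sum_col[OF assms(2)] by (simp add: sum_distrib_left)
qed

locale decaying_family =
  fixes n :: nat and S :: "real mat set" and C \<gamma> b :: real
  assumes carrier: "S \<subseteq> carrier_mat n n"
    and bounded: "M \<in> S \<Longrightarrow> mat_l1 M \<le> b"
    and C: "C \<ge> 0" and \<gamma>: "0 < \<gamma>" "\<gamma> < 1"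
    and decay: "set Ms \<subseteq> S \<Longrightarrow> x \<in> carrier_vec n \<Longrightarrow>
      vec_l1 (mat_prod n Ms *\<^sub>v x) \<le> C * \<gamma> ^ length Ms * vec_l1 x"
begin

text \<open>Only the products of the matrices contract, not the matrices themselves, so the plain
  contraction principle does not apply to \<open>G\<close>.\<close>
lemma fixed_point_exists:
  assumes G: "\<And>x. x \<in> carrier_vec n \<Longrightarrow> G x \<in> carrier_vec n"
    and diff: "\<And>x y. x \<in> carrier_vec n \<Longrightarrow> y \<in> carrier_vec n \<Longrightarrow> \<exists>M\<in>S. G x - G y = M *\<^sub>v (x - y)"
  shows "\<exists>x\<in>carrier_vec n. G x = x"
proof -
  define X where "X j = (G ^^ j) (0\<^sub>v n)" for j
  have X: "X j \<in> carrier_vec n" for j by (induction j) (auto simp: X_def G)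
  have XS: "X (Suc j) = G (X j)" for j by (simp add: X_def)
  define D where "D j = X (Suc j) - X j" for j
  have Dc: "D j \<in> carrier_vec n" for j using X by (simp add: D_def)
  have "\<exists>Ms. set Ms \<subseteq> S \<and> length Ms = j \<and> D j = mat_prod n Ms *\<^sub>v D 0" for j
  proof (induction j)
    case 0
    then show ?case using Dc[of 0] by (intro exI[of _ "[]"]) simp
  next
    case (Suc j)
    then obtain Ms where Ms: "set Ms \<subseteq> S" "length Ms = j" "D j = mat_prod n Ms *\<^sub>v D 0" by blast
    obtain M where M: "M \<in> S" "G (X (Suc j)) - G (X j) = M *\<^sub>v (X (Suc j) - X j)"
      using diff[OF X X] by blast
    have c: "M \<in> carrier_mat n n" "mat_prod n Ms \<in> carrier_mat n n"
      using M Ms carrier by (auto intro!: mat_prod_carrier)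
    have "D (Suc j) = mat_prod n (M # Ms) *\<^sub>v D 0"
      using M(2) Ms(3) assoc_mult_mat_vec[OF c Dc[of 0]] by (simp add: D_def XS)
    then show ?case using M Ms by (intro exI[of _ "M # Ms"]) simp
  qed
  then have Dle: "vec_l1 (D j) \<le> C * \<gamma> ^ j * vec_l1 (D 0)" for j
    using decay[OF _ Dc] by metis
  define x where "x = vec n (\<lambda>i. \<Sum>j. D j $ i)"
  have x: "x \<in> carrier_vec n" by (simp add: x_def)
  have lim: "(\<lambda>j. X j $ i) \<longlonglongrightarrow> x $ i" if i: "i < n" for i
  proof -
    have "summable (\<lambda>j. C * \<gamma> ^ j * vec_l1 (D 0))"
      using \<gamma> by (intro summable_mult2 summable_mult summable_geometric) simp
    moreover have "norm (D j $ i) \<le> C * \<gamma> ^ j * vec_l1 (D 0)" for j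
      using norm_index_le_vec_l1[of i "D j"] Dle[of j] i Dc[of j] by (metis carrier_vecD order_trans)
    ultimately have "summable (\<lambda>j. D j $ i)" by (rule summable_comparison_test'[where N = 0])
    then have "(\<lambda>j. \<Sum>l<j. D l $ i) \<longlonglongrightarrow> x $ i" using i by (simp add: x_def summable_LIMSEQ)
    moreover have "(\<Sum>l<j. D l $ i) = X j $ i" for j
    proof (induction j)
      case 0
      then show ?case using i by (simp add: X_def)
    next
      case (Suc j)
      then show ?case using i X[of j] X[of "Suc j"] by (simp add: D_def)
    qed
    ultimately show ?thesis by simp
  qed
  have conv: "(\<lambda>j. vec_l1 (x - X j)) \<longlonglongrightarrow> 0"
  proof -
    have "(\<lambda>j. \<Sum>i<n. norm (x $ i - X j $ i)) \<longlonglongrightarrow> (\<Sum>i<n. norm (x $ i - x $ i))"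
      using lim by (intro tendsto_sum tendsto_norm tendsto_diff) auto
    moreover have "vec_l1 (x - X j) = (\<Sum>i<n. norm (x $ i - X j $ i))" for j
      using x X[of j] by (simp add: vec_l1_def)
    ultimately show ?thesis by simp
  qed
  \<comment> \<open>A single application of \<open>G\<close> is Lipschitz with constant
    \<open>b\<close>, which suffices to pass to the limit in
    \<open>X (Suc j) = G (X j)\<close>.\<close>
  have "vec_l1 (G x - x) \<le> b * vec_l1 (x - X j) + vec_l1 (x - X (Suc j))" for j
  proof -
    obtain M where M: "M \<in> S" "G x - G (X j) = M *\<^sub>v (x - X j)" using diff[OF x X] by blast
    have "G x - x = (G x - G (X j)) - (x - X (Suc j))"
      using G[OF x] X[of "Suc j"] x by (intro eq_vecI) (auto simp: XS)
    then have "vec_l1 (G x - x) \<le> vec_l1 (G x - G (X j)) + vec_l1 (x - X (Suc j))"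
      using vec_l1_diff[of "G x - G (X j)" n "x - X (Suc j)"] G[OF x] G[OF X] x X by simp
    also have "vec_l1 (G x - G (X j)) \<le> mat_l1 M * vec_l1 (x - X j)"
      unfolding M(2) using M carrier x X by (intro vec_l1_mult_mat_vec_le[of _ n n]) auto
    also have "\<dots> \<le> b * vec_l1 (x - X j)" using bounded[OF M(1)] by (intro mult_right_mono) auto
    finally show ?thesis by simp
  qed
  moreover have "(\<lambda>j. b * vec_l1 (x - X j) + vec_l1 (x - X (Suc j))) \<longlonglongrightarrow> b * 0 + 0"
    by (intro tendsto_add tendsto_mult tendsto_const conv LIMSEQ_Suc[OF conv])
  ultimately have "vec_l1 (G x - x) \<le> b * 0 + 0"
    by (intro LIMSEQ_le_const) auto
  then have "vec_l1 (G x - x) = 0" using vec_l1_nonneg[of "G x - x"] by linarith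
  then have "(G x - x) $ i = 0" if "i < n" for i
    using that norm_index_le_vec_l1[of i "G x - x"] x by simp
  then have "G x = x" using G[OF x] x by (intro eq_vecI) auto
  then show ?thesis using x by blast
qed

text \<open>For one exponent \<open>j\<close>, common to all \<open>M\<close>, the power
  \<open>M ^ j\<close> halves every vector, while \<open>M ^ j x - x\<close> is the sum of the
  images of \<open>M x - x\<close> under the lower powers, each of which costs at most
  \<open>C\<close>. So 1 is uniformly far from being an eigenvalue.\<close>

lemma defect_bound:
  obtains K where "K \<ge> 0" "\<And>M x. M \<in> S \<Longrightarrow> x \<in> carrier_vec n \<Longrightarrow> vec_l1 x \<le> K * vec_l1 (M *\<^sub>v x - x)"
proof -
  \<comment> \<open>\<open>C + 1\<close> instead of \<open>C\<close> allows for
    \<open>C = 0\<close>.\<close>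
  obtain j where j: "\<gamma> ^ j < 1 / (2 * (C + 1))"
    using real_arch_pow_inv[of "1 / (2 * (C + 1))" \<gamma>] C \<gamma> by auto
  have "C * \<gamma> ^ j \<le> C * (1 / (2 * (C + 1)))" using j C by (intro mult_left_mono) auto
  also have "\<dots> \<le> 1/2" using C by (simp add: field_simps)
  finally have half: "C * \<gamma> ^ j \<le> 1/2" .
  have "vec_l1 x \<le> 2 * j * C * vec_l1 (M *\<^sub>v x - x)" if M: "M \<in> S" and x: "x \<in> carrier_vec n" for M x
  proof -
    define P where "P i = mat_prod n (replicate i M)" for i
    define d where "d = M *\<^sub>v x - x"
    have Mc: "M \<in> carrier_mat n n" using M carrier by blast
    have Pc: "P i \<in> carrier_mat n n" for i unfolding P_def using Mc by (intro mat_prod_carrier) auto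
    have d: "d \<in> carrier_vec n" using Mc x by (simp add: d_def)
    have "vec_l1 (P i *\<^sub>v x - x) \<le> i * C * vec_l1 d" for i
    proof (induction i)
      case 0
      then show ?case using x by (simp add: P_def)
    next
      case (Suc i)
      have "set (replicate i M) \<subseteq> carrier_mat n n" using Mc by auto
      then have "mat_prod n (replicate i M @ [M]) = mat_prod n (replicate i M) * M"
        using mat_prod_append[of "replicate i M" n "[M]"] Mc by simp
      then have "P (Suc i) = P i * M" by (simp add: P_def replicate_append_same)
      then have "P (Suc i) *\<^sub>v x = P i *\<^sub>v (M *\<^sub>v x)" using assoc_mult_mat_vec[OF Pc Mc x] by simp
      then have "P (Suc i) *\<^sub>v x - x = P i *\<^sub>v d + (P i *\<^sub>v x - x)"
        using mult_minus_distrib_mat_vec[OF Pc[of i], of "M *\<^sub>v x" x] mult_mat_vec_carrier[OF Pc[of i] x]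
          mult_mat_vec_carrier[OF Pc[of i], of "M *\<^sub>v x"] Mc x Pc[of i]
        unfolding d_def by (intro eq_vecI) auto
      then have "vec_l1 (P (Suc i) *\<^sub>v x - x) \<le> vec_l1 (P i *\<^sub>v d) + vec_l1 (P i *\<^sub>v x - x)"
        using vec_l1_add[of "P i *\<^sub>v d" n "P i *\<^sub>v x - x"] mult_mat_vec_carrier[OF Pc[of i] x]
          mult_mat_vec_carrier[OF Pc[of i] d] x by simp
      also have "vec_l1 (P i *\<^sub>v d) \<le> C * \<gamma> ^ i * vec_l1 d"
        using decay[of "replicate i M" d] M d by (simp add: P_def set_replicate_conv_if)
      also have "\<dots> \<le> C * 1 * vec_l1 d"
        using C \<gamma> power_le_one[of \<gamma> i] by (intro mult_right_mono mult_left_mono) auto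
      finally show ?case using Suc by (simp add: algebra_simps)
    qed
    from this[of j] have "vec_l1 (P j *\<^sub>v x - x) \<le> j * C * vec_l1 d" .
    moreover have "vec_l1 (P j *\<^sub>v x) \<le> 1/2 * vec_l1 x"
    proof -
      have "vec_l1 (P j *\<^sub>v x) \<le> C * \<gamma> ^ j * vec_l1 x"
        using decay[of "replicate j M" x] M x by (simp add: P_def set_replicate_conv_if)
      also have "\<dots> \<le> 1/2 * vec_l1 x" using half by (rule mult_right_mono) simp
      finally show ?thesis .
    qed
    moreover have "vec_l1 x \<le> vec_l1 (P j *\<^sub>v x) + vec_l1 (P j *\<^sub>v x - x)"
    proof -
      have "x = P j *\<^sub>v x - (P j *\<^sub>v x - x)" using mult_mat_vec_carrier[OF Pc[of j] x] x by (intro eq_vecI) auto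
      then show ?thesis
        using vec_l1_diff[of "P j *\<^sub>v x" n "P j *\<^sub>v x - x"] mult_mat_vec_carrier[OF Pc[of j] x] x by simp
    qed
    ultimately show ?thesis by (simp add: d_def)
  qed
  then show thesis using that[of "2 * j * C"] C by simp
qed

lemma mprod_seq_decay:
  assumes A: "\<And>t. t \<ge> 1 \<Longrightarrow> A t \<in> S"
  shows "mnorm (mprod_seq n A t) \<le> (n * C) * \<gamma> ^ t"
proof -
  \<comment> \<open>\<open>mprod_seq\<close> puts later matrices on the left, hence the
    reversal.\<close>
  define Ms where "Ms = rev (map A [1..<Suc t])"
  have Ms: "set Ms \<subseteq> S" "length Ms = t" using A by (auto simp: Ms_def)
  have "mprod_seq n A t = mat_prod n Ms" unfolding Ms_def by (induction t) auto
  then have c: "mprod_seq n A t \<in> carrier_mat n n" using Ms carrier by (auto intro!: mat_prod_carrier)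
  have "mnorm (mprod_seq n A t) \<le> (\<Sum>j<n. vec_l1 (col (mprod_seq n A t) j))"
    using mnorm_le_mat_l1 mat_l1_eq_sum_col[OF c] by metis
  also have "\<dots> \<le> (\<Sum>j<n. C * \<gamma> ^ t)"
  proof (rule sum_mono)
    fix j assume j: "j \<in> {..<n}"
    have "vec_l1 (unit_vec n j :: real vec) = 1" using j
      by (simp add: vec_l1_def if_distrib cong: if_cong)
    moreover have "col (mprod_seq n A t) j = mprod_seq n A t *\<^sub>v unit_vec n j"
      using j c by (intro eq_vecI) (auto simp: scalar_prod_right_unit)
    ultimately show "vec_l1 (col (mprod_seq n A t) j) \<le> C * \<gamma> ^ t"
      using decay[OF Ms(1), of "unit_vec n j"] Ms(2) \<open>mprod_seq n A t = _\<close> by simp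
  qed
  finally show ?thesis by simp
qed

end

section \<open>Full-rank matrices and their orthogonal complements\<close>

text \<open>Linear independence is a property of the set of columns, so a repeated column must be
  excluded first: it would leave fewer than \<open>nc\<close> columns to account for the
  rank.\<close>

lemma full_rank_imp_inj:
  fixes A :: "'a::field mat"
  assumes A: "A \<in> carrier_mat n nc" and rank: "vec_space.rank n A = nc"
    and v: "v \<in> carrier_vec nc" "A *\<^sub>v v = 0\<^sub>v n"
  shows "v = 0\<^sub>v nc"
proof -
  interpret vec_space "TYPE('a)" n .
  have dist: "distinct (cols A)"
  proof (rule ccontr)
    assume nd: "\<not> distinct (cols A)"
    obtain S where S: "maximal S (\<lambda>T. T \<subseteq> set (cols A) \<and> lin_indpt T)"
      using maximal_exists[of "(\<lambda>T. T \<subseteq> set (cols A) \<and> lin_indpt T)" "card (set (cols A))" "{}"]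
      by (meson List.finite_set card_mono empty_iff empty_subsetI finite_lin_indpt2 rev_finite_subset)
    then have "S \<subseteq> set (cols A)" by (simp add: maximal_def)
    then have "rank A \<le> card (set (cols A))"
      using rank_card_indpt[OF A S] by (simp add: card_mono)
    also have "\<dots> < nc"
    proof -
      have "card (set (cols A)) \<noteq> length (cols A)" using nd card_distinct by blast
      then show ?thesis using card_length[of "cols A"] A by simp
    qed
    finally show False using rank by simp
  qed
  show ?thesis
    using full_rank_lin_indpt[OF A rank dist] lin_depI[OF A v(1) _ v(2) dist] by blast
qed

lemma inj_square_mat_inverse:
  fixes A :: "'a::field mat"
  assumes A: "A \<in> carrier_mat n n" and inj: "\<And>v. v \<in> carrier_vec n \<Longrightarrow> A *\<^sub>v v = 0\<^sub>v n \<Longrightarrow> v = 0\<^sub>v n"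
  obtains A' where "A' \<in> carrier_mat n n" "A * A' = 1\<^sub>m n"
proof -
  have "det A \<noteq> 0" using det_0_iff_vec_prod_zero_field[OF A] inj by blast
  from det_non_zero_imp_unit[OF A this, of n] show thesis
    using that by (auto simp: Units_def ring_mat_def)
qed

text \<open>The scalar product of \<open>A v\<close> with itself equals that of
  \<open>A^T A v\<close> with \<open>v\<close>, and over the reals a vanishing sum of squares has
  vanishing terms.\<close>

lemma gram_mult_eq_0_imp_inj:
  fixes A :: "real mat"
  assumes A: "A \<in> carrier_mat n m" and inj: "\<And>v. v \<in> carrier_vec m \<Longrightarrow> A *\<^sub>v v = 0\<^sub>v n \<Longrightarrow> v = 0\<^sub>v m"
    and v: "v \<in> carrier_vec m" "transpose_mat A *\<^sub>v (A *\<^sub>v v) = 0\<^sub>v m"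
  shows "v = 0\<^sub>v m"
proof (rule inj[OF v(1)])
  let ?w = "A *\<^sub>v v"
  have w: "?w \<in> carrier_vec n" using A v by simp
  have "?w \<bullet> ?w = (transpose_mat A *\<^sub>v ?w) \<bullet> v" using transpose_vec_mult_scalar[OF A v(1) w] by simp
  also have "\<dots> = 0" using v by simp
  finally have "?w \<bullet> ?w = 0" .
  then have "(\<Sum>i=0..<n. ?w $ i * ?w $ i) = 0" using w by (simp only: scalar_prod_def carrier_vecD)
  then have "\<forall>i\<in>{0..<n}. ?w $ i * ?w $ i = 0" by (subst (asm) sum_nonneg_eq_0_iff) auto
  then show "?w = 0\<^sub>v n" using w A by (intro eq_vecI) auto
qed

text \<open>The witness is \<open>A (A^T A)^(-1)\<close>. For \<alpha>p it supplies a vector with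
  prescribed image under the transpose, that is, a representative of each affine subspace.\<close>

lemma transpose_right_inverse:
  fixes A :: "real mat"
  assumes A: "A \<in> carrier_mat n m" and inj: "\<And>v. v \<in> carrier_vec m \<Longrightarrow> A *\<^sub>v v = 0\<^sub>v n \<Longrightarrow> v = 0\<^sub>v m"
  obtains R where "R \<in> carrier_mat n m" "transpose_mat A * R = 1\<^sub>m m"
proof -
  have G: "transpose_mat A * A \<in> carrier_mat m m" using A by simp
  obtain W where W: "W \<in> carrier_mat m m" "(transpose_mat A * A) * W = 1\<^sub>m m"
  proof (rule inj_square_mat_inverse[OF G])
    fix v assume v: "v \<in> carrier_vec m" "(transpose_mat A * A) *\<^sub>v v = 0\<^sub>v m"
    then have "transpose_mat A *\<^sub>v (A *\<^sub>v v) = 0\<^sub>v m" using A by (simp add: assoc_mult_mat_vec[of _ m n _ m])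
    then show "v = 0\<^sub>v m" using gram_mult_eq_0_imp_inj[OF A inj] v(1) by blast
  qed
  have "transpose_mat A * (A * W) = 1\<^sub>m m"
    using assoc_mult_mat[of "transpose_mat A" m n A m W m] A W by simp
  moreover have "A * W \<in> carrier_mat n m" using A W by simp
  ultimately show thesis using that by blast
qed

text \<open>The square matrix with blocks \<alpha> and \<alpha>p is injective, hence invertible, so
  \<open>e = \<alpha> a + \<alpha>p w\<close>. Applying the transpose of \<alpha>p leaves only its
  Gram matrix times \<open>w\<close>, which forces \<open>w = 0\<close>.\<close>

lemma orthogonal_complement_kernel:
  fixes \<alpha> \<alpha>p :: "real mat"
  assumes \<alpha>: "\<alpha> \<in> carrier_mat n r" and \<alpha>p: "\<alpha>p \<in> carrier_mat n q" and n: "r + q = n"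
    and inj: "\<And>v. v \<in> carrier_vec r \<Longrightarrow> \<alpha> *\<^sub>v v = 0\<^sub>v n \<Longrightarrow> v = 0\<^sub>v r"
      "\<And>v. v \<in> carrier_vec q \<Longrightarrow> \<alpha>p *\<^sub>v v = 0\<^sub>v n \<Longrightarrow> v = 0\<^sub>v q"
    and orth: "transpose_mat \<alpha>p * \<alpha> = 0\<^sub>m q r"
    and e: "e \<in> carrier_vec n" "transpose_mat \<alpha>p *\<^sub>v e = 0\<^sub>v q"
  obtains a where "a \<in> carrier_vec r" "e = \<alpha> *\<^sub>v a"
proof -
  define N where "N = mat n n (\<lambda>(i,j). if j < r then \<alpha> $$ (i,j) else \<alpha>p $$ (i, j - r))"
  have N: "N \<in> carrier_mat n n" by (simp add: N_def)
  have Nv: "N *\<^sub>v (a @\<^sub>v w) = \<alpha> *\<^sub>v a + \<alpha>p *\<^sub>v w" if aw: "a \<in> carrier_vec r" "w \<in> carrier_vec q" for a w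
  proof (rule eq_vecI)
    fix i assume "i < dim_vec (\<alpha> *\<^sub>v a + \<alpha>p *\<^sub>v w)"
    then have i: "i < n" using \<alpha>p by simp
    have "(N *\<^sub>v (a @\<^sub>v w)) $ i = (\<Sum>j=0..<r+q. N $$ (i,j) * (a @\<^sub>v w) $ j)"
      using i aw n N by (simp add: scalar_prod_def)
    also have "\<dots> = (\<Sum>j=0..<r. N $$ (i,j) * (a @\<^sub>v w) $ j) + (\<Sum>j=r..<r+q. N $$ (i,j) * (a @\<^sub>v w) $ j)"
      by (simp add: sum.atLeastLessThan_concat)
    also have "(\<Sum>j=r..<r+q. N $$ (i,j) * (a @\<^sub>v w) $ j) = (\<Sum>j=0..<q. N $$ (i,j+r) * (a @\<^sub>v w) $ (j+r))"
      using sum.shift_bounds_nat_ivl[of "\<lambda>j. N $$ (i,j) * (a @\<^sub>v w) $ j" 0 r q] by (simp add: add.commute)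
    finally show "(N *\<^sub>v (a @\<^sub>v w)) $ i = (\<alpha> *\<^sub>v a + \<alpha>p *\<^sub>v w) $ i"
      using i aw n \<alpha> \<alpha>p by (simp add: N_def scalar_prod_def)
  qed (use N \<alpha>p in auto)
  have orthv: "transpose_mat \<alpha>p *\<^sub>v (\<alpha> *\<^sub>v a) = 0\<^sub>v q" if "a \<in> carrier_vec r" for a
  proof -
    have "transpose_mat \<alpha>p *\<^sub>v (\<alpha> *\<^sub>v a) = 0\<^sub>m q r *\<^sub>v a"
      using assoc_mult_mat_vec[of "transpose_mat \<alpha>p" q n \<alpha> r a] \<alpha> \<alpha>p that orth by simp
    then show ?thesis using that by (auto intro!: eq_vecI)
  qed
  have w0: "w = 0\<^sub>v q"
    if "a \<in> carrier_vec r" "w \<in> carrier_vec q" "transpose_mat \<alpha>p *\<^sub>v (\<alpha> *\<^sub>v a + \<alpha>p *\<^sub>v w) = 0\<^sub>v q" for a w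
  proof (rule gram_mult_eq_0_imp_inj[OF \<alpha>p inj(2) that(2)])
    have c: "transpose_mat \<alpha>p \<in> carrier_mat q n" "\<alpha> *\<^sub>v a \<in> carrier_vec n" "\<alpha>p *\<^sub>v w \<in> carrier_vec n"
      using \<alpha> \<alpha>p that by auto
    then show "transpose_mat \<alpha>p *\<^sub>v (\<alpha>p *\<^sub>v w) = 0\<^sub>v q"
      using mult_add_distrib_mat_vec[OF c] orthv[OF that(1)] that(3) mult_mat_vec_carrier[OF c(1,3)] by simp
  qed
  have split: "\<exists>a\<in>carrier_vec r. \<exists>w\<in>carrier_vec q. v = a @\<^sub>v w" if "v \<in> carrier_vec n" for v :: "real vec"
    using that n by (intro bexI[of _ "vec_first v r"] bexI[of _ "vec_last v q"]) auto
  obtain N' where N': "N' \<in> carrier_mat n n" "N * N' = 1\<^sub>m n"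
  proof (rule inj_square_mat_inverse[OF N])
    fix v assume v: "v \<in> carrier_vec n" "N *\<^sub>v v = 0\<^sub>v n"
    obtain a w where aw: "a \<in> carrier_vec r" "w \<in> carrier_vec q" "v = a @\<^sub>v w" using split[OF v(1)] by blast
    have eq: "\<alpha> *\<^sub>v a + \<alpha>p *\<^sub>v w = 0\<^sub>v n" using v Nv aw by simp
    have "transpose_mat \<alpha>p *\<^sub>v 0\<^sub>v n = 0\<^sub>v q" using \<alpha>p by (auto intro!: eq_vecI)
    then have w: "w = 0\<^sub>v q" using w0[OF aw(1,2)] eq by simp
    have "\<alpha>p *\<^sub>v 0\<^sub>v q = 0\<^sub>v n" using \<alpha>p by (auto intro!: eq_vecI)
    then have "a = 0\<^sub>v r" using eq w \<alpha> aw inj(1) by simp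
    then show "v = 0\<^sub>v n" using aw w n by (auto intro!: eq_vecI)
  qed auto
  obtain a w where aw: "a \<in> carrier_vec r" "w \<in> carrier_vec q" "N' *\<^sub>v e = a @\<^sub>v w"
    using split[of "N' *\<^sub>v e"] N' e by auto
  have "e = N *\<^sub>v (N' *\<^sub>v e)" using assoc_mult_mat_vec[OF N N'(1) e(1)] N' e by simp
  then have eq: "e = \<alpha> *\<^sub>v a + \<alpha>p *\<^sub>v w" using Nv aw by simp
  then have "w = 0\<^sub>v q" using w0[OF aw(1,2)] e by simp
  moreover have "\<alpha>p *\<^sub>v 0\<^sub>v q = 0\<^sub>v n" using \<alpha>p by (auto intro!: eq_vecI)
  ultimately have "e = \<alpha> *\<^sub>v a" using eq \<alpha> aw by simp
  then show thesis using that aw by blast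
qed

section \<open>The block matrices\<close>

declare One_nat_def [simp del]

lemma append_minus_append:
  assumes "a \<in> carrier_vec n1" "b \<in> carrier_vec n1" "c \<in> carrier_vec n2" "d \<in> carrier_vec n2"
  shows "(a @\<^sub>v c) - (b @\<^sub>v d) = (a - b) @\<^sub>v (c - d)"
  using assms by (intro eq_vecI) auto

lemma vec_l1_append [simp]: "vec_l1 (a @\<^sub>v b) = vec_l1 a + vec_l1 b"
proof -
  let ?m = "dim_vec a" and ?n = "dim_vec b"
  have "vec_l1 (a @\<^sub>v b) = (\<Sum>i=0..<?m+?n. norm ((a @\<^sub>v b) $ i))"
    by (simp add: vec_l1_def lessThan_atLeast0)
  also have "\<dots> = (\<Sum>i=0..<?m. norm ((a @\<^sub>v b) $ i)) + (\<Sum>i=?m..<?m+?n. norm ((a @\<^sub>v b) $ i))"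
    by (rule sum.atLeastLessThan_concat[symmetric]) auto
  also have "(\<Sum>i=?m..<?m+?n. norm ((a @\<^sub>v b) $ i)) = (\<Sum>i=0..<?n. norm ((a @\<^sub>v b) $ (i + ?m)))"
    using sum.shift_bounds_nat_ivl[of "\<lambda>i. norm ((a @\<^sub>v b) $ i)" 0 ?m ?n] by (simp add: add.commute)
  finally show ?thesis by (simp add: vec_l1_def lessThan_atLeast0)
qed

lemma vec_l1_eq_0_imp_eq:
  assumes "x \<in> carrier_vec n" "y \<in> carrier_vec n" "vec_l1 (x - y) \<le> 0"
  shows "x = y"
proof (rule eq_vecI)
  fix i assume "i < dim_vec y"
  then have "norm (x $ i - y $ i) \<le> 0"
    using order_trans[OF norm_index_le_vec_l1[of i "x - y"] assms(3)] assms(1,2) by simp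
  then show "x $ i = y $ i" by simp
qed (use assms in auto)

lemma vsum_carrier [simp]: "(\<And>i. i \<in> I \<Longrightarrow> F i \<in> carrier_vec n) \<Longrightarrow> vsum n F I \<in> carrier_vec n"
  unfolding vsum_def by (rule finsum_vec_closed) auto

lemma vsum_index:
  "finite I \<Longrightarrow> (\<And>i. i \<in> I \<Longrightarrow> F i \<in> carrier_vec n) \<Longrightarrow> l < n \<Longrightarrow> vsum n F I $ l = (\<Sum>i\<in>I. F i $ l)"
  unfolding vsum_def by (rule index_finsum_vec) auto

lemma Dmat_carrier [simp]: "Dmat p k \<in> carrier_mat (p*(k-1)) (p*(k-1))"
  by (simp add: Dmat_def)

lemma Emat_carrier [simp]: "Emat p k \<in> carrier_mat (p*(k-1)) p"
  by (simp add: Emat_def)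

lemmas Dmat_dim [simp] = carrier_matD[OF Dmat_carrier]
lemmas Emat_dim [simp] = carrier_matD[OF Emat_carrier]

lemma boldalpha_carrier [simp]:
  assumes "\<alpha> \<in> carrier_mat p r"
  shows "boldalpha p k r \<alpha> \<in> carrier_mat (p + p*(k-1)) (p*(k-1)+r)"
proof -
  have "boldalpha p k r \<alpha> \<in> carrier_mat (p + p*(k-1)) (r + p*(k-1))"
    unfolding boldalpha_def by (rule four_block_carrier_mat) (use assms in auto)
  then show ?thesis by (simp only: add.commute)
qed

lemma D0mat_carrier [simp]: "D0mat p k r \<in> carrier_mat (p*(k-1)+r) (p + p*(k-1))"
proof -
  have "D0mat p k r \<in> carrier_mat (r + p*(k-1)) (p + p*(k-1))"
    unfolding D0mat_def by (rule four_block_carrier_mat) auto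
  then show ?thesis by (simp only: add.commute)
qed

lemma Dmat_mult_index:
  assumes "p \<ge> 1" "v \<in> carrier_vec (p*(k-1))" "a < p*(k-1)"
  shows "(Dmat p k *\<^sub>v v) $ a = (if a + p < p*(k-1) then v $ (a + p) else 0) - v $ a"
proof -
  let ?m = "p*(k-1)"
  have "(Dmat p k *\<^sub>v v) $ a = (\<Sum>b=0..<?m. (if b = a then -1 else if b = a + p then 1 else 0) * v $ b)"
    using assms by (simp add: Dmat_def scalar_prod_def)
  also have "\<dots> = (\<Sum>b=0..<?m. (if b = a + p then v $ b else 0) - (if b = a then v $ b else 0))"
    using assms(1) by (intro sum.cong) auto
  finally show ?thesis using assms by (simp add: sum_subtractf)
qed

text \<open>The condition fails only when there are no blocks at all, as for \<open>k = 1\<close>;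
  otherwise the first block is read off.\<close>

lemma Emat_transpose_mult_index:
  assumes "v \<in> carrier_vec (p*(k-1))" "a < p"
  shows "(transpose_mat (Emat p k) *\<^sub>v v) $ a = (if a < p*(k-1) then v $ a else 0)"
proof -
  let ?m = "p*(k-1)"
  have "(transpose_mat (Emat p k) *\<^sub>v v) $ a = (\<Sum>b=0..<?m. (if b = a then 1 else 0) * v $ b)"
    using assms by (simp add: Emat_def scalar_prod_def)
  also have "\<dots> = (\<Sum>b=0..<?m. if b = a then v $ b else 0)"
    by (intro sum.cong) auto
  finally show ?thesis by simp
qed

lemma D0mat_mult:
  assumes "a \<in> carrier_vec p" "d \<in> carrier_vec (p*(k-1))"
  shows "D0mat p k r *\<^sub>v (a @\<^sub>v d) = 0\<^sub>v r @\<^sub>v (Dmat p k *\<^sub>v d)"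
proof -
  have "D0mat p k r *\<^sub>v (a @\<^sub>v d)
      = (0\<^sub>m r p *\<^sub>v a + 0\<^sub>m r (p*(k-1)) *\<^sub>v d) @\<^sub>v (0\<^sub>m (p*(k-1)) p *\<^sub>v a + Dmat p k *\<^sub>v d)"
    unfolding D0mat_def by (rule four_block_mat_mult_vec) (use assms in auto)
  moreover have "0\<^sub>m r p *\<^sub>v a + 0\<^sub>m r (p*(k-1)) *\<^sub>v d = 0\<^sub>v r"
    "0\<^sub>m (p*(k-1)) p *\<^sub>v a + Dmat p k *\<^sub>v d = Dmat p k *\<^sub>v d"
    using assms by (auto intro!: eq_vecI simp: Dmat_def)
  ultimately show ?thesis by simp
qed

lemma boldalpha_mult:
  assumes "\<alpha> \<in> carrier_mat p r" "a \<in> carrier_vec r" "d \<in> carrier_vec (p*(k-1))"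
  shows "boldalpha p k r \<alpha> *\<^sub>v (a @\<^sub>v d) = (\<alpha> *\<^sub>v a + transpose_mat (Emat p k) *\<^sub>v d) @\<^sub>v d"
proof -
  have "boldalpha p k r \<alpha> *\<^sub>v (a @\<^sub>v d)
      = (\<alpha> *\<^sub>v a + transpose_mat (Emat p k) *\<^sub>v d) @\<^sub>v (0\<^sub>m (p*(k-1)) r *\<^sub>v a + 1\<^sub>m (p*(k-1)) *\<^sub>v d)"
    unfolding boldalpha_def by (rule four_block_mat_mult_vec) (use assms in auto)
  moreover have "0\<^sub>m (p*(k-1)) r *\<^sub>v a + 1\<^sub>m (p*(k-1)) *\<^sub>v d = d"
    using assms by (auto intro!: eq_vecI)
  ultimately show ?thesis by simp
qed

text \<open>Back substitution from the last block upwards, hence the induction on the distance to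
  the end.\<close>

lemma Dmat_inj:
  assumes p: "p \<ge> 1" and v: "v \<in> carrier_vec (p*(k-1))" and 0: "Dmat p k *\<^sub>v v = 0\<^sub>v (p*(k-1))"
  shows "v = 0\<^sub>v (p*(k-1))"
proof -
  have "v $ a = 0" if "a < p*(k-1)" for a
    using that
  proof (induction "p*(k-1) - a" arbitrary: a rule: less_induct)
    case less
    have "v $ a = (if a + p < p*(k-1) then v $ (a + p) else 0)"
      using Dmat_mult_index[OF p v less.prems] 0 less.prems by simp
    also have "\<dots> = 0" using less.hyps[of "a + p"] less.prems p by auto
    finally show ?case .
  qed
  then show ?thesis using v by (intro eq_vecI) auto
qed

text \<open>Serves to pass continuity from \<open>f 0\<close> to \<chi>, whose increments are
  bounded by those of \<open>f 0\<close>. Dividing by \<open>K + 1\<close> covers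
  \<open>K = 0\<close>.\<close>

lemma vcont_on_dominated:
  assumes F: "vcont_on n F" and K: "K \<ge> 0"
    and le: "\<And>x y. x \<in> carrier_vec n \<Longrightarrow> y \<in> carrier_vec n \<Longrightarrow> vnorm (G y - G x) \<le> K * vnorm (F y - F x)"
  shows "vcont_on n G"
  unfolding vcont_on_def
proof (intro ballI allI impI)
  fix x :: "real vec" and e :: real assume x: "x \<in> carrier_vec n" and e: "e > 0"
  then have "e / (K + 1) > 0" using K by simp
  then obtain d where d: "d > 0" "\<And>y. y \<in> carrier_vec n \<Longrightarrow> vnorm (y - x) < d \<Longrightarrow> vnorm (F y - F x) < e / (K + 1)"
    using F x unfolding vcont_on_def by blast
  have "vnorm (G y - G x) < e" if y: "y \<in> carrier_vec n" "vnorm (y - x) < d" for y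
  proof -
    have "vnorm (G y - G x) \<le> K * (e / (K + 1))"
      using le[OF x y(1)] d(2)[OF y] mult_left_mono[OF less_imp_le[OF d(2)[OF y]] K] by linarith
    also have "\<dots> < e" using K e by (simp add: field_simps)
    finally show ?thesis .
  qed
  then show "\<exists>d>0. \<forall>y\<in>carrier_vec n. vnorm (y - x) < d \<longrightarrow> vnorm (G y - G x) < e" using d(1) by blast
qed

text \<open>Serves for the inverse of \<chi>, written as the inverse of \<open>f 0\<close> after a
  Lipschitz map.\<close>

lemma vcont_on_compose_Lipschitz:
  assumes G: "vcont_on n G" and K: "K \<ge> 0" and H: "\<And>x. x \<in> carrier_vec n \<Longrightarrow> H x \<in> carrier_vec n"
    and le: "\<And>x y. x \<in> carrier_vec n \<Longrightarrow> y \<in> carrier_vec n \<Longrightarrow> vnorm (H y - H x) \<le> K * vnorm (y - x)"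
  shows "vcont_on n (\<lambda>x. G (H x))"
  unfolding vcont_on_def
proof (intro ballI allI impI)
  fix x :: "real vec" and e :: real assume x: "x \<in> carrier_vec n" and e: "e > 0"
  obtain d where d: "d > 0" "\<And>y. y \<in> carrier_vec n \<Longrightarrow> vnorm (y - H x) < d \<Longrightarrow> vnorm (G y - G (H x)) < e"
    using G H[OF x] e unfolding vcont_on_def by blast
  have "vnorm (G (H y) - G (H x)) < e" if y: "y \<in> carrier_vec n" "vnorm (y - x) < d / (K + 1)" for y
  proof (rule d(2)[OF H[OF y(1)]])
    have "vnorm (H y - H x) \<le> K * (d / (K + 1))"
      using le[OF x y(1)] mult_left_mono[OF less_imp_le[OF y(2)] K] by linarith
    also have "\<dots> < d" using K d(1) by (simp add: field_simps)
    finally show "vnorm (H y - H x) < d" .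
  qed
  moreover have "d / (K + 1) > 0" using K d(1) by simp
  ultimately show "\<exists>d>0. \<forall>y\<in>carrier_vec n. vnorm (y - x) < d \<longrightarrow> vnorm (G (H y) - G (H x)) < e" by blast
qed

lemma vcont_on_cong:
  assumes "\<And>x. x \<in> carrier_vec n \<Longrightarrow> F x = G x"
  shows "vcont_on n F \<longleftrightarrow> vcont_on n G"
  unfolding vcont_on_def using assms by auto

section \<open>The model class\<close>

locale cointegrated_var =
  fixes p k r :: nat and c \<mu> :: "real vec" and f :: "nat \<Rightarrow> real vec \<Rightarrow> real vec"
    and \<theta> :: "real vec \<Rightarrow> real vec" and \<alpha> \<alpha>p :: "real mat" and B :: "real mat set" and bb \<rho>b :: real
  assumes p: "p \<ge> 1" and k: "k \<ge> 1" and r: "r < p"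
    and var: "var_model p k c f"
    and cls: "in_class_M p k r \<alpha> bb \<rho>b c f \<mu> \<theta> B"
    and \<alpha>p: "\<alpha>p \<in> carrier_mat p (p - r)" and rank_\<alpha>p: "vec_space.rank p \<alpha>p = p - r"
    and orth: "transpose_mat \<alpha>p * \<alpha> = 0\<^sub>m (p - r) r"
begin

abbreviation (input) "m \<equiv> p*(k-1)"
abbreviation (input) "n \<equiv> p*(k-1)+r"
abbreviation "A \<equiv> boldalpha p k r \<alpha>"
abbreviation "g \<equiv> gfun p k f"
abbreviation "Et \<equiv> transpose_mat (Emat p k)"
abbreviation "\<alpha>pt \<equiv> transpose_mat \<alpha>p"
abbreviation "steps \<equiv> (\<lambda>\<beta>. 1\<^sub>m (p*(k-1)+r) + transpose_mat \<beta> * A) ` B"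

text \<open>The map \<open>z \<mapsto> \<theta>(f\<^sub>0\<^sup>-\<^sup>1(z)) + D\<^sub>0 z\<close> (in boldface) of condition (iii).\<close>
definition F :: "real vec \<Rightarrow> real vec" where
  "F zz = boldtheta p k f \<theta> (vinv p (f 0) (vec_first zz p)) + D0mat p k r *\<^sub>v zz"

lemma kp: "k * p = p + m"
  using k by (cases k) auto

lemma f_carrier [simp]: "i \<le> k \<Longrightarrow> z \<in> carrier_vec p \<Longrightarrow> f i z \<in> carrier_vec p"
  using var by (auto simp: var_model_def)

lemma \<alpha>: "\<alpha> \<in> carrier_mat p r" and \<mu>: "\<mu> \<in> carrier_vec r"
  and \<theta> [simp]: "z \<in> carrier_vec p \<Longrightarrow> \<theta> z \<in> carrier_vec r"
  and c_eq: "c = \<alpha> *\<^sub>v \<mu>" and pi_eq: "z \<in> carrier_vec p \<Longrightarrow> pifun p k f z = \<alpha> *\<^sub>v \<theta> z"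
  and f0: "homeo_vec p (f 0)"
  and B_carrier: "\<beta> \<in> B \<Longrightarrow> \<beta> \<in> carrier_mat (p + p*(k-1)) (p*(k-1)+r)"
  and B_bounded: "\<beta> \<in> B \<Longrightarrow> mnorm \<beta> \<le> bb"
  using cls by (auto simp: in_class_M_def closed_mats_def kp)

lemma \<alpha>_inj: "v \<in> carrier_vec r \<Longrightarrow> \<alpha> *\<^sub>v v = 0\<^sub>v p \<Longrightarrow> v = 0\<^sub>v r"
  using full_rank_imp_inj[OF \<alpha>, of v] cls by (simp add: in_class_M_def)

lemma \<alpha>p_inj: "v \<in> carrier_vec (p - r) \<Longrightarrow> \<alpha>p *\<^sub>v v = 0\<^sub>v p \<Longrightarrow> v = 0\<^sub>v (p - r)"
  using full_rank_imp_inj[OF \<alpha>p rank_\<alpha>p, of v] by simp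

lemma A_carrier [simp]: "A \<in> carrier_mat (p + m) n"
  using \<alpha> by simp

lemma append_carrier_n [simp]: "a \<in> carrier_vec r \<Longrightarrow> d \<in> carrier_vec m \<Longrightarrow> a @\<^sub>v d \<in> carrier_vec n"
  using append_carrier_vec[of a r d m] by (simp only: add.commute)

lemma split_n:
  assumes "x \<in> carrier_vec n"
  obtains a d where "a \<in> carrier_vec r" "d \<in> carrier_vec m" "x = a @\<^sub>v d"
proof -
  have "x \<in> carrier_vec (r + m)" using assms by (simp only: add.commute)
  then have "x = vec_first x r @\<^sub>v vec_last x m" by simp
  then show thesis using that vec_first_carrier vec_last_carrier by blast
qed

lemma bij_f0: "bij_betw (f 0) (carrier_vec p) (carrier_vec p)"
  using f0 by (simp add: homeo_vec_def)

lemma vinv_f0 [simp]: "z \<in> carrier_vec p \<Longrightarrow> vinv p (f 0) (f 0 z) = z"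
  using bij_f0 unfolding vinv_def bij_betw_def by (simp add: the_inv_into_f_f)

lemma f0_vinv [simp]: "y \<in> carrier_vec p \<Longrightarrow> f 0 (vinv p (f 0) y) = y"
  using bij_f0 unfolding vinv_def by (simp add: f_the_inv_into_f_bij_betw)

lemma vinv_f0_carrier [simp]: "y \<in> carrier_vec p \<Longrightarrow> vinv p (f 0) y \<in> carrier_vec p"
  using bij_f0 unfolding vinv_def bij_betw_def by (metis order_refl the_inv_into_into)

lemma g_carrier [simp]: "z \<in> carrier_vec p \<Longrightarrow> g j z \<in> carrier_vec p"
  unfolding gfun_def by (intro uminus_carrier_vec[THEN iffD2] vsum_carrier) auto

lemma gstack_carrier [simp]: "gstack p k f z \<in> carrier_vec m"
  by (simp add: gstack_def)

lemma gstack_dim [simp]: "dim_vec (gstack p k f z) = m"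
  by (simp add: gstack_def)

lemma zeta_dim [simp]: "dim_vec (zeta p k f z t) = m"
  by (simp add: zeta_def)

lemma zeta_carrier [simp]: "zeta p k f z t \<in> carrier_vec m"
  by (simp add: zeta_def)

lemma boldtheta_carrier [simp]: "z \<in> carrier_vec p \<Longrightarrow> boldtheta p k f \<theta> z \<in> carrier_vec n"
  by (simp add: boldtheta_def)

lemma Et_carrier [simp]: "Et \<in> carrier_mat p m"
  by simp

lemma Et_mult_carrier [simp]: "d \<in> carrier_vec m \<Longrightarrow> Et *\<^sub>v d \<in> carrier_vec p"
  using mult_mat_vec_carrier[OF Et_carrier] by simp

lemma D_mult_carrier [simp]: "d \<in> carrier_vec m \<Longrightarrow> Dmat p k *\<^sub>v d \<in> carrier_vec m"
  using mult_mat_vec_carrier[OF Dmat_carrier] by simp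

lemma F_append:
  assumes z: "z \<in> carrier_vec p" and d: "d \<in> carrier_vec m"
  shows "F (f 0 z @\<^sub>v d) = \<theta> z @\<^sub>v (gstack p k f z + Dmat p k *\<^sub>v d)"
proof -
  have fz: "f 0 z \<in> carrier_vec p" using z by simp
  have "vec_first (f 0 z @\<^sub>v d) p = f 0 z" using fz d by (intro eq_vecI) (auto simp: vec_first_def)
  then have "F (f 0 z @\<^sub>v d) = (\<theta> z @\<^sub>v gstack p k f z) + (0\<^sub>v r @\<^sub>v Dmat p k *\<^sub>v d)"
    using z by (simp add: F_def D0mat_mult[OF fz d] boldtheta_def)
  also have "\<dots> = (\<theta> z + 0\<^sub>v r) @\<^sub>v (gstack p k f z + Dmat p k *\<^sub>v d)"
    using z d by (intro append_vec_add[of _ r _ _ m]) auto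
  finally show ?thesis using z by simp
qed

lemma F_carrier [simp]: "zz \<in> carrier_vec (p + m) \<Longrightarrow> F zz \<in> carrier_vec n"
  unfolding F_def by (intro add_carrier_vec mult_mat_vec_carrier[OF D0mat_carrier]) auto

lemma F_diff:
  assumes "zz \<in> carrier_vec (p + m)" "zz' \<in> carrier_vec (p + m)"
  obtains \<beta> where "\<beta> \<in> B" "F zz - F zz' = transpose_mat \<beta> *\<^sub>v (zz - zz')"
proof -
  have "\<forall>zz\<in>carrier_vec (p + m). \<forall>zz'\<in>carrier_vec (p + m). \<exists>\<beta>\<in>B. F zz - F zz' = transpose_mat \<beta> *\<^sub>v (zz - zz')"
    using cls unfolding in_class_M_def kp F_def by (elim conjE)
  then show thesis using assms that by blast
qed

lemma \<beta>t_carrier: "\<beta> \<in> B \<Longrightarrow> transpose_mat \<beta> \<in> carrier_mat n (p + m)"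
  using B_carrier by simp

text \<open>The bound \<open>bb\<close> on \<open>mnorm\<close> times the number of entries; a
  Lipschitz constant of \<open>F\<close> with respect to \<open>vec_l1\<close>.\<close>

definition b\<^sub>1 :: real where "b\<^sub>1 = (p + m) * n * bb"

lemma mat_l1_\<beta>t: "\<beta> \<in> B \<Longrightarrow> mat_l1 (transpose_mat \<beta>) \<le> b\<^sub>1"
proof -
  assume \<beta>: "\<beta> \<in> B"
  have "mat_l1 \<beta> \<le> ((p + m) * n) * mnorm \<beta>" using mat_l1_le_mnorm[of \<beta>] B_carrier[OF \<beta>] by simp
  also have "\<dots> \<le> ((p + m) * n) * bb" using B_bounded[OF \<beta>] by (intro mult_left_mono) auto
  finally show ?thesis by (simp add: b\<^sub>1_def)
qed

text \<open>Condition (iii) for two equal states already produces an element. This matters for the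
  sign of the bound: \<open>bb\<close> is merely some real number until a matrix is known to obey
  it.\<close>

lemma B_nonempty: "B \<noteq> {}"
  using F_diff[of "0\<^sub>v (p + m)" "0\<^sub>v (p + m)"] by auto

lemma b\<^sub>1_nonneg: "0 \<le> b\<^sub>1"
  using B_nonempty mat_l1_\<beta>t mat_l1_nonneg order_trans by blast

lemma step_carrier: "\<beta> \<in> B \<Longrightarrow> 1\<^sub>m n + transpose_mat \<beta> * A \<in> carrier_mat n n"
  using mult_carrier_mat[OF \<beta>t_carrier A_carrier] by simp

lemma step_mult:
  assumes "\<beta> \<in> B" "x \<in> carrier_vec n"
  shows "(1\<^sub>m n + transpose_mat \<beta> * A) *\<^sub>v x = x + transpose_mat \<beta> *\<^sub>v (A *\<^sub>v x)"
proof -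
  have "(1\<^sub>m n + transpose_mat \<beta> * A) *\<^sub>v x = 1\<^sub>m n *\<^sub>v x + (transpose_mat \<beta> * A) *\<^sub>v x"
    using \<beta>t_carrier[OF assms(1)] assms(2) by (intro add_mult_distrib_mat_vec[of _ n n]) auto
  also have "(transpose_mat \<beta> * A) *\<^sub>v x = transpose_mat \<beta> *\<^sub>v (A *\<^sub>v x)"
    by (rule assoc_mult_mat_vec[OF \<beta>t_carrier[OF assms(1)] A_carrier assms(2)])
  finally show ?thesis using assms(2) by simp
qed

text \<open>The joint spectral radius condition enters here and nowhere else; all later arguments
  use only the decay of products.\<close>

lemma steps_decaying:
  obtains C \<gamma> b where "decaying_family n steps C \<gamma> b"
proof -
  define b where "b = mat_l1 (1\<^sub>m n :: real mat) + b\<^sub>1 * mat_l1 A"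
  have car: "steps \<subseteq> carrier_mat n n" using step_carrier by auto
  have bnd: "mat_l1 M \<le> b" if "M \<in> steps" for M
  proof -
    obtain \<beta> where \<beta>: "\<beta> \<in> B" "M = 1\<^sub>m n + transpose_mat \<beta> * A" using \<open>M \<in> steps\<close> by auto
    have "mat_l1 M \<le> mat_l1 (1\<^sub>m n :: real mat) + mat_l1 (transpose_mat \<beta> * A)"
      unfolding \<beta>(2) using \<beta>t_carrier[OF \<beta>(1)] by (intro mat_l1_add_le[of _ n n]) auto
    also have "mat_l1 (transpose_mat \<beta> * A) \<le> mat_l1 (transpose_mat \<beta>) * mat_l1 A"
      by (rule mat_l1_mult_le[OF \<beta>t_carrier[OF \<beta>(1)] A_carrier])
    also have "\<dots> \<le> b\<^sub>1 * mat_l1 A" using mat_l1_\<beta>t[OF \<beta>(1)] by (intro mult_right_mono) auto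
    finally show ?thesis by (simp add: b_def)
  qed
  have "jsr n steps \<le> ereal \<rho>b" "\<rho>b < 1" using cls by (auto simp: in_class_M_def)
  then have jsr: "jsr n steps < 1" by (simp add: order_le_less_trans)
  show thesis
  proof (rule jsr_imp_exponential_decay[OF car _ jsr])
    show "mat_l1 M \<le> b" if "M \<in> steps" for M by (rule bnd[OF that])
    fix C \<gamma>
    assume "C \<ge> 0" "0 < \<gamma>" "\<gamma> < 1" and "\<And>Ms x. set Ms \<subseteq> steps \<Longrightarrow> x \<in> carrier_vec n \<Longrightarrow>
      vec_l1 (mat_prod n Ms *\<^sub>v x) \<le> C * \<gamma> ^ length Ms * vec_l1 x"
    then have "decaying_family n steps C \<gamma> b" by (intro decaying_family.intro car bnd)
    then show thesis by (rule that)
  qed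
qed

text \<open>On each affine subspace \<open>zz\<^sub>0 + range A\<close>, solving \<open>F zz = y\<close> is a fixed-point problem whose
  increments are governed by the stable matrices.\<close>
lemma F_surj_on_affine:
  assumes zz0: "zz0 \<in> carrier_vec (p + m)" and y: "y \<in> carrier_vec n"
  obtains x where "x \<in> carrier_vec n" "F (zz0 + A *\<^sub>v x) = y"
proof -
  obtain C \<gamma> b where "decaying_family n steps C \<gamma> b" using steps_decaying .
  then interpret decaying_family n steps C \<gamma> b .
  have Ax: "A *\<^sub>v x \<in> carrier_vec (p + m)" if "x \<in> carrier_vec n" for x
    by (rule mult_mat_vec_carrier[OF A_carrier that])
  define G where "G x = x + (F (zz0 + A *\<^sub>v x) - y)" for x
  have Fc: "F (zz0 + A *\<^sub>v x) \<in> carrier_vec n" if "x \<in> carrier_vec n" for x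
    using Ax[OF that] zz0 by simp
  have "\<exists>x\<in>carrier_vec n. G x = x"
  proof (rule fixed_point_exists)
    show "G x \<in> carrier_vec n" if "x \<in> carrier_vec n" for x using Fc[OF that] that y by (simp add: G_def)
    fix x x' :: "real vec" assume x: "x \<in> carrier_vec n" "x' \<in> carrier_vec n"
    obtain \<beta> where \<beta>: "\<beta> \<in> B" "F (zz0 + A *\<^sub>v x) - F (zz0 + A *\<^sub>v x')
        = transpose_mat \<beta> *\<^sub>v ((zz0 + A *\<^sub>v x) - (zz0 + A *\<^sub>v x'))"
      using F_diff[of "zz0 + A *\<^sub>v x" "zz0 + A *\<^sub>v x'"] zz0 Ax x by auto
    have "(zz0 + A *\<^sub>v x) - (zz0 + A *\<^sub>v x') = A *\<^sub>v x - A *\<^sub>v x'"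
      using zz0 Ax[OF x(1)] Ax[OF x(2)] carrier_vecD[OF zz0] carrier_vecD[OF Ax[OF x(1)]]
        carrier_vecD[OF Ax[OF x(2)]] by (intro eq_vecI) auto
    also have "\<dots> = A *\<^sub>v (x - x')" by (rule mult_minus_distrib_mat_vec[OF A_carrier x, symmetric])
    finally have dF: "F (zz0 + A *\<^sub>v x) - F (zz0 + A *\<^sub>v x') = transpose_mat \<beta> *\<^sub>v (A *\<^sub>v (x - x'))"
      using \<beta>(2) by simp
    have "G x - G x' = (x - x') + (F (zz0 + A *\<^sub>v x) - F (zz0 + A *\<^sub>v x'))"
      using x y carrier_vecD[OF Fc[OF x(1)]] carrier_vecD[OF Fc[OF x(2)]]
      unfolding G_def by (intro eq_vecI) auto
    then have "G x - G x' = (1\<^sub>m n + transpose_mat \<beta> * A) *\<^sub>v (x - x')"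
      using step_mult[OF \<beta>(1), of "x - x'"] dF x by simp
    then show "\<exists>M\<in>steps. G x - G x' = M *\<^sub>v (x - x')" using \<beta>(1) by blast
  qed
  then obtain x where x: "x \<in> carrier_vec n" "G x = x" by blast
  have "F (zz0 + A *\<^sub>v x) = y"
  proof (rule eq_vecI)
    fix i assume i: "i < dim_vec y"
    have "G x $ i = x $ i + (F (zz0 + A *\<^sub>v x) $ i - y $ i)"
      using i x(1) y Fc[OF x(1)] by (simp add: G_def)
    then show "F (zz0 + A *\<^sub>v x) $ i = y $ i" using x(2) by simp
  qed (use y Fc[OF x(1)] in auto)
  then show thesis using that x by blast
qed

lemma \<alpha>pt_carrier: "\<alpha>pt \<in> carrier_mat (p - r) p"
  using \<alpha>p by simp

lemma \<alpha>pt_\<alpha>: "a \<in> carrier_vec r \<Longrightarrow> \<alpha>pt *\<^sub>v (\<alpha> *\<^sub>v a) = 0\<^sub>v (p - r)"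
proof -
  assume a: "a \<in> carrier_vec r"
  have "\<alpha>pt *\<^sub>v (\<alpha> *\<^sub>v a) = 0\<^sub>m (p - r) r *\<^sub>v a"
    using assoc_mult_mat_vec[OF \<alpha>pt_carrier \<alpha> a] orth by simp
  then show ?thesis using a by (auto intro!: eq_vecI)
qed

text \<open>The quantitative form of uniqueness. The difference of two states is \<open>A x\<close>
  plus \<open>(R y, 0)\<close>, where \<open>y\<close> measures the distance between their affine
  subspaces. Up to a multiple of \<open>y\<close>, the increment of \<open>F\<close> is the defect
  of \<open>x\<close> under a stable matrix, and \<open>defect_bound\<close> recovers
  \<open>x\<close> from it.\<close>

lemma F_expansive:
  obtains K where "K \<ge> 0" "\<And>z z' d d'. z \<in> carrier_vec p \<Longrightarrow> z' \<in> carrier_vec p \<Longrightarrow>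
      d \<in> carrier_vec m \<Longrightarrow> d' \<in> carrier_vec m \<Longrightarrow>
      vec_l1 (z - z') \<le> K * (vec_l1 (\<alpha>pt *\<^sub>v ((z - z') - Et *\<^sub>v (d - d'))) + vec_l1 (F (z @\<^sub>v d) - F (z' @\<^sub>v d')))"
proof -
  obtain C \<gamma> b where "decaying_family n steps C \<gamma> b" using steps_decaying .
  then interpret decaying_family n steps C \<gamma> b .
  obtain K0 where K0: "K0 \<ge> 0" "\<And>M x. M \<in> steps \<Longrightarrow> x \<in> carrier_vec n \<Longrightarrow> vec_l1 x \<le> K0 * vec_l1 (M *\<^sub>v x - x)"
    using defect_bound by metis
  obtain R where R: "R \<in> carrier_mat p (p - r)" "\<alpha>pt * R = 1\<^sub>m (p - r)"
    using transpose_right_inverse[OF \<alpha>p \<alpha>p_inj] by metis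
  define LA LR where "LA = mat_l1 A" and "LR = mat_l1 R"
  have L: "LA \<ge> 0" "LR \<ge> 0" by (simp_all add: LA_def LR_def)
  \<comment> \<open>The first summand bounds \<open>A x\<close> through the estimate
    \<open>lx\<close> for \<open>x\<close>, the second bounds \<open>R y\<close>.\<close>
  define K where "K = LA * K0 * (1 + b\<^sub>1 * LR) + LR"
  show thesis
  proof (rule that[of K])
    show "K \<ge> 0" using L K0 b\<^sub>1_nonneg by (simp add: K_def)
    fix z z' d d' :: "real vec"
    assume z: "z \<in> carrier_vec p" "z' \<in> carrier_vec p" and d: "d \<in> carrier_vec m" "d' \<in> carrier_vec m"
    define \<delta> where "\<delta> = d - d'"
    define e where "e = (z - z') - Et *\<^sub>v \<delta>"
    define y where "y = \<alpha>pt *\<^sub>v e"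
    have c: "\<delta> \<in> carrier_vec m" "e \<in> carrier_vec p"
      using z d by (auto simp: \<delta>_def e_def)
    have y: "y \<in> carrier_vec (p - r)" using mult_mat_vec_carrier[OF \<alpha>pt_carrier c(2)] by (simp add: y_def)
    have Ry: "R *\<^sub>v y \<in> carrier_vec p" using R y by simp
    have "\<alpha>pt *\<^sub>v (e - R *\<^sub>v y) = \<alpha>pt *\<^sub>v e - \<alpha>pt *\<^sub>v (R *\<^sub>v y)"
      by (rule mult_minus_distrib_mat_vec[OF \<alpha>pt_carrier c(2) Ry])
    also have "\<alpha>pt *\<^sub>v (R *\<^sub>v y) = y" using assoc_mult_mat_vec[OF \<alpha>pt_carrier R(1) y] R(2) y by simp
    finally have ker: "\<alpha>pt *\<^sub>v (e - R *\<^sub>v y) = 0\<^sub>v (p - r)" using y by (simp add: y_def)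
    have eR: "e - R *\<^sub>v y \<in> carrier_vec p" using c(2) Ry by simp
    \<comment> \<open>After subtracting \<open>R y\<close> the vector is annihilated by the
      transpose of \<alpha>p, so it lies in the range of \<alpha>.\<close>
    obtain a where a: "a \<in> carrier_vec r" "e - R *\<^sub>v y = \<alpha> *\<^sub>v a"
    proof (rule orthogonal_complement_kernel[OF \<alpha> \<alpha>p _ _ _ orth eR ker])
      show "r + (p - r) = p" using r by simp
    qed (use \<alpha>_inj \<alpha>p_inj in blast)+
    define x where "x = a @\<^sub>v \<delta>"
    have x: "x \<in> carrier_vec n" using a c by (simp add: x_def)
    have \<alpha>a: "\<alpha> *\<^sub>v a \<in> carrier_vec p" using \<alpha> a by simp
    have Ax: "A *\<^sub>v x = (\<alpha> *\<^sub>v a + Et *\<^sub>v \<delta>) @\<^sub>v \<delta>" using boldalpha_mult[OF \<alpha> a(1) c(1)] by (simp add: x_def)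
    have zz: "z - z' = \<alpha> *\<^sub>v a + Et *\<^sub>v \<delta> + R *\<^sub>v y"
    proof (rule eq_vecI)
      fix i assume "i < dim_vec (\<alpha> *\<^sub>v a + Et *\<^sub>v \<delta> + R *\<^sub>v y)"
      then have i: "i < p" using carrier_vecD[OF Ry] by simp
      have "(\<alpha> *\<^sub>v a) $ i = (e - R *\<^sub>v y) $ i" using a(2) by simp
      also have "\<dots> = (z - z') $ i - (Et *\<^sub>v \<delta>) $ i - (R *\<^sub>v y) $ i"
        using i carrier_vecD[OF Ry] carrier_vecD[OF c(2)] carrier_vecD[OF z(1)] carrier_vecD[OF z(2)]
          carrier_vecD[OF Et_mult_carrier[OF c(1)]]
        by (simp add: e_def)
      finally show "(z - z') $ i = (\<alpha> *\<^sub>v a + Et *\<^sub>v \<delta> + R *\<^sub>v y) $ i"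
        using i carrier_vecD[OF Ry] carrier_vecD[OF \<alpha>a] carrier_vecD[OF Et_mult_carrier[OF c(1)]] by simp
    qed (use z carrier_vecD[OF Ry] in auto)
    have Ry0: "R *\<^sub>v y @\<^sub>v 0\<^sub>v m \<in> carrier_vec (p + m)" using Ry by simp
    have Axc: "A *\<^sub>v x \<in> carrier_vec (p + m)" by (rule mult_mat_vec_carrier[OF A_carrier x])
    have "(z @\<^sub>v d) - (z' @\<^sub>v d') = (z - z') @\<^sub>v \<delta>"
      using append_minus_append[OF z d] by (simp add: \<delta>_def)
    also have "\<dots> = A *\<^sub>v x + (R *\<^sub>v y @\<^sub>v 0\<^sub>v m)"
      unfolding Ax zz using \<alpha>a c Ry by (subst append_vec_add[of _ p _ _ m]) auto
    finally have dzz: "(z @\<^sub>v d) - (z' @\<^sub>v d') = A *\<^sub>v x + (R *\<^sub>v y @\<^sub>v 0\<^sub>v m)" .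
    obtain \<beta> where \<beta>: "\<beta> \<in> B" "F (z @\<^sub>v d) - F (z' @\<^sub>v d') = transpose_mat \<beta> *\<^sub>v ((z @\<^sub>v d) - (z' @\<^sub>v d'))"
      using F_diff[of "z @\<^sub>v d" "z' @\<^sub>v d'"] z d by auto
    let ?bt = "transpose_mat \<beta>" and ?dF = "F (z @\<^sub>v d) - F (z' @\<^sub>v d')"
    have dFc: "?dF \<in> carrier_vec n" using z d by simp
    have "?dF = ?bt *\<^sub>v (A *\<^sub>v x) + ?bt *\<^sub>v (R *\<^sub>v y @\<^sub>v 0\<^sub>v m)"
      using \<beta>(2) dzz mult_add_distrib_mat_vec[OF \<beta>t_carrier[OF \<beta>(1)] Axc Ry0] by simp
    moreover have bAx: "?bt *\<^sub>v (A *\<^sub>v x) \<in> carrier_vec n" by (rule mult_mat_vec_carrier[OF \<beta>t_carrier[OF \<beta>(1)] Axc])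
    moreover have bR: "?bt *\<^sub>v (R *\<^sub>v y @\<^sub>v 0\<^sub>v m) \<in> carrier_vec n"
      by (rule mult_mat_vec_carrier[OF \<beta>t_carrier[OF \<beta>(1)] Ry0])
    ultimately have "?bt *\<^sub>v (A *\<^sub>v x) = ?dF - ?bt *\<^sub>v (R *\<^sub>v y @\<^sub>v 0\<^sub>v m)"
      using carrier_vecD[OF bAx] carrier_vecD[OF bR] by (intro eq_vecI) auto
    moreover have "(1\<^sub>m n + ?bt * A) *\<^sub>v x - x = ?bt *\<^sub>v (A *\<^sub>v x)"
      using step_mult[OF \<beta>(1) x] carrier_vecD[OF bAx] x by (intro eq_vecI) auto
    ultimately have "vec_l1 ((1\<^sub>m n + ?bt * A) *\<^sub>v x - x) \<le> vec_l1 ?dF + vec_l1 (?bt *\<^sub>v (R *\<^sub>v y @\<^sub>v 0\<^sub>v m))"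
      using vec_l1_diff[OF dFc bR] by simp
    also have "vec_l1 (?bt *\<^sub>v (R *\<^sub>v y @\<^sub>v 0\<^sub>v m)) \<le> b\<^sub>1 * (LR * vec_l1 y)"
    proof -
      have "vec_l1 (?bt *\<^sub>v (R *\<^sub>v y @\<^sub>v 0\<^sub>v m)) \<le> mat_l1 ?bt * vec_l1 (R *\<^sub>v y)"
        using vec_l1_mult_mat_vec_le[OF \<beta>t_carrier[OF \<beta>(1)] Ry0] by simp
      also have "\<dots> \<le> b\<^sub>1 * (LR * vec_l1 y)"
        using mat_l1_\<beta>t[OF \<beta>(1)] vec_l1_mult_mat_vec_le[OF R(1) y] b\<^sub>1_nonneg
        by (intro mult_mono) (auto simp: LR_def)
      finally show ?thesis .
    qed
    finally have "K0 * vec_l1 ((1\<^sub>m n + ?bt * A) *\<^sub>v x - x) \<le> K0 * (vec_l1 ?dF + b\<^sub>1 * (LR * vec_l1 y))"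
      using K0(1) by (intro mult_left_mono) auto
    moreover have "vec_l1 x \<le> K0 * vec_l1 ((1\<^sub>m n + ?bt * A) *\<^sub>v x - x)" using K0(2) \<beta>(1) x by blast
    ultimately have lx: "vec_l1 x \<le> K0 * (vec_l1 ?dF + b\<^sub>1 * (LR * vec_l1 y))" by linarith
    have "vec_l1 (z - z') \<le> vec_l1 ((z - z') @\<^sub>v \<delta>)" by simp
    also have "\<dots> = vec_l1 (A *\<^sub>v x + (R *\<^sub>v y @\<^sub>v 0\<^sub>v m))"
      using append_minus_append[OF z d] dzz by (simp add: \<delta>_def)
    also have "\<dots> \<le> vec_l1 (A *\<^sub>v x) + vec_l1 (R *\<^sub>v y @\<^sub>v 0\<^sub>v m)" by (rule vec_l1_add[OF Axc Ry0])
    also have "\<dots> \<le> LA * vec_l1 x + LR * vec_l1 y"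
      using vec_l1_mult_mat_vec_le[OF A_carrier x] vec_l1_mult_mat_vec_le[OF R(1) y] by (simp add: LA_def LR_def)
    also have "\<dots> \<le> LA * (K0 * (vec_l1 ?dF + b\<^sub>1 * (LR * vec_l1 y))) + LR * vec_l1 y"
      using mult_left_mono[OF lx L(1)] by simp
    also have "\<dots> \<le> K * (vec_l1 y + vec_l1 ?dF)"
    proof -
      have "0 \<le> LA * K0 * vec_l1 y + (LA * K0 * b\<^sub>1 * LR + LR) * vec_l1 ?dF"
        using L K0(1) b\<^sub>1_nonneg by simp
      then show ?thesis by (simp add: K_def algebra_simps)
    qed
    finally show "vec_l1 (z - z') \<le> K * (vec_l1 (\<alpha>pt *\<^sub>v ((z - z') - Et *\<^sub>v (d - d'))) + vec_l1 ?dF)"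
      by (simp add: y_def e_def \<delta>_def)
  qed
qed

end

section \<open>Sums over residue classes and over lags\<close>

lemma sum_residue_class:
  fixes v :: "nat \<Rightarrow> 'a::comm_monoid_add"
  assumes "a < p"
  shows "(\<Sum>b<p*N. if b mod p = a then v b else 0) = (\<Sum>j<N. v (j * p + a))"
proof (induction N)
  case (Suc N)
  have "{..<p * Suc N} = {..<p*N} \<union> {p*N..<p*N+p}" by auto
  then have "(\<Sum>b<p * Suc N. if b mod p = a then v b else 0)
      = (\<Sum>b\<in>{..<p*N} \<union> {p*N..<p*N+p}. if b mod p = a then v b else 0)" by (rule arg_cong)
  also have "\<dots> = (\<Sum>b<p*N. if b mod p = a then v b else 0) + (\<Sum>b=p*N..<p*N+p. if b mod p = a then v b else 0)"
    by (rule sum.union_disjoint) auto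
  also have "(\<Sum>b=p*N..<p*N+p. if b mod p = a then v b else 0) = (\<Sum>b=0..<p. if (b + p*N) mod p = a then v (b + p*N) else 0)"
    using sum.shift_bounds_nat_ivl[of "\<lambda>b. if b mod p = a then v b else 0" 0 "p*N" p] by (simp add: add.commute)
  also have "\<dots> = (\<Sum>b=0..<p. if b = a then v (b + p*N) else 0)"
    by (intro sum.cong) auto
  also have "\<dots> = v (N * p + a)" using assms by (simp add: ac_simps)
  finally show ?case using Suc by simp
qed simp

text \<open>Summation by parts for \<open>f\<^sub>i = g\<^sub>i - g\<^sub>(\<^sub>i\<^sub>-\<^sub>1\<^sub>)\<close>, with \<open>g\<^sub>k = 0\<close>.\<close>
lemma sum_lags_by_parts:
  fixes \<phi> \<gamma> :: "nat \<Rightarrow> int \<Rightarrow> real"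
  assumes k: "k \<ge> 1" and \<gamma>: "\<And>i s. \<gamma> i s = - (\<Sum>j=i+1..k. \<phi> j s)"
  shows "(\<Sum>i=1..k. \<phi> i (t - int i))
    = (\<Sum>i=1..k. \<phi> i (t - 1)) + (\<Sum>i=1..k-1. \<gamma> i (t - int i) - \<gamma> i (t - 1 - int i))"
proof -
  have \<phi>: "\<phi> (Suc i) s = \<gamma> (Suc i) s - \<gamma> i s" if "i < k" for i s
    using that by (simp add: \<gamma> sum.atLeast_Suc_atMost One_nat_def)
  have "(\<Sum>i=1..Suc N. \<phi> i (t - int i))
      = - \<gamma> 0 (t - 1) + \<gamma> (Suc N) (t - int (Suc N)) + (\<Sum>i=1..N. \<gamma> i (t - int i) - \<gamma> i (t - 1 - int i))"
    if "Suc N \<le> k" for N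
    using that
  proof (induction N)
    case 0
    then show ?case using \<phi>[of 0] by simp
  next
    case (Suc N)
    then show ?case using \<phi>[of "Suc N" "t - int (Suc (Suc N))"] by (simp add: algebra_simps)
  qed
  from this[of "k - 1"] k show ?thesis by (simp add: \<gamma>)
qed

section \<open>Stacked states and the homeomorphism \<chi>\<close>

context cointegrated_var
begin

lemma div_p_less: "l < m \<Longrightarrow> l div p < k - 1"
  using p by (intro less_mult_imp_div_less) (simp add: mult.commute)

lemma mod_p_less [simp]: "l mod p < p"
  using p by simp

lemma gstack_index: "l < m \<Longrightarrow> gstack p k f z $ l = g (l div p + 1) z $ (l mod p)"
  by (simp add: gstack_def)

text \<open>The assumption covers exactly the dates that occur, from t - k + 2 (block 1, last
  summand) to t. This precision is needed because a path consists of vectors only from its first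
  initial value on.\<close>

lemma zeta_index:
  assumes l: "l < m" and z: "\<And>s. t - int k + 2 \<le> s \<Longrightarrow> s \<le> t \<Longrightarrow> z s \<in> carrier_vec p"
  shows "zeta p k f z t $ l
    = (\<Sum>i=l div p + 1..k-1. g i (z (t - int i + int (l div p + 1))) $ (l mod p))"
proof -
  have "g i (z (t - int i + int (l div p + 1))) \<in> carrier_vec p" if "i \<in> {l div p + 1..k-1}" for i
    using that k by (intro g_carrier z) (auto simp: of_nat_diff)
  then have "vsum p (\<lambda>i. g i (z (t - int i + int (l div p + 1)))) {l div p + 1..k-1} $ (l mod p)
      = (\<Sum>i=l div p + 1..k-1. g i (z (t - int i + int (l div p + 1))) $ (l mod p))"
    by (intro vsum_index) auto
  then show ?thesis using l by (simp add: zeta_def)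
qed

text \<open>Block j at date t and block j + 1 at date t - 1 are sums of the same terms, except that
  the former has in addition the value of \<open>g j\<close> at \<open>z t\<close>. So adding
  \<open>g\<close> and the superdiagonal of \<open>D\<close> to the lagged stack performs the
  update.\<close>

lemma gstack_plus_D_zeta:
  assumes z: "\<And>s. t + 1 - int k \<le> s \<Longrightarrow> s \<le> t \<Longrightarrow> z s \<in> carrier_vec p"
  shows "gstack p k f (z t) + Dmat p k *\<^sub>v zeta p k f z (t - 1) = zeta p k f z t - zeta p k f z (t - 1)"
proof (rule eq_vecI)
  fix l assume "l < dim_vec (zeta p k f z t - zeta p k f z (t - 1))"
  then have l: "l < m" by (simp add: zeta_def)
  define j a where "j = l div p + 1" and "a = l mod p"
  have j: "1 \<le> j" "j \<le> k - 1" using div_p_less[OF l] by (auto simp: j_def)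
  have now: "zeta p k f z t $ l = (\<Sum>i=j..k-1. g i (z (t - int i + int j)) $ a)"
    unfolding j_def a_def by (rule zeta_index[OF l z]) auto
  \<comment> \<open>For the last block there is no successor, and the sum on the right is
    empty.\<close>
  have lag: "(if l + p < m then zeta p k f z (t - 1) $ (l + p) else 0)
      = (\<Sum>i=j+1..k-1. g i (z (t - int i + int j)) $ a)"
  proof (cases "l + p < m")
    case True
    have "(l + p) div p + 1 = j + 1" "(l + p) mod p = a" using p by (auto simp: j_def a_def)
    then have "zeta p k f z (t - 1) $ (l + p) = (\<Sum>i=j+1..k-1. g i (z (t - 1 - int i + int (j + 1))) $ a)"
      using zeta_index[OF True, of "t - 1" z] z by simp
    then show ?thesis using True by (simp add: algebra_simps)
  next
    case False
    then have "p * (k - 1) div p \<le> (l + p) div p" by (intro div_le_mono) simp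
    then have "k - 1 \<le> j" using p by (simp add: j_def)
    then show ?thesis using False by simp
  qed
  have "(gstack p k f (z t) + Dmat p k *\<^sub>v zeta p k f z (t - 1)) $ l
      = g j (z t) $ a + ((\<Sum>i=j+1..k-1. g i (z (t - int i + int j)) $ a) - zeta p k f z (t - 1) $ l)"
    using l Dmat_mult_index[OF p zeta_carrier l, of z "t - 1"] lag
    by (simp add: gstack_index j_def a_def carrier_vecD[OF D_mult_carrier[OF zeta_carrier]])
  also have "\<dots> = zeta p k f z t $ l - zeta p k f z (t - 1) $ l"
    unfolding now using j by (simp add: sum.atLeast_Suc_atMost[of j "k - Suc 0"] One_nat_def)
  finally show "(gstack p k f (z t) + Dmat p k *\<^sub>v zeta p k f z (t - 1)) $ l
      = (zeta p k f z t - zeta p k f z (t - 1)) $ l"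
    using l by (simp add: carrier_vecD[OF zeta_carrier])
qed (simp add: zeta_def Dmat_def)

lemma Et_zeta_index:
  assumes z: "\<And>s. t - int k + 2 \<le> s \<Longrightarrow> s \<le> t \<Longrightarrow> z s \<in> carrier_vec p" and a: "a < p"
  shows "(Et *\<^sub>v zeta p k f z t) $ a = (\<Sum>i=1..k-1. g i (z (t - int i + 1)) $ a)"
proof (cases "k = 1")
  case True
  then show ?thesis using Emat_transpose_mult_index[OF zeta_carrier a] by simp
next
  case False
  then have "p * 1 \<le> m" using k by (intro mult_le_mono2) simp
  then have am: "a < m" using a by (simp only: mult_1_right)
  then show ?thesis
    using Emat_transpose_mult_index[OF zeta_carrier a] zeta_index[OF am z] a by simp
qed

text \<open>The stack of a path resting at \<open>w\<close>. It is the only solution \<zeta> of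
  \<open>g(w) + D \<zeta> = 0\<close>, since \<open>D\<close> is injective.\<close>

definition Z :: "real vec \<Rightarrow> real vec" where
  "Z w = zeta p k f (\<lambda>_. w) 0"

lemma Z_carrier [simp]: "Z w \<in> carrier_vec m"
  by (simp add: Z_def)

lemma gstack_plus_D_Z:
  assumes "w \<in> carrier_vec p"
  shows "gstack p k f w + Dmat p k *\<^sub>v Z w = 0\<^sub>v m"
proof -
  have "zeta p k f (\<lambda>_. w) (0 - 1) = Z w" by (simp add: zeta_def Z_def)
  then have "gstack p k f w + Dmat p k *\<^sub>v Z w = Z w - Z w"
    using gstack_plus_D_zeta[of 0 "\<lambda>_. w"] assms by (simp add: Z_def)
  then show ?thesis using Z_carrier[of w] by simp
qed

lemma F_state: "w \<in> carrier_vec p \<Longrightarrow> F (f 0 w @\<^sub>v Z w) = \<theta> w @\<^sub>v 0\<^sub>v m"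
  by (simp add: F_append gstack_plus_D_Z)

lemma vsum_g_index:
  "w \<in> carrier_vec p \<Longrightarrow> a < p \<Longrightarrow> vsum p (\<lambda>i. g i w) {1..k-1} $ a = (\<Sum>i=1..k-1. g i w $ a)"
  by (rule vsum_index) auto

lemma vsum_g_carrier [simp]: "w \<in> carrier_vec p \<Longrightarrow> vsum p (\<lambda>i. g i w) {1..k-1} \<in> carrier_vec p"
  by (rule vsum_carrier) auto

lemma h_carrier [simp]: "w \<in> carrier_vec p \<Longrightarrow> hfun p k f w \<in> carrier_vec p"
  by (simp add: hfun_def)

lemma h_index:
  assumes "w \<in> carrier_vec p" "a < p"
  shows "hfun p k f w $ a = f 0 w $ a - (\<Sum>i=1..k-1. g i w $ a)"
proof -
  have "a < dim_vec (vsum p (\<lambda>i. g i w) {1..k-1})"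
    using assms(2) by (simp only: carrier_vecD[OF vsum_g_carrier[OF assms(1)]])
  then show ?thesis using assms by (simp add: hfun_def vsum_g_index)
qed

lemma h_eq: "w \<in> carrier_vec p \<Longrightarrow> hfun p k f w = f 0 w - Et *\<^sub>v Z w"
proof (rule eq_vecI)
  assume w: "w \<in> carrier_vec p"
  have c: "Et *\<^sub>v Z w \<in> carrier_vec p" by simp
  show "dim_vec (hfun p k f w) = dim_vec (f 0 w - Et *\<^sub>v Z w)"
    using carrier_vecD[OF h_carrier[OF w]] carrier_vecD[OF c] by simp
  fix a assume "a < dim_vec (f 0 w - Et *\<^sub>v Z w)"
  then have a: "a < p" using carrier_vecD[OF c] by simp
  show "hfun p k f w $ a = (f 0 w - Et *\<^sub>v Z w) $ a"
    using a w h_index[OF w a] Et_zeta_index[of 0 "\<lambda>_. w" a] carrier_vecD[OF c] by (simp add: Z_def)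
qed

abbreviation "\<chi> \<equiv> chifun p k f \<alpha>p \<theta>"

lemma \<alpha>pt_mult_carrier [simp]: "x \<in> carrier_vec p \<Longrightarrow> \<alpha>pt *\<^sub>v x \<in> carrier_vec (p - r)"
  by (rule mult_mat_vec_carrier[OF \<alpha>pt_carrier])

lemma \<chi>_carrier [simp]: "w \<in> carrier_vec p \<Longrightarrow> \<chi> w \<in> carrier_vec p"
  using append_carrier_vec[of "\<alpha>pt *\<^sub>v hfun p k f w" "p - r" "\<theta> w" r] r by (simp add: chifun_def)

lemma \<chi>_diff:
  assumes w: "w \<in> carrier_vec p" "w' \<in> carrier_vec p"
  shows "\<chi> w - \<chi> w' = (\<alpha>pt *\<^sub>v (hfun p k f w - hfun p k f w')) @\<^sub>v (\<theta> w - \<theta> w')"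
  using append_minus_append[of "\<alpha>pt *\<^sub>v hfun p k f w" "p - r" "\<alpha>pt *\<^sub>v hfun p k f w'" "\<theta> w" r "\<theta> w'"] w
    mult_minus_distrib_mat_vec[OF \<alpha>pt_carrier h_carrier[OF w(1)] h_carrier[OF w(2)]]
  by (simp add: chifun_def)

text \<open>On the states \<open>(f 0 w, Z w)\<close> the two terms on the right of
  \<open>F_expansive\<close> are the increments of the two blocks of \<chi>.\<close>

lemma \<chi>_expansive:
  obtains K where "K \<ge> 0" "\<And>w w'. w \<in> carrier_vec p \<Longrightarrow> w' \<in> carrier_vec p \<Longrightarrow>
      vec_l1 (f 0 w - f 0 w') \<le> K * vec_l1 (\<chi> w - \<chi> w')"
proof -
  obtain K where K: "K \<ge> 0" "\<And>z z' d d'. z \<in> carrier_vec p \<Longrightarrow> z' \<in> carrier_vec p \<Longrightarrow>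
      d \<in> carrier_vec m \<Longrightarrow> d' \<in> carrier_vec m \<Longrightarrow>
      vec_l1 (z - z') \<le> K * (vec_l1 (\<alpha>pt *\<^sub>v ((z - z') - Et *\<^sub>v (d - d'))) + vec_l1 (F (z @\<^sub>v d) - F (z' @\<^sub>v d')))"
    using F_expansive by metis
  show thesis
  proof (rule that[OF K(1)])
    fix w w' :: "real vec" assume w: "w \<in> carrier_vec p" "w' \<in> carrier_vec p"
    have c: "Et *\<^sub>v Z w \<in> carrier_vec p" "Et *\<^sub>v Z w' \<in> carrier_vec p"
      "f 0 w \<in> carrier_vec p" "f 0 w' \<in> carrier_vec p" using w by auto
    have "(f 0 w - f 0 w') - Et *\<^sub>v (Z w - Z w') = (f 0 w - f 0 w') - (Et *\<^sub>v Z w - Et *\<^sub>v Z w')"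
      by (simp add: mult_minus_distrib_mat_vec[OF Et_carrier Z_carrier Z_carrier])
    also have "\<dots> = hfun p k f w - hfun p k f w'"
      unfolding h_eq[OF w(1)] h_eq[OF w(2)] using c[THEN carrier_vecD] by (intro eq_vecI) auto
    finally have h: "(f 0 w - f 0 w') - Et *\<^sub>v (Z w - Z w') = hfun p k f w - hfun p k f w'" .
    have "F (f 0 w @\<^sub>v Z w) - F (f 0 w' @\<^sub>v Z w') = (\<theta> w - \<theta> w') @\<^sub>v (0\<^sub>v m - 0\<^sub>v m)"
      unfolding F_state[OF w(1)] F_state[OF w(2)] using w by (intro append_minus_append[of _ r _ _ m]) auto
    then have "vec_l1 (F (f 0 w @\<^sub>v Z w) - F (f 0 w' @\<^sub>v Z w')) = vec_l1 (\<theta> w - \<theta> w')" by simp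
    then show "vec_l1 (f 0 w - f 0 w') \<le> K * vec_l1 (\<chi> w - \<chi> w')"
      using K(2)[OF c(3,4) Z_carrier Z_carrier, of w w'] \<chi>_diff[OF w] h by simp
  qed
qed

lemma \<chi>_inj: "inj_on \<chi> (carrier_vec p)"
proof (rule inj_onI)
  fix w w' :: "real vec" assume w: "w \<in> carrier_vec p" "w' \<in> carrier_vec p" and eq: "\<chi> w = \<chi> w'"
  obtain K where "vec_l1 (f 0 w - f 0 w') \<le> K * vec_l1 (\<chi> w - \<chi> w')"
    using \<chi>_expansive w by metis
  moreover have "\<chi> w - \<chi> w' = 0\<^sub>v p" using eq w by simp
  ultimately have "f 0 w = f 0 w'" using w by (intro vec_l1_eq_0_imp_eq[of _ p]) auto
  then show "w = w'" using vinv_f0[OF w(1)] vinv_f0[OF w(2)] by metis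
qed

text \<open>The first block of \<open>y\<close> selects an affine subspace, on which
  \<open>F\<close> is solved for the second block of \<open>y\<close> followed by zeros. Those zeros
  force the stack \<open>d\<close> to be \<open>Z w\<close>, so the state found comes from a point
  \<open>w\<close>, and moving along the range of \<open>A\<close> has not changed the first
  block.\<close>

lemma \<chi>_surj:
  assumes y: "y \<in> carrier_vec p"
  shows "\<exists>w\<in>carrier_vec p. \<chi> w = y"
proof -
  obtain y1 y2 where y12: "y1 \<in> carrier_vec (p - r)" "y2 \<in> carrier_vec r" "y = y1 @\<^sub>v y2"
  proof -
    have "y \<in> carrier_vec ((p - r) + r)" using y r by simp
    then have "y = vec_first y (p - r) @\<^sub>v vec_last y r" by simp
    then show thesis using that vec_first_carrier vec_last_carrier by blast
  qed
  obtain R where R: "R \<in> carrier_mat p (p - r)" "\<alpha>pt * R = 1\<^sub>m (p - r)"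
    using transpose_right_inverse[OF \<alpha>p \<alpha>p_inj] by metis
  have Ry: "R *\<^sub>v y1 \<in> carrier_vec p" using R y12 by simp
  obtain x where x: "x \<in> carrier_vec n" "F ((R *\<^sub>v y1 @\<^sub>v 0\<^sub>v m) + A *\<^sub>v x) = y2 @\<^sub>v 0\<^sub>v m"
    using F_surj_on_affine[of "R *\<^sub>v y1 @\<^sub>v 0\<^sub>v m" "y2 @\<^sub>v 0\<^sub>v m"] Ry y12 by auto
  obtain a d where ad: "a \<in> carrier_vec r" "d \<in> carrier_vec m" "x = a @\<^sub>v d" using split_n[OF x(1)] .
  have \<alpha>a: "\<alpha> *\<^sub>v a \<in> carrier_vec p" using \<alpha> ad by simp
  define v where "v = R *\<^sub>v y1 + (\<alpha> *\<^sub>v a + Et *\<^sub>v d)"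
  have v: "v \<in> carrier_vec p" using Ry \<alpha>a ad by (simp add: v_def)
  define w where "w = vinv p (f 0) v"
  have w: "w \<in> carrier_vec p" "f 0 w = v" using v by (simp_all add: w_def)
  have "(R *\<^sub>v y1 @\<^sub>v 0\<^sub>v m) + A *\<^sub>v x = v @\<^sub>v d"
    unfolding ad(3) boldalpha_mult[OF \<alpha> ad(1,2)] v_def
    using Ry \<alpha>a ad by (subst append_vec_add[of _ p _ _ m]) auto
  then have "\<theta> w @\<^sub>v (gstack p k f w + Dmat p k *\<^sub>v d) = y2 @\<^sub>v 0\<^sub>v m"
    using x(2) F_append[OF w(1) ad(2)] w(2) by simp
  then have \<theta>w: "\<theta> w = y2" and Dd: "gstack p k f w + Dmat p k *\<^sub>v d = 0\<^sub>v m"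
    using append_vec_eq[of "\<theta> w" r y2] w(1) y12 by auto
  have Dc: "Dmat p k *\<^sub>v d \<in> carrier_vec m" "Dmat p k *\<^sub>v Z w \<in> carrier_vec m" using ad by auto
  have "Dmat p k *\<^sub>v d = Dmat p k *\<^sub>v Z w"
  proof (rule eq_vecI)
    fix l assume "l < dim_vec (Dmat p k *\<^sub>v Z w)"
    then have l: "l < m" using carrier_vecD[OF Dc(2)] by simp
    have "(gstack p k f w + Dmat p k *\<^sub>v d) $ l = (gstack p k f w + Dmat p k *\<^sub>v Z w) $ l"
      using Dd gstack_plus_D_Z[OF w(1)] by simp
    then show "(Dmat p k *\<^sub>v d) $ l = (Dmat p k *\<^sub>v Z w) $ l"
      using l Dc[THEN carrier_vecD] by simp
  qed (use Dc[THEN carrier_vecD] in simp)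
  then have "Dmat p k *\<^sub>v (d - Z w) = 0\<^sub>v m"
    using mult_minus_distrib_mat_vec[OF Dmat_carrier ad(2) Z_carrier] Dc by simp
  then have dZ0: "d - Z w = 0\<^sub>v m" using Dmat_inj[OF p, of "d - Z w"] ad(2) by simp
  have dZ: "d = Z w" by (rule vec_l1_eq_0_imp_eq[OF ad(2) Z_carrier]) (simp add: dZ0)
  have "hfun p k f w = R *\<^sub>v y1 + \<alpha> *\<^sub>v a"
    unfolding h_eq[OF w(1)] w(2) v_def dZ
    using carrier_vecD[OF Ry] carrier_vecD[OF \<alpha>a] carrier_vecD[OF Et_mult_carrier[OF Z_carrier]]
    by (intro eq_vecI) auto
  then have "\<alpha>pt *\<^sub>v hfun p k f w = \<alpha>pt *\<^sub>v (R *\<^sub>v y1) + \<alpha>pt *\<^sub>v (\<alpha> *\<^sub>v a)"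
    using mult_add_distrib_mat_vec[OF \<alpha>pt_carrier Ry \<alpha>a] by simp
  also have "\<dots> = y1"
    using \<alpha>pt_\<alpha>[OF ad(1)] assoc_mult_mat_vec[OF \<alpha>pt_carrier R(1) y12(1)] R(2) y12(1) by simp
  finally have "\<chi> w = y" using \<theta>w y12(3) by (simp add: chifun_def)
  then show ?thesis using w(1) by blast
qed

lemma \<chi>_bij: "bij_betw \<chi> (carrier_vec p) (carrier_vec p)"
proof (rule bij_betw_imageI[OF \<chi>_inj])
  show "\<chi> ` carrier_vec p = carrier_vec p" using \<chi>_surj \<chi>_carrier by blast
qed

lemma F_Lipschitz:
  assumes "zz \<in> carrier_vec (p + m)" "zz' \<in> carrier_vec (p + m)"
  shows "vec_l1 (F zz - F zz') \<le> b\<^sub>1 * vec_l1 (zz - zz')"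
proof -
  obtain \<beta> where \<beta>: "\<beta> \<in> B" "F zz - F zz' = transpose_mat \<beta> *\<^sub>v (zz - zz')"
    using F_diff[OF assms] .
  have "vec_l1 (F zz - F zz') \<le> mat_l1 (transpose_mat \<beta>) * vec_l1 (zz - zz')"
    unfolding \<beta>(2) using assms by (intro vec_l1_mult_mat_vec_le[OF \<beta>t_carrier[OF \<beta>(1)]]) simp
  also have "\<dots> \<le> b\<^sub>1 * vec_l1 (zz - zz')" using mat_l1_\<beta>t[OF \<beta>(1)] by (intro mult_right_mono) auto
  finally show ?thesis .
qed

text \<open>With zero stack, \<open>F\<close> returns \<theta> and \<open>g\<close> undisturbed, so
  both inherit its Lipschitz bound in the variable \<open>f 0 w\<close>.\<close>

lemma boldtheta_dominated:
  assumes w: "w \<in> carrier_vec p" "w' \<in> carrier_vec p"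
  shows "vec_l1 (\<theta> w - \<theta> w') + vec_l1 (gstack p k f w - gstack p k f w') \<le> b\<^sub>1 * vec_l1 (f 0 w - f 0 w')"
proof -
  have "Dmat p k *\<^sub>v 0\<^sub>v m = 0\<^sub>v m" by (intro eq_vecI) (auto simp: Dmat_def)
  then have F0: "F (f 0 w @\<^sub>v 0\<^sub>v m) = \<theta> w @\<^sub>v gstack p k f w" if "w \<in> carrier_vec p" for w
    using F_append[OF that, of "0\<^sub>v m"] gstack_carrier[of w] by simp
  have "F (f 0 w @\<^sub>v 0\<^sub>v m) - F (f 0 w' @\<^sub>v 0\<^sub>v m) = (\<theta> w - \<theta> w') @\<^sub>v (gstack p k f w - gstack p k f w')"
    unfolding F0[OF w(1)] F0[OF w(2)] using w by (intro append_minus_append[of _ r _ _ m]) auto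
  moreover have "(f 0 w @\<^sub>v 0\<^sub>v m) - (f 0 w' @\<^sub>v 0\<^sub>v m) = (f 0 w - f 0 w') @\<^sub>v (0\<^sub>v m - 0\<^sub>v m)"
    using w by (intro append_minus_append[of _ p _ _ m]) auto
  ultimately show ?thesis
    using F_Lipschitz[of "f 0 w @\<^sub>v 0\<^sub>v m" "f 0 w' @\<^sub>v 0\<^sub>v m"] w by simp
qed

lemma \<chi>_dominated:
  obtains K where "K \<ge> 0" "\<And>w w'. w \<in> carrier_vec p \<Longrightarrow> w' \<in> carrier_vec p \<Longrightarrow>
      vec_l1 (\<chi> w - \<chi> w') \<le> K * vec_l1 (f 0 w - f 0 w')"
proof -
  \<comment> \<open>In each of the \<open>p\<close> coordinates, \<open>h\<close> consists of one
    term \<open>f 0\<close> and k - 1 terms \<open>g i\<close>, each of the latter bounded through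
    \<open>b\<^sub>1\<close>.\<close>
  define Kh where "Kh = p * (1 + (k - 1) * b\<^sub>1)"
  define K where "K = mat_l1 \<alpha>pt * Kh + b\<^sub>1"
  have Kh: "Kh \<ge> 0" using b\<^sub>1_nonneg by (simp add: Kh_def)
  show thesis
  proof (rule that[of K])
    show "K \<ge> 0" using Kh b\<^sub>1_nonneg by (simp add: K_def)
    fix w w' :: "real vec" assume w: "w \<in> carrier_vec p" "w' \<in> carrier_vec p"
    define \<Delta> where "\<Delta> = vec_l1 (f 0 w - f 0 w')"
    have hc: "hfun p k f w - hfun p k f w' \<in> carrier_vec p" using w by simp
    have gs: "vec_l1 (gstack p k f w - gstack p k f w') \<le> b\<^sub>1 * \<Delta>"
      and th: "vec_l1 (\<theta> w - \<theta> w') \<le> b\<^sub>1 * \<Delta>"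
      using boldtheta_dominated[OF w] vec_l1_nonneg[of "\<theta> w - \<theta> w'"]
        vec_l1_nonneg[of "gstack p k f w - gstack p k f w'"] unfolding \<Delta>_def by linarith+
    have entry: "\<bar>(hfun p k f w - hfun p k f w') $ a\<bar> \<le> (1 + (k - 1) * b\<^sub>1) * \<Delta>" if a: "a < p" for a
    proof -
      have gle: "\<bar>g i w $ a - g i w' $ a\<bar> \<le> b\<^sub>1 * \<Delta>" if i: "i \<in> {1..k-1}" for i
      proof -
        \<comment> \<open>The position of coordinate \<open>a\<close> of block \<open>i\<close> in
          the stack; blocks are numbered from 1, positions from 0.\<close>
        let ?l = "(i - 1) * p + a"
        have "?l < (i - 1) * p + p" using a by simp
        also have "\<dots> = p * i" using i by (cases i) auto
        also have "\<dots> \<le> m" using i by simp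
        finally have l: "?l < m" .
        have il: "?l div p + 1 = i" "?l mod p = a" using a i by auto
        have "gstack p k f v $ ?l = g i v $ a" for v
          using gstack_index[OF l, of v] by (simp only: il)
        then have "\<bar>g i w $ a - g i w' $ a\<bar> = norm ((gstack p k f w - gstack p k f w') $ ?l)"
          using l by simp
        also have "\<dots> \<le> vec_l1 (gstack p k f w - gstack p k f w')"
          using l by (intro norm_index_le_vec_l1) simp
        finally show ?thesis using gs by linarith
      qed
      have ahd: "a < dim_vec (hfun p k f w')" using a by (simp only: carrier_vecD[OF h_carrier[OF w(2)]])
      have afd: "a < dim_vec (f 0 w')" using a by (simp only: carrier_vecD[OF f_carrier[OF le0 w(2)]])
      have "(hfun p k f w - hfun p k f w') $ a
          = (f 0 w - f 0 w') $ a - (\<Sum>i=1..k-1. g i w $ a - g i w' $ a)"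
        using a w ahd afd
        by (simp add: h_index sum_subtractf)
      then have "\<bar>(hfun p k f w - hfun p k f w') $ a\<bar>
          \<le> \<bar>(f 0 w - f 0 w') $ a\<bar> + \<bar>\<Sum>i=1..k-1. g i w $ a - g i w' $ a\<bar>"
        by (simp only: abs_triangle_ineq4)
      moreover have "\<bar>(f 0 w - f 0 w') $ a\<bar> \<le> \<Delta>"
        unfolding \<Delta>_def real_norm_def[symmetric] using afd by (intro norm_index_le_vec_l1) simp
      moreover have "\<bar>\<Sum>i=1..k-1. g i w $ a - g i w' $ a\<bar> \<le> (\<Sum>i=1..k-1. b\<^sub>1 * \<Delta>)"
        by (rule order_trans[OF sum_abs sum_mono[OF gle]])
      ultimately have "\<bar>(hfun p k f w - hfun p k f w') $ a\<bar> \<le> \<Delta> + (\<Sum>i=1..k-1. b\<^sub>1 * \<Delta>)"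
        by linarith
      then show ?thesis by (simp add: algebra_simps)
    qed
    have "vec_l1 (hfun p k f w - hfun p k f w') \<le> (\<Sum>a<p. (1 + (k - 1) * b\<^sub>1) * \<Delta>)"
      unfolding vec_l1_def carrier_vecD[OF hc] real_norm_def by (intro sum_mono entry) simp
    then have h: "vec_l1 (hfun p k f w - hfun p k f w') \<le> Kh * \<Delta>" by (simp add: Kh_def algebra_simps)
    have "vec_l1 (\<alpha>pt *\<^sub>v (hfun p k f w - hfun p k f w')) \<le> mat_l1 \<alpha>pt * (Kh * \<Delta>)"
      using vec_l1_mult_mat_vec_le[OF \<alpha>pt_carrier hc] mult_left_mono[OF h mat_l1_nonneg[of \<alpha>pt]] by linarith
    then show "vec_l1 (\<chi> w - \<chi> w') \<le> K * vec_l1 (f 0 w - f 0 w')"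
      using th by (simp add: \<chi>_diff[OF w] K_def \<Delta>_def[symmetric] algebra_simps)
  qed
qed

lemma vnorm_le_of_vec_l1_le:
  assumes "vec_l1 x \<le> K * vec_l1 y" "K \<ge> 0" "y \<in> carrier_vec p"
  shows "vnorm x \<le> (K * p) * vnorm y"
proof -
  have "vnorm x \<le> K * vec_l1 y" using vnorm_le_vec_l1 assms(1) by (rule order_trans)
  also have "\<dots> \<le> K * (p * vnorm y)" using vec_l1_le_vnorm[of y] assms by (intro mult_left_mono) auto
  finally show ?thesis by simp
qed

lemma vinv_\<chi>: "w \<in> carrier_vec p \<Longrightarrow> vinv p \<chi> (\<chi> w) = w"
  using \<chi>_inj by (simp add: vinv_def the_inv_into_f_f)

lemma \<chi>_vinv: "y \<in> carrier_vec p \<Longrightarrow> \<chi> (vinv p \<chi> y) = y"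
  using \<chi>_bij by (simp add: vinv_def f_the_inv_into_f_bij_betw)

lemma vinv_\<chi>_carrier: "y \<in> carrier_vec p \<Longrightarrow> vinv p \<chi> y \<in> carrier_vec p"
  using \<chi>_bij unfolding vinv_def bij_betw_def by (metis order_refl the_inv_into_into)

theorem \<chi>_homeo: "homeo_vec p \<chi>"
proof -
  obtain K where K: "K \<ge> 0" "\<And>w w'. w \<in> carrier_vec p \<Longrightarrow> w' \<in> carrier_vec p \<Longrightarrow>
      vec_l1 (\<chi> w - \<chi> w') \<le> K * vec_l1 (f 0 w - f 0 w')"
    using \<chi>_dominated by metis
  obtain K' where K': "K' \<ge> 0" "\<And>w w'. w \<in> carrier_vec p \<Longrightarrow> w' \<in> carrier_vec p \<Longrightarrow>
      vec_l1 (f 0 w - f 0 w') \<le> K' * vec_l1 (\<chi> w - \<chi> w')"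
    using \<chi>_expansive by metis
  have f0c: "vcont_on p (f 0)" "vcont_on p (vinv p (f 0))" using f0 by (auto simp: homeo_vec_def)
  have "vcont_on p \<chi>"
  proof (rule vcont_on_dominated[OF f0c(1)])
    show "K * p \<ge> 0" using K by simp
    show "vnorm (\<chi> y - \<chi> x) \<le> K * p * vnorm (f 0 y - f 0 x)"
      if "x \<in> carrier_vec p" "y \<in> carrier_vec p" for x y
      using K that by (intro vnorm_le_of_vec_l1_le) auto
  qed
  moreover have "vcont_on p (vinv p \<chi>)"
  proof -
    let ?H = "\<lambda>y. f 0 (vinv p \<chi> y)"
    have "vcont_on p (\<lambda>y. vinv p (f 0) (?H y))"
    proof (rule vcont_on_compose_Lipschitz[OF f0c(2)])
      show "K' * p \<ge> 0" using K' by simp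
      show "?H y \<in> carrier_vec p" if "y \<in> carrier_vec p" for y using vinv_\<chi>_carrier[OF that] by simp
      fix x y :: "real vec" assume xy: "x \<in> carrier_vec p" "y \<in> carrier_vec p"
      have "vec_l1 (?H y - ?H x) \<le> K' * vec_l1 (y - x)"
        using K'(2)[OF vinv_\<chi>_carrier vinv_\<chi>_carrier, of y x] xy by (simp add: \<chi>_vinv)
      then show "vnorm (?H y - ?H x) \<le> K' * p * vnorm (y - x)"
        using K'(1) xy by (intro vnorm_le_of_vec_l1_le) auto
    qed
    then show ?thesis by (subst vcont_on_cong[where G = "\<lambda>y. vinv p (f 0) (?H y)"]) (auto simp: vinv_\<chi>_carrier)
  qed
  ultimately show ?thesis using \<chi>_bij by (simp add: homeo_vec_def)
qed

end

section \<open>Paths of the model\<close>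

locale cointegrated_var_path = cointegrated_var +
  fixes z :: "int \<Rightarrow> real vec" and u :: "nat \<Rightarrow> real vec"
  assumes z: "\<And>t :: int. t \<ge> 1 - int k \<Longrightarrow> z t \<in> carrier_vec p"
    and u: "\<And>t :: nat. t \<ge> 1 \<Longrightarrow> u t \<in> carrier_vec p"
    and rec: "\<And>t :: nat. t \<ge> 1 \<Longrightarrow> f 0 (z (int t)) = c + vsum p (\<lambda>i. f i (z (int t - int i))) {1..k} + u t"
begin

abbreviation "\<zeta> \<equiv> zeta p k f z"
abbreviation "\<xi> \<equiv> xi p k r f \<mu> \<theta> z"
abbreviation "S\<chi> \<equiv> Schi p k r \<alpha>p"

lemma z_carrier [simp]: "t \<ge> 0 \<Longrightarrow> z t \<in> carrier_vec p"
  using z[of t] k by simp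

lemma xi_eq_F:
  assumes t: "t \<ge> 0"
  shows "\<xi> t = (\<mu> @\<^sub>v 0\<^sub>v m) + F (f 0 (z t) @\<^sub>v \<zeta> (t - 1))"
proof -
  have "\<xi> t = ((\<mu> @\<^sub>v 0\<^sub>v m) + (\<theta> (z t) @\<^sub>v gstack p k f (z t))) + (0\<^sub>v r @\<^sub>v Dmat p k *\<^sub>v \<zeta> (t - 1))"
    using D0mat_mult[OF z_carrier[OF t] zeta_carrier] by (simp add: xi_def boldtheta_def)
  also have "\<dots> = (\<mu> @\<^sub>v 0\<^sub>v m) + ((\<theta> (z t) @\<^sub>v gstack p k f (z t)) + (0\<^sub>v r @\<^sub>v Dmat p k *\<^sub>v \<zeta> (t - 1)))"
    using \<mu> t by (intro assoc_add_vec[of _ "r + m"]) auto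
  also have "(\<theta> (z t) @\<^sub>v gstack p k f (z t)) + (0\<^sub>v r @\<^sub>v Dmat p k *\<^sub>v \<zeta> (t - 1))
      = (\<theta> (z t) + 0\<^sub>v r) @\<^sub>v (gstack p k f (z t) + Dmat p k *\<^sub>v \<zeta> (t - 1))"
    using t by (intro append_vec_add[of _ r _ _ m]) auto
  finally show ?thesis using t F_append[OF z_carrier[OF t] zeta_carrier] by simp
qed

lemma xi_eq:
  assumes t: "t \<ge> 0"
  shows "\<xi> t = (\<mu> + \<theta> (z t)) @\<^sub>v (\<zeta> t - \<zeta> (t - 1))"
proof -
  have "gstack p k f (z t) + Dmat p k *\<^sub>v \<zeta> (t - 1) = \<zeta> t - \<zeta> (t - 1)"
    using t by (intro gstack_plus_D_zeta z) simp
  then have "\<xi> t = (\<mu> @\<^sub>v 0\<^sub>v m) + (\<theta> (z t) @\<^sub>v (\<zeta> t - \<zeta> (t - 1)))"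
    using xi_eq_F[OF t] F_append[OF z_carrier[OF t] zeta_carrier] by simp
  also have "\<dots> = (\<mu> + \<theta> (z t)) @\<^sub>v (0\<^sub>v m + (\<zeta> t - \<zeta> (t - 1)))"
    using \<mu> t by (intro append_vec_add[of _ r _ _ m]) auto
  finally show ?thesis using left_zero_vec[OF minus_carrier_vec[OF zeta_carrier zeta_carrier]] by simp
qed

lemma xi_carrier [simp]: "t \<ge> 0 \<Longrightarrow> \<xi> t \<in> carrier_vec n"
  using \<mu> by (simp add: xi_eq)

text \<open>The model in error-correction form: apart from the shock, \<open>f 0\<close> along the
  path moves by the first block of \<open>A\<close> applied to the previous \<xi>. The term with
  \<alpha> comes from \<open>c\<close> and \<pi>, and what is left of the lags is summed by
  parts.\<close>

lemma f0_step:
  fixes t :: nat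
  assumes t: "t \<ge> 1"
  shows "f 0 (z (int t)) = f 0 (z (int t - 1))
    + (\<alpha> *\<^sub>v (\<mu> + \<theta> (z (int t - 1))) + Et *\<^sub>v (\<zeta> (int t - 1) - \<zeta> (int t - 2))) + u t"
proof (rule eq_vecI)
  let ?s = "int t - 1"
  have zs: "z ?s \<in> carrier_vec p" using t by simp
  have zi: "z (int t - int i) \<in> carrier_vec p" if "i \<le> k" for i using t that by (intro z) simp
  have c: "c \<in> carrier_vec p" using var by (simp add: var_model_def)
  have ac: "\<alpha> *\<^sub>v (\<mu> + \<theta> (z ?s)) \<in> carrier_vec p"
    using zs by (intro mult_mat_vec_carrier[OF \<alpha>] add_carrier_vec \<mu> \<theta>)
  have ec: "Et *\<^sub>v (\<zeta> ?s - \<zeta> (int t - 2)) \<in> carrier_vec p" by simp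
  have uc: "u t \<in> carrier_vec p" using u t by simp
  have f0c: "f 0 (z ?s) \<in> carrier_vec p" using zs by simp
  show "dim_vec (f 0 (z (int t))) = dim_vec (f 0 (z ?s) + (\<alpha> *\<^sub>v (\<mu> + \<theta> (z ?s)) + Et *\<^sub>v (\<zeta> ?s - \<zeta> (int t - 2))) + u t)"
    using carrier_vecD[OF uc] carrier_vecD[OF f_carrier[OF le0 z_carrier[of "int t"]]] by simp
  fix a assume "a < dim_vec (f 0 (z ?s) + (\<alpha> *\<^sub>v (\<mu> + \<theta> (z ?s)) + Et *\<^sub>v (\<zeta> ?s - \<zeta> (int t - 2))) + u t)"
  then have a: "a < p" using carrier_vecD[OF uc] by simp
  \<comment> \<open>Fixing a coordinate turns the lagged terms into real sequences, to which
    \<open>sum_lags_by_parts\<close> applies.\<close>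
  define \<phi> where "\<phi> i s = f i (z s) $ a" for i s
  define \<gamma> where "\<gamma> i s = - (\<Sum>j=i+1..k. \<phi> j s)" for i s
  have g\<gamma>: "g i (z s) $ a = \<gamma> i s" if "z s \<in> carrier_vec p" for i s
  proof -
    have v: "vsum p (\<lambda>j. f j (z s)) {i+1..k} \<in> carrier_vec p" using that by (intro vsum_carrier) auto
    have "vsum p (\<lambda>j. f j (z s)) {i+1..k} $ a = (\<Sum>j=i+1..k. \<phi> j s)"
      unfolding \<phi>_def using that a by (intro vsum_index) auto
    moreover have "a < dim_vec (vsum p (\<lambda>j. f j (z s)) {i+1..k})" using a by (simp only: carrier_vecD[OF v])
    ultimately show ?thesis by (simp add: gfun_def \<gamma>_def)
  qed
  have lhs: "f 0 (z (int t)) $ a = c $ a + (\<Sum>i=1..k. \<phi> i (int t - int i)) + u t $ a"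
  proof -
    have v: "vsum p (\<lambda>i. f i (z (int t - int i))) {1..k} \<in> carrier_vec p" using zi by (intro vsum_carrier) auto
    have "vsum p (\<lambda>i. f i (z (int t - int i))) {1..k} $ a = (\<Sum>i=1..k. \<phi> i (int t - int i))"
      unfolding \<phi>_def using zi a by (intro vsum_index) auto
    moreover have "a < dim_vec (vsum p (\<lambda>i. f i (z (int t - int i))) {1..k})" using a by (simp only: carrier_vecD[OF v])
    moreover have "a < dim_vec (u t)" using a by (simp only: carrier_vecD[OF uc])
    ultimately show ?thesis unfolding rec[OF t] by simp
  qed
  have alpha: "(\<alpha> *\<^sub>v (\<mu> + \<theta> (z ?s))) $ a = c $ a + (- f 0 (z ?s) $ a + (\<Sum>i=1..k. \<phi> i ?s))"
  proof -
    have v: "vsum p (\<lambda>i. f i (z ?s)) {1..k} \<in> carrier_vec p" using zs by (intro vsum_carrier) auto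
    have "\<alpha> *\<^sub>v (\<mu> + \<theta> (z ?s)) = c + pifun p k f (z ?s)"
      using mult_add_distrib_mat_vec[OF \<alpha> \<mu> \<theta>[OF zs]] c_eq pi_eq[OF zs] by simp
    moreover have "vsum p (\<lambda>i. f i (z ?s)) {1..k} $ a = (\<Sum>i=1..k. \<phi> i ?s)"
      unfolding \<phi>_def using zs a by (intro vsum_index) auto
    moreover have "a < dim_vec (vsum p (\<lambda>i. f i (z ?s)) {1..k})" using a by (simp only: carrier_vecD[OF v])
    moreover have "a < dim_vec (f 0 (z ?s))" using a by (simp only: carrier_vecD[OF f0c])
    ultimately show ?thesis by (simp add: pifun_def)
  qed
  have E: "(Et *\<^sub>v (\<zeta> ?s - \<zeta> (int t - 2))) $ a = (\<Sum>i=1..k-1. \<gamma> i (int t - int i) - \<gamma> i (?s - int i))"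
  proof -
    have e1: "(Et *\<^sub>v \<zeta> ?s) $ a = (\<Sum>i=1..k-1. g i (z (?s - int i + 1)) $ a)"
      using t a by (intro Et_zeta_index z) auto
    also have "\<dots> = (\<Sum>i=1..k-1. \<gamma> i (int t - int i))"
    proof (rule sum.cong)
      fix i assume i: "i \<in> {1..k-1}"
      have "?s - int i + 1 = int t - int i" by simp
      then show "g i (z (?s - int i + 1)) $ a = \<gamma> i (int t - int i)" using g\<gamma>[OF zi, of i i] i by auto
    qed simp
    finally have e1: "(Et *\<^sub>v \<zeta> ?s) $ a = (\<Sum>i=1..k-1. \<gamma> i (int t - int i))" .
    \<comment> \<open>For \<open>t = 1\<close> this reaches back exactly to
      \<open>z (1 - int k)\<close>, the earliest initial value.\<close>
    have "(Et *\<^sub>v \<zeta> (int t - 2)) $ a = (\<Sum>i=1..k-1. g i (z (int t - 2 - int i + 1)) $ a)"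
      using t a by (intro Et_zeta_index z) auto
    also have "\<dots> = (\<Sum>i=1..k-1. \<gamma> i (?s - int i))"
    proof (rule sum.cong)
      fix i assume i: "i \<in> {1..k-1}"
      have s: "int t - 2 - int i + 1 = ?s - int i" by simp
      have zc: "z (?s - int i) \<in> carrier_vec p" using i t k by (intro z) auto
      show "g i (z (int t - 2 - int i + 1)) $ a = \<gamma> i (?s - int i)" unfolding s by (rule g\<gamma>[OF zc])
    qed simp
    finally have e2: "(Et *\<^sub>v \<zeta> (int t - 2)) $ a = (\<Sum>i=1..k-1. \<gamma> i (?s - int i))" .
    show ?thesis
      using e1 e2 a mult_minus_distrib_mat_vec[OF Et_carrier zeta_carrier[of z ?s] zeta_carrier[of z "int t - 2"]]
      by (simp add: sum_subtractf)
  qed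
  have "(f 0 (z ?s) + (\<alpha> *\<^sub>v (\<mu> + \<theta> (z ?s)) + Et *\<^sub>v (\<zeta> ?s - \<zeta> (int t - 2))) + u t) $ a
      = f 0 (z ?s) $ a + ((\<alpha> *\<^sub>v (\<mu> + \<theta> (z ?s))) $ a + (Et *\<^sub>v (\<zeta> ?s - \<zeta> (int t - 2))) $ a) + u t $ a"
    using a uc ec by (subst index_add_vec; simp only: carrier_vecD[OF uc] carrier_vecD[OF ec] index_add_vec)+
  then show "f 0 (z (int t)) $ a = (f 0 (z ?s) + (\<alpha> *\<^sub>v (\<mu> + \<theta> (z ?s)) + Et *\<^sub>v (\<zeta> ?s - \<zeta> (int t - 2))) + u t) $ a"
    using lhs alpha E sum_lags_by_parts[OF k \<gamma>_def, where t = "int t"] by simp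
qed

text \<open>\<xi> is \<open>F\<close> of the state up to a constant, so condition (iii) for two
  consecutive states yields \<beta>, and the move of the state already contains the previous
  \<xi>.\<close>

lemma xi_step:
  fixes t :: nat
  assumes t: "t \<ge> 1"
  obtains \<beta> where "\<beta> \<in> B" "\<xi> (int t) = (1\<^sub>m n + transpose_mat \<beta> * A) *\<^sub>v \<xi> (int t - 1) + transpose_mat \<beta> *\<^sub>v (u t @\<^sub>v 0\<^sub>v m)"
proof -
  let ?s = "int t - 1"
  \<comment> \<open>The stack in the state lags one date behind the variable
    \<open>z\<close>.\<close>
  define X X' where "X = f 0 (z (int t)) @\<^sub>v \<zeta> ?s" and "X' = f 0 (z ?s) @\<^sub>v \<zeta> (int t - 2)"
  have s: "?s \<ge> 0" "int t \<ge> 0" using t by auto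
  have Xc: "X \<in> carrier_vec (p + m)" "X' \<in> carrier_vec (p + m)" using s by (auto simp: X_def X'_def)
  obtain \<beta> where \<beta>: "\<beta> \<in> B" "F X - F X' = transpose_mat \<beta> *\<^sub>v (X - X')" using F_diff[OF Xc] .
  have c: "\<mu> + \<theta> (z ?s) \<in> carrier_vec r" "\<zeta> ?s - \<zeta> (int t - 2) \<in> carrier_vec m" "u t \<in> carrier_vec p"
    "f 0 (z (int t)) \<in> carrier_vec p" "f 0 (z ?s) \<in> carrier_vec p"
    using \<mu> s u t by auto
  have ac: "\<alpha> *\<^sub>v (\<mu> + \<theta> (z ?s)) \<in> carrier_vec p" by (rule mult_mat_vec_carrier[OF \<alpha> c(1)])
  define y where "y = \<alpha> *\<^sub>v (\<mu> + \<theta> (z ?s)) + Et *\<^sub>v (\<zeta> ?s - \<zeta> (int t - 2))"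
  have y: "y \<in> carrier_vec p" using ac c(2) by (simp add: y_def)
  have "\<xi> ?s = (\<mu> + \<theta> (z ?s)) @\<^sub>v (\<zeta> ?s - \<zeta> (?s - 1))" by (rule xi_eq[OF s(1)])
  also have "?s - 1 = int t - 2" by simp
  finally have Axi: "A *\<^sub>v \<xi> ?s = y @\<^sub>v (\<zeta> ?s - \<zeta> (int t - 2))"
    using boldalpha_mult[OF \<alpha> c(1,2)] by (simp add: y_def)
  have "X - X' = (f 0 (z (int t)) - f 0 (z ?s)) @\<^sub>v (\<zeta> ?s - \<zeta> (int t - 2))"
    unfolding X_def X'_def by (rule append_minus_append[OF c(4,5) zeta_carrier zeta_carrier])
  also have "f 0 (z (int t)) - f 0 (z ?s) = y + u t"
    using f0_step[OF t] carrier_vecD[OF c(3)] carrier_vecD[OF c(5)] carrier_vecD[OF y]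
    by (intro eq_vecI) (auto simp: y_def[symmetric])
  also have "(y + u t) @\<^sub>v (\<zeta> ?s - \<zeta> (int t - 2)) = A *\<^sub>v \<xi> ?s + (u t @\<^sub>v 0\<^sub>v m)"
    unfolding Axi using y c by (subst append_vec_add[of _ p _ _ m]) auto
  finally have dX: "X - X' = A *\<^sub>v \<xi> ?s + (u t @\<^sub>v 0\<^sub>v m)" .
  have xs: "\<xi> ?s \<in> carrier_vec n" using s by simp
  have Axc: "A *\<^sub>v \<xi> ?s \<in> carrier_vec (p + m)" by (rule mult_mat_vec_carrier[OF A_carrier xs])
  have u0: "u t @\<^sub>v 0\<^sub>v m \<in> carrier_vec (p + m)" using c by simp
  let ?v = "transpose_mat \<beta> *\<^sub>v (A *\<^sub>v \<xi> ?s)" and ?w = "transpose_mat \<beta> *\<^sub>v (u t @\<^sub>v 0\<^sub>v m)"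
  have vc: "?v \<in> carrier_vec n" by (rule mult_mat_vec_carrier[OF \<beta>t_carrier[OF \<beta>(1)] Axc])
  have wc: "?w \<in> carrier_vec n" by (rule mult_mat_vec_carrier[OF \<beta>t_carrier[OF \<beta>(1)] u0])
  have dF: "F X - F X' = ?v + ?w"
    unfolding \<beta>(2) dX by (rule mult_add_distrib_mat_vec[OF \<beta>t_carrier[OF \<beta>(1)] Axc u0])
  have mu0: "\<mu> @\<^sub>v 0\<^sub>v m \<in> carrier_vec n" using \<mu> by simp
  have FXc: "F X \<in> carrier_vec n" "F X' \<in> carrier_vec n" using Xc by auto
  have xi1: "\<xi> (int t) = (\<mu> @\<^sub>v 0\<^sub>v m) + F X" using xi_eq_F[OF s(2)] by (simp add: X_def)
  have xi0: "\<xi> ?s = (\<mu> @\<^sub>v 0\<^sub>v m) + F X'" using xi_eq_F[OF s(1)] by (simp add: X'_def)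
  have "\<xi> (int t) = \<xi> ?s + (F X - F X')"
    unfolding xi1 xi0 using carrier_vecD[OF mu0] carrier_vecD[OF FXc(1)] carrier_vecD[OF FXc(2)]
    by (intro eq_vecI) auto
  also have "\<dots> = (\<xi> ?s + ?v) + ?w" unfolding dF by (rule assoc_add_vec[OF xs vc wc, symmetric])
  also have "\<xi> ?s + ?v = (1\<^sub>m n + transpose_mat \<beta> * A) *\<^sub>v \<xi> ?s" by (rule step_mult[OF \<beta>(1) xs, symmetric])
  finally show thesis using that \<beta>(1) by blast
qed

text \<open>The rows of \<open>[\<alpha>\<^sub>\<bottom>\<^sup>T, -\<alpha>\<^sub>\<bottom>\<^sup>T E\<^sup>T]\<close> annihilate the block matrix \<open>A\<close>, so along a path the
  corresponding combinations of the state only accumulate the shocks.\<close>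
lemma common_trend:
  "\<alpha>pt *\<^sub>v (f 0 (z (int t)) - Et *\<^sub>v \<zeta> (int t - 1)) = \<alpha>pt *\<^sub>v hbar p k f z + \<alpha>pt *\<^sub>v vsum p u {1..t}"
proof (induction t)
  case 0
  have zi: "z (- int i) \<in> carrier_vec p" if "i \<in> {1..k-1}" for i using that k by (intro z) auto
  have v: "vsum p (\<lambda>i. g i (z (- int i))) {1..k-1} \<in> carrier_vec p" using zi by (intro vsum_carrier) auto
  have "Et *\<^sub>v \<zeta> (int 0 - 1) = vsum p (\<lambda>i. g i (z (- int i))) {1..k-1}"
  proof (rule eq_vecI)
    fix a assume "a < dim_vec (vsum p (\<lambda>i. g i (z (- int i))) {1..k-1})"
    then have a: "a < p" by (simp only: carrier_vecD[OF v])
    have "(Et *\<^sub>v \<zeta> (int 0 - 1)) $ a = (\<Sum>i=1..k-1. g i (z (int 0 - 1 - int i + 1)) $ a)"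
      using a by (intro Et_zeta_index z) auto
    also have "\<dots> = vsum p (\<lambda>i. g i (z (- int i))) {1..k-1} $ a"
      using a zi by (subst vsum_index) auto
    finally show "(Et *\<^sub>v \<zeta> (int 0 - 1)) $ a = vsum p (\<lambda>i. g i (z (- int i))) {1..k-1} $ a" .
  qed (simp add: carrier_vecD[OF v])
  then have "f 0 (z (int 0)) - Et *\<^sub>v \<zeta> (int 0 - 1) = hbar p k f z" by (simp add: hbar_def)
  moreover have hb: "hbar p k f z \<in> carrier_vec p" unfolding hbar_def using v by simp
  moreover have "vsum p u {1..0} = 0\<^sub>v p" by (auto simp: vsum_def finsum_vec_empty)
  moreover have "\<alpha>pt *\<^sub>v 0\<^sub>v p = 0\<^sub>v (p - r)" using \<alpha>p by (auto intro!: eq_vecI)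
  ultimately show ?case using right_zero_vec[OF \<alpha>pt_mult_carrier[OF hb]] by simp
next
  case (Suc t)
  let ?s = "int t"
  have t: "Suc t \<ge> 1" by simp
  define y where "y = \<alpha> *\<^sub>v (\<mu> + \<theta> (z ?s))"
  have mt: "\<mu> + \<theta> (z ?s) \<in> carrier_vec r" by (intro add_carrier_vec \<mu> \<theta> z_carrier) simp
  have c: "f 0 (z ?s) \<in> carrier_vec p" "y \<in> carrier_vec p" "u (Suc t) \<in> carrier_vec p"
    "Et *\<^sub>v \<zeta> ?s \<in> carrier_vec p" "Et *\<^sub>v \<zeta> (?s - 1) \<in> carrier_vec p"
    using \<alpha> mt u by (auto simp: y_def)
  have kc: "f 0 (z ?s) - Et *\<^sub>v \<zeta> (?s - 1) \<in> carrier_vec p" using c by simp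
  have us: "vsum p u {1..t} \<in> carrier_vec p" using u by (intro vsum_carrier) auto
  have step: "f 0 (z (int (Suc t))) = f 0 (z ?s) + (y + Et *\<^sub>v (\<zeta> ?s - \<zeta> (?s - 1))) + u (Suc t)"
    using f0_step[OF t] by (simp add: y_def)
  have "f 0 (z (int (Suc t))) - Et *\<^sub>v \<zeta> ?s = (f 0 (z ?s) - Et *\<^sub>v \<zeta> (?s - 1)) + (y + u (Suc t))"
    unfolding step mult_minus_distrib_mat_vec[OF Et_carrier zeta_carrier zeta_carrier]
    using c[THEN carrier_vecD] by (intro eq_vecI) auto
  then have "\<alpha>pt *\<^sub>v (f 0 (z (int (Suc t))) - Et *\<^sub>v \<zeta> ?s)
      = \<alpha>pt *\<^sub>v (f 0 (z ?s) - Et *\<^sub>v \<zeta> (?s - 1)) + (\<alpha>pt *\<^sub>v y + \<alpha>pt *\<^sub>v u (Suc t))"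
    using mult_add_distrib_mat_vec[OF \<alpha>pt_carrier kc add_carrier_vec[OF c(2,3)]]
      mult_add_distrib_mat_vec[OF \<alpha>pt_carrier c(2,3)] by simp
  also have "\<alpha>pt *\<^sub>v y = 0\<^sub>v (p - r)" unfolding y_def by (rule \<alpha>pt_\<alpha>[OF mt])
  also have "0\<^sub>v (p - r) + \<alpha>pt *\<^sub>v u (Suc t) = \<alpha>pt *\<^sub>v u (Suc t)"
    by (rule left_zero_vec[OF \<alpha>pt_mult_carrier[OF c(3)]])
  also have "\<alpha>pt *\<^sub>v (f 0 (z ?s) - Et *\<^sub>v \<zeta> (?s - 1)) = \<alpha>pt *\<^sub>v hbar p k f z + \<alpha>pt *\<^sub>v vsum p u {1..t}" by (rule Suc)
  also have "\<alpha>pt *\<^sub>v hbar p k f z + \<alpha>pt *\<^sub>v vsum p u {1..t} + \<alpha>pt *\<^sub>v u (Suc t)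
      = \<alpha>pt *\<^sub>v hbar p k f z + (\<alpha>pt *\<^sub>v vsum p u {1..t} + \<alpha>pt *\<^sub>v u (Suc t))"
  proof (rule assoc_add_vec)
    have "z (- int i) \<in> carrier_vec p" if "i \<in> {1..k-1}" for i using that k by (intro z) auto
    then have "vsum p (\<lambda>i. g i (z (- int i))) {1..k-1} \<in> carrier_vec p" by (intro vsum_carrier) auto
    then show "\<alpha>pt *\<^sub>v hbar p k f z \<in> carrier_vec (p - r)" unfolding hbar_def by simp
  qed (use us c in auto)
  also have "\<alpha>pt *\<^sub>v vsum p u {1..t} + \<alpha>pt *\<^sub>v u (Suc t) = \<alpha>pt *\<^sub>v (vsum p u {1..t} + u (Suc t))"
    by (rule mult_add_distrib_mat_vec[OF \<alpha>pt_carrier us c(3), symmetric])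
  also have "vsum p u {1..t} + u (Suc t) = vsum p u {1..Suc t}"
  proof (rule eq_vecI)
    have vS: "vsum p u {1..Suc t} \<in> carrier_vec p" using u by (intro vsum_carrier) auto
    then show "dim_vec (vsum p u {1..t} + u (Suc t)) = dim_vec (vsum p u {1..Suc t})"
      using carrier_vecD[OF c(3)] carrier_vecD[OF vS] by simp
    fix a assume "a < dim_vec (vsum p u {1..Suc t})"
    then have a: "a < p" by (simp only: carrier_vecD[OF vS])
    have "vsum p u {1..t} $ a = (\<Sum>s=1..t. u s $ a)" using u a by (intro vsum_index) auto
    moreover have "vsum p u {1..Suc t} $ a = (\<Sum>s=1..Suc t. u s $ a)" using u a by (intro vsum_index) auto
    moreover have "a < dim_vec (u (Suc t))" using a by (simp only: carrier_vecD[OF c(3)])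
    ultimately show "(vsum p u {1..t} + u (Suc t)) $ a = vsum p u {1..Suc t} $ a" by simp
  qed
  finally show ?case by simp
qed

section \<open>The row of identity blocks in \<open>Schi\<close> and the values of \<chi> along the
  path\<close>

definition J :: "real mat" where
  "J = mat p m (\<lambda>(a,b). if b mod p = a then 1 else 0)"

lemma J_carrier: "J \<in> carrier_mat p m"
  by (simp add: J_def)

lemma J_mult_index:
  assumes d: "d \<in> carrier_vec m" and a: "a < p"
  shows "(J *\<^sub>v d) $ a = (\<Sum>j<k-1. d $ (j * p + a))"
proof -
  have "(J *\<^sub>v d) $ a = (\<Sum>b=0..<m. (if b mod p = a then 1 else 0) * d $ b)"
    using d a by (simp add: J_def scalar_prod_def)
  also have "\<dots> = (\<Sum>b<m. if b mod p = a then d $ b else 0)"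
    by (intro sum.cong) (auto simp: lessThan_atLeast0)
  also have "\<dots> = (\<Sum>j<k-1. d $ (j * p + a))" by (rule sum_residue_class[OF a])
  finally show ?thesis .
qed

lemma block_index_less: "j < k - 1 \<Longrightarrow> a < p \<Longrightarrow> j * p + a < m"
proof -
  assume j: "j < k - 1" and a: "a < p"
  have "j * p + a < Suc j * p" using a by simp
  also have "\<dots> \<le> (k - 1) * p" using j by (intro mult_le_mono1) simp
  finally show ?thesis by (simp add: mult.commute)
qed

text \<open>The block sum telescopes over the superdiagonal of \<open>D\<close>.\<close>
lemma J_gstack_plus_D:
  assumes w: "w \<in> carrier_vec p" and d: "d \<in> carrier_vec m"
  shows "f 0 w - Et *\<^sub>v d = hfun p k f w + J *\<^sub>v (gstack p k f w + Dmat p k *\<^sub>v d)"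
proof (rule eq_vecI)
  let ?d = "gstack p k f w + Dmat p k *\<^sub>v d"
  have c: "?d \<in> carrier_vec m" "Et *\<^sub>v d \<in> carrier_vec p" "J *\<^sub>v ?d \<in> carrier_vec p"
    using d J_carrier by auto
  show "dim_vec (f 0 w - Et *\<^sub>v d) = dim_vec (hfun p k f w + J *\<^sub>v ?d)"
    using c(2,3)[THEN carrier_vecD] by simp
  fix a assume "a < dim_vec (hfun p k f w + J *\<^sub>v ?d)"
  then have a: "a < p" using c(3)[THEN carrier_vecD] by simp
  \<comment> \<open>The value 0 past the last block mirrors the missing superdiagonal entry there,
    so the telescoping sum leaves minus the first block of \<open>d\<close>.\<close>
  define v where "v j = (if j < k - 1 then d $ (j * p + a) else 0)" for j
  have D: "(Dmat p k *\<^sub>v d) $ (j * p + a) = v (Suc j) - v j" if j: "j < k - 1" for j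
  proof -
    have l: "j * p + a < m" by (rule block_index_less[OF j a])
    have "j * p + a + p < m \<longleftrightarrow> Suc j < k - 1"
    proof
      assume "Suc j < k - 1"
      from block_index_less[OF this a] show "j * p + a + p < m" by (simp add: algebra_simps)
    next
      assume "j * p + a + p < m"
      then have "Suc j * p < (k - 1) * p" by (simp add: algebra_simps)
      then show "Suc j < k - 1" by (simp only: mult_less_cancel2)
    qed
    then show ?thesis using Dmat_mult_index[OF p d l] j by (simp add: v_def algebra_simps)
  qed
  have gj: "gstack p k f w $ (j * p + a) = g (j + 1) w $ a" if j: "j < k - 1" for j
  proof -
    have "(j * p + a) div p + 1 = j + 1" "(j * p + a) mod p = a" using a by auto
    then show ?thesis using gstack_index[OF block_index_less[OF j a], of w] by (simp only:)
  qed
  have "(J *\<^sub>v ?d) $ a = (\<Sum>j<k-1. ?d $ (j * p + a))" by (rule J_mult_index[OF c(1) a])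
  also have "\<dots> = (\<Sum>j<k-1. g (j + 1) w $ a + (v (Suc j) - v j))"
    using D gj block_index_less[OF _ a] by (intro sum.cong) auto
  also have "\<dots> = (\<Sum>j<k-1. g (j + 1) w $ a) + (v (k - 1) - v 0)"
    by (simp add: sum.distrib sum_lessThan_telescope)
  also have "(\<Sum>j<k-1. g (j + 1) w $ a) = (\<Sum>i=1..k-1. g i w $ a)"
    using sum.shift_bounds_Suc_ivl[of "\<lambda>i. g i w $ a" 0 "k - 1"]
    by (simp add: lessThan_atLeast0 atLeastLessThanSuc_atLeastAtMost One_nat_def)
  also have "v (k - 1) - v 0 = - (Et *\<^sub>v d) $ a"
  proof (cases "k - 1 = 0")
    case True
    then show ?thesis using Emat_transpose_mult_index[OF d a] by (simp add: v_def)
  next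
    case False
    then have "a < m" using block_index_less[of 0 a] a by simp
    then show ?thesis using Emat_transpose_mult_index[OF d a] False by (simp add: v_def)
  qed
  finally have Ja: "(J *\<^sub>v ?d) $ a = (\<Sum>i=1..k-1. g i w $ a) - (Et *\<^sub>v d) $ a" by simp
  have "(f 0 w - Et *\<^sub>v d) $ a = f 0 w $ a - (Et *\<^sub>v d) $ a"
    using a by simp
  moreover have "(hfun p k f w + J *\<^sub>v ?d) $ a = hfun p k f w $ a + (J *\<^sub>v ?d) $ a"
    using a by (simp add: J_def)
  ultimately show "(f 0 w - Et *\<^sub>v d) $ a = (hfun p k f w + J *\<^sub>v ?d) $ a"
    using Ja h_index[OF w a] by simp
qed

lemma Schi_mult:
  assumes a: "a \<in> carrier_vec r" and d: "d \<in> carrier_vec m"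
  shows "S\<chi> *\<^sub>v (a @\<^sub>v d) = (- \<alpha>pt *\<^sub>v (J *\<^sub>v d)) @\<^sub>v a"
proof -
  let ?P = "four_block_mat (- \<alpha>pt) (0\<^sub>m (p - r) r) (0\<^sub>m r p) (1\<^sub>m r)"
  let ?Q = "four_block_mat (0\<^sub>m p r) J (1\<^sub>m r) (0\<^sub>m r m)"
  have Jd: "J *\<^sub>v d \<in> carrier_vec p" using J_carrier d by simp
  have \<alpha>c: "- \<alpha>pt \<in> carrier_mat (p - r) p" using \<alpha>pt_carrier by simp
  have P: "?P \<in> carrier_mat ((p - r) + r) (p + r)" by (rule four_block_carrier_mat[OF \<alpha>c]) simp
  have Q: "?Q \<in> carrier_mat (p + r) (r + m)" by (rule four_block_carrier_mat) auto
  have "S\<chi> *\<^sub>v (a @\<^sub>v d) = ?P *\<^sub>v (?Q *\<^sub>v (a @\<^sub>v d))"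
    unfolding Schi_def J_def[symmetric] by (rule assoc_mult_mat_vec[OF P Q]) (use a d in simp)
  also have "?Q *\<^sub>v (a @\<^sub>v d) = (0\<^sub>m p r *\<^sub>v a + J *\<^sub>v d) @\<^sub>v (1\<^sub>m r *\<^sub>v a + 0\<^sub>m r m *\<^sub>v d)"
    by (rule four_block_mat_mult_vec) (use a d J_carrier in auto)
  also have "0\<^sub>m p r *\<^sub>v a + J *\<^sub>v d = J *\<^sub>v d"
    using a J_carrier by (intro eq_vecI) auto
  also have "1\<^sub>m r *\<^sub>v a + 0\<^sub>m r m *\<^sub>v d = a"
    using a d by (intro eq_vecI) auto
  also have "?P *\<^sub>v (J *\<^sub>v d @\<^sub>v a) = (- \<alpha>pt *\<^sub>v (J *\<^sub>v d) + 0\<^sub>m (p - r) r *\<^sub>v a) @\<^sub>v (0\<^sub>m r p *\<^sub>v (J *\<^sub>v d) + 1\<^sub>m r *\<^sub>v a)"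
    by (rule four_block_mat_mult_vec) (use a Jd \<alpha>c in auto)
  also have "- \<alpha>pt *\<^sub>v (J *\<^sub>v d) + 0\<^sub>m (p - r) r *\<^sub>v a = - \<alpha>pt *\<^sub>v (J *\<^sub>v d)"
    using a \<alpha>p by (intro eq_vecI) auto
  also have "0\<^sub>m r p *\<^sub>v (J *\<^sub>v d) + 1\<^sub>m r *\<^sub>v a = a"
    using a Jd by (intro eq_vecI) auto
  finally show ?thesis .
qed

text \<open>The trend is known for \<open>f 0\<close> minus the lagged stack, whereas \<chi> uses
  \<open>h\<close>, the same expression for a path at rest. The two differ by the block sum of the
  increment of \<zeta>, which the minus sign in \<open>Schi\<close> removes; in the lower block
  -\<mu> cancels the \<mu> contained in \<xi>.\<close>

lemma \<chi>_path:
  "\<chi> (z (int t)) = ((\<alpha>pt *\<^sub>v hbar p k f z + \<alpha>pt *\<^sub>v vsum p u {1..t}) @\<^sub>v (- \<mu>)) + S\<chi> *\<^sub>v \<xi> (int t)"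
proof -
  let ?w = "z (int t)" and ?d = "\<zeta> (int t) - \<zeta> (int t - 1)"
  have w: "?w \<in> carrier_vec p" by simp
  have d: "?d \<in> carrier_vec m" by simp
  have Jd: "J *\<^sub>v ?d \<in> carrier_vec p" using J_carrier d by simp
  have "gstack p k f ?w + Dmat p k *\<^sub>v \<zeta> (int t - 1) = ?d"
    by (intro gstack_plus_D_zeta z) simp
  then have split: "f 0 ?w - Et *\<^sub>v \<zeta> (int t - 1) = hfun p k f ?w + J *\<^sub>v ?d"
    using J_gstack_plus_D[OF w zeta_carrier, of z "int t - 1"] by simp
  have trend: "\<alpha>pt *\<^sub>v hbar p k f z + \<alpha>pt *\<^sub>v vsum p u {1..t} = \<alpha>pt *\<^sub>v hfun p k f ?w + \<alpha>pt *\<^sub>v (J *\<^sub>v ?d)"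
    unfolding common_trend[of t, symmetric] split
    by (rule mult_add_distrib_mat_vec[OF \<alpha>pt_carrier h_carrier[OF w] Jd])
  have mt: "\<mu> + \<theta> ?w \<in> carrier_vec r" using \<mu> by simp
  have neg: "- \<alpha>pt *\<^sub>v (J *\<^sub>v ?d) \<in> carrier_vec (p - r)"
    by (rule mult_mat_vec_carrier[OF _ Jd]) (use \<alpha>pt_carrier in simp)
  have c: "\<alpha>pt *\<^sub>v hfun p k f ?w \<in> carrier_vec (p - r)" "\<alpha>pt *\<^sub>v (J *\<^sub>v ?d) \<in> carrier_vec (p - r)"
    using w Jd by auto
  have "((\<alpha>pt *\<^sub>v hfun p k f ?w + \<alpha>pt *\<^sub>v (J *\<^sub>v ?d)) @\<^sub>v (- \<mu>)) + S\<chi> *\<^sub>v \<xi> (int t)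
      = ((\<alpha>pt *\<^sub>v hfun p k f ?w + \<alpha>pt *\<^sub>v (J *\<^sub>v ?d)) + (- \<alpha>pt *\<^sub>v (J *\<^sub>v ?d))) @\<^sub>v (- \<mu> + (\<mu> + \<theta> ?w))"
    using xi_eq[of "int t"] Schi_mult[OF mt d] append_vec_add[of _ "p - r" _ "- \<mu>" r] c neg \<mu> mt by simp
  also have "- \<mu> + (\<mu> + \<theta> ?w) = \<theta> ?w"
  proof -
    have "dim_vec (\<theta> ?w) = dim_vec \<mu>" by (simp only: carrier_vecD[OF \<mu>] carrier_vecD[OF \<theta>[OF w]])
    then show ?thesis by (intro eq_vecI) auto
  qed
  also have "- \<alpha>pt *\<^sub>v (J *\<^sub>v ?d) = - (\<alpha>pt *\<^sub>v (J *\<^sub>v ?d))"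
    using J_carrier \<alpha>p by (intro uminus_mult_mat_vec) auto
  also have "(\<alpha>pt *\<^sub>v hfun p k f ?w + \<alpha>pt *\<^sub>v (J *\<^sub>v ?d)) + - (\<alpha>pt *\<^sub>v (J *\<^sub>v ?d)) = \<alpha>pt *\<^sub>v hfun p k f ?w"
    using c[THEN carrier_vecD] by (intro eq_vecI) auto
  finally show ?thesis using trend by (simp add: chifun_def)
qed

end

theorem theorem3p1:
  fixes p k r :: nat and c \<mu> :: "real vec" and f :: "nat \<Rightarrow> real vec \<Rightarrow> real vec"
    and \<theta> :: "real vec \<Rightarrow> real vec" and \<alpha> \<alpha>p :: "real mat" and B :: "real mat set"
    and bb \<rho>b :: real and z :: "int \<Rightarrow> real vec" and u :: "nat \<Rightarrow> real vec"
  assumes "p \<ge> 1" and "k \<ge> 1" and "r < p"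
    and "var_model p k c f"
    and "in_class_M p k r \<alpha> bb \<rho>b c f \<mu> \<theta> B"
    and "\<alpha>p \<in> carrier_mat p (p - r)" and "vec_space.rank p \<alpha>p = p - r"
    and "transpose_mat \<alpha>p * \<alpha> = 0\<^sub>m (p - r) r"
    and "\<forall>t::int. t \<ge> 1 - int k \<longrightarrow> z t \<in> carrier_vec p"
    and "\<forall>t::nat. t \<ge> 1 \<longrightarrow> u t \<in> carrier_vec p"
    and "\<forall>t::nat. t \<ge> 1 \<longrightarrow>
           f 0 (z (int t)) = c + vsum p (\<lambda>i. f i (z (int t - int i))) {1..k} + u t"
  shows "homeo_vec p (chifun p k f \<alpha>p \<theta>)
    \<and> (\<forall>t::nat. t \<ge> 1 \<longrightarrow>
         z (int t) = vinv p (chifun p k f \<alpha>p \<theta>)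
            (((transpose_mat \<alpha>p *\<^sub>v hbar p k f z + transpose_mat \<alpha>p *\<^sub>v vsum p u {1..t}) @\<^sub>v (- \<mu>))
             + Schi p k r \<alpha>p *\<^sub>v xi p k r f \<mu> \<theta> z (int t)))
    \<and> (\<forall>t::nat. t \<ge> 1 \<longrightarrow>
         xi p k r f \<mu> \<theta> z (int t)
           = (\<mu> + \<theta> (z (int t))) @\<^sub>v (zeta p k f z (int t) - zeta p k f z (int t - 1)))
    \<and> (\<exists>\<beta> :: nat \<Rightarrow> real mat.
         (\<forall>t\<ge>1. \<beta> t \<in> B)
       \<and> (\<forall>t::nat. t \<ge> 1 \<longrightarrow>
            xi p k r f \<mu> \<theta> z (int t)
              = (1\<^sub>m (p*(k-1)+r) + transpose_mat (\<beta> t) * boldalpha p k r \<alpha>) *\<^sub>v xi p k r f \<mu> \<theta> z (int t - 1)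
                + transpose_mat (\<beta> t) *\<^sub>v (u t @\<^sub>v 0\<^sub>v (p*(k-1))))
       \<and> exp_stable (p*(k-1)+r)
           (\<lambda>t. 1\<^sub>m (p*(k-1)+r) + transpose_mat (\<beta> t) * boldalpha p k r \<alpha>)
           (\<lambda>t. transpose_mat (\<beta> t)) (\<lambda>t. 0\<^sub>v (p*(k-1)+r)))"
proof -
  interpret cointegrated_var_path p k r c \<mu> f \<theta> \<alpha> \<alpha>p B bb \<rho>b z u
    by unfold_locales (use assms in auto)
  obtain \<beta> where \<beta>: "\<And>t. t \<ge> 1 \<Longrightarrow> \<beta> t \<in> B \<and> \<xi> (int t)
      = (1\<^sub>m (p*(k-1)+r) + transpose_mat (\<beta> t) * A) *\<^sub>v \<xi> (int t - 1) + transpose_mat (\<beta> t) *\<^sub>v (u t @\<^sub>v 0\<^sub>v (p*(k-1)))"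
  proof -
    have "\<forall>t\<in>{1..}. \<exists>\<beta>. \<beta> \<in> B \<and> \<xi> (int t)
      = (1\<^sub>m (p*(k-1)+r) + transpose_mat \<beta> * A) *\<^sub>v \<xi> (int t - 1) + transpose_mat \<beta> *\<^sub>v (u t @\<^sub>v 0\<^sub>v (p*(k-1)))"
      using xi_step by (metis atLeast_iff)
    from bchoice[OF this] show thesis using that by auto
  qed
  have "exp_stable (p*(k-1)+r) (\<lambda>t. 1\<^sub>m (p*(k-1)+r) + transpose_mat (\<beta> t) * A)
           (\<lambda>t. transpose_mat (\<beta> t)) (\<lambda>t. 0\<^sub>v (p*(k-1)+r))"
    unfolding exp_stable_def
  proof (intro conjI)
    show "\<exists>K. \<forall>t\<ge>1. mnorm (transpose_mat (\<beta> t)) \<le> K" using \<beta> B_bounded by (intro exI[of _ bb]) simp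
    show "\<exists>K. \<forall>t\<ge>1::nat. vnorm (0\<^sub>v (p*(k-1)+r)) \<le> K" by blast
    obtain C \<gamma> b where "decaying_family (p*(k-1)+r) steps C \<gamma> b" using steps_decaying .
    then interpret decaying_family "p*(k-1)+r" steps C \<gamma> b .
    have "1\<^sub>m (p*(k-1)+r) + transpose_mat (\<beta> t) * A \<in> steps" if "t \<ge> 1" for t using \<beta>[OF that] by blast
    then show "\<exists>C \<rho>. 0 \<le> \<rho> \<and> \<rho> < 1 \<and> (\<forall>t\<ge>1.
        mnorm (mprod_seq (p*(k-1)+r) (\<lambda>t. 1\<^sub>m (p*(k-1)+r) + transpose_mat (\<beta> t) * A) t) \<le> C * \<rho> ^ t)"
      using mprod_seq_decay \<gamma>
      by (intro exI[of _ "(p*(k-1)+r) * C"] exI[of _ \<gamma>]) auto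
  qed
  moreover have "z (int t) = vinv p \<chi> (((\<alpha>pt *\<^sub>v hbar p k f z + \<alpha>pt *\<^sub>v vsum p u {1..t}) @\<^sub>v (- \<mu>)) + S\<chi> *\<^sub>v \<xi> (int t))" for t
    unfolding \<chi>_path[symmetric] by (rule vinv_\<chi>[symmetric]) simp
  moreover have "\<xi> (int t) = (\<mu> + \<theta> (z (int t))) @\<^sub>v (\<zeta> (int t) - \<zeta> (int t - 1))" for t :: nat
    by (rule xi_eq) simp
  ultimately show ?thesis using \<chi>_homeo \<beta> by blast
qed

end
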